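(* Let $X$ and $Y$ be infinite-dimensional complex Banach spaces and let $\alpha$ be a crossnorm on $X\otimes Y$, with completion $X\otimes_\alpha Y$. Suppose that $\mathcal{F}(X)$ and $\mathcal{F}(Y)$ are amenable and that $X\otimes_\alpha Y$ is a tight tensor product of $X$ and $Y$. Then $\mathcal{F}(X\otimes_\alpha Y)$ is amenable.
   Context: For a Banach space $Z$, $\mathcal{F}(Z)$ is the Banach algebra of approximable operators on $Z$: the operator-norm closure in $\mathcal{B}(Z)$ of the finite rank operators. A Banach algebra $\mathcal{A}$ is amenable if for every Banach $\mathcal{A}$-bimodule $Z$, every continuous derivation $D:\mathcal{A}\to Z^*$ is inner, i.e. of the form $a\mapsto a\cdot z^*-z^*\cdot a$ for some $z^*\in Z^*$. Here $Z^*$ carries the dual module actions $\langle a\cdot z^*,z\rangle=\langle z^*,z\cdot a\rangle$, $\langle z^*\cdot a,z\rangle=\langle z^*,a\cdot z\rangle$, and a derivation is a linear map with $D(ab)=a\cdot D(b)+D(a)\cdot b$. A crossnorm $\alpha$ on $X\otimes Y$ is a norm with $\alpha(x\otimes y)=\|x\|\|y\|$. The completion $X\otimes_\alpha Y$ is called a tight tensor product of $X$ and $Y$ if: (i) there is $K>0$ such that for all $S\in\mathcal{F}(X)$, $T\in\mathcal{F}(Y)$ the operator on $X\otimes Y$ given by $(S\otimes T)(x\otimes y)=Sx\otimes Ty$ has $\alpha$-operator norm not exceeding $K\|S\|\|T\|$ (so it extends to $X\otimes_\alpha Y$); (ii) $\operatorname{span}\{S\otimes T : S\in\mathcal{F}(X),\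 T\in\mathcal{F}(Y)\}$ is dense in $\mathcal{F}(X\otimes_\alpha Y)$. *)

theory Defs
  imports "HOL-Analysis.Analysis"
begin

section \<open>Complex Banach spaces\<close>

class complex_banach = banach +
  fixes scaleC :: "complex \<Rightarrow> 'a \<Rightarrow> 'a"  (infixr "*\<^sub>C" 75)
  assumes scaleC_add_right: "c *\<^sub>C (x + y) = c *\<^sub>C x + c *\<^sub>C y"
    and scaleC_add_left: "(c + d) *\<^sub>C x = c *\<^sub>C x + d *\<^sub>C x"
    and scaleC_scaleC: "c *\<^sub>C d *\<^sub>C x = (c * d) *\<^sub>C x"
    and scaleC_one: "1 *\<^sub>C x = x"
    and scaleR_scaleC: "r *\<^sub>R x = complex_of_real r *\<^sub>C x"
    and norm_scaleC: "norm (c *\<^sub>C x) = cmod c * norm x"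

global_interpretation complex_vector: vector_space "scaleC :: complex \<Rightarrow> 'a \<Rightarrow> 'a::complex_banach"
  by standard (simp_all add: scaleC_add_right scaleC_add_left scaleC_scaleC scaleC_one)

lemma bounded_linear_scaleC: "bounded_linear (\<lambda>x::'a::complex_banach. c *\<^sub>C x)"
  by (rule bounded_linear_intro[where K = "cmod c"])
     (simp_all add: scaleC_add_right scaleR_scaleC scaleC_scaleC norm_scaleC mult.commute)

text \<open>
  The library type of bounded operators consists of the real-linear ones; it is made a complex
  Banach space by pointwise scaling, and complex linearity is imposed by the predicate
  \<open>clinear_op\<close> below.
\<close>

instantiation blinfun :: (real_normed_vector, complex_banach) complex_banach
begin

lift_definition scaleC_blinfun :: "complex \<Rightarrow> ('a \<Rightarrow>\<^sub>L 'b) \<Rightarrow> ('a \<Rightarrow>\<^sub>L 'b)"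
  is "\<lambda>c f x. c *\<^sub>C f x"
  by (rule bounded_linear_compose[OF bounded_linear_scaleC])

lemma norm_scaleC_blinfun_le: "norm (c *\<^sub>C f) \<le> cmod c * norm f" for f :: "'a \<Rightarrow>\<^sub>L 'b"
proof (rule norm_blinfun_bound)
  fix x
  have "norm (blinfun_apply (c *\<^sub>C f) x) = cmod c * norm (blinfun_apply f x)"
    by (simp add: scaleC_blinfun.rep_eq norm_scaleC)
  also have "\<dots> \<le> cmod c * (norm f * norm x)"
    by (intro mult_left_mono norm_blinfun) auto
  finally show "norm (blinfun_apply (c *\<^sub>C f) x) \<le> cmod c * norm f * norm x"
    by (simp add: mult.assoc)
qed simp

instance
proof
  fix c d :: complex and f g :: "'a \<Rightarrow>\<^sub>L 'b" and r :: real
  show "c *\<^sub>C (f + g) = c *\<^sub>C f + c *\<^sub>C g"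
    by (rule blinfun_eqI) (simp add: scaleC_blinfun.rep_eq blinfun.add_left scaleC_add_right)
  show "(c + d) *\<^sub>C f = c *\<^sub>C f + d *\<^sub>C f"
    by (rule blinfun_eqI) (simp add: scaleC_blinfun.rep_eq blinfun.add_left scaleC_add_left)
  show assoc: "c *\<^sub>C d *\<^sub>C f = (c * d) *\<^sub>C f"
    for c d :: complex and f :: "'a \<Rightarrow>\<^sub>L 'b"
    by (rule blinfun_eqI) (simp add: scaleC_blinfun.rep_eq scaleC_scaleC)
  show one: "1 *\<^sub>C f = f" for f :: "'a \<Rightarrow>\<^sub>L 'b"
    by (rule blinfun_eqI) (simp add: scaleC_blinfun.rep_eq scaleC_one)
  show "r *\<^sub>R f = complex_of_real r *\<^sub>C f"
    by (rule blinfun_eqI) (simp add: scaleC_blinfun.rep_eq blinfun.scaleR_left scaleR_scaleC)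
  show "norm (c *\<^sub>C f) = cmod c * norm f"
  proof (cases "c = 0")
    case True
    then show ?thesis using norm_scaleC_blinfun_le[of c f] by simp
  next
    case False
    have "norm f = norm (inverse c *\<^sub>C c *\<^sub>C f)"
      using False by (simp add: assoc one)
    also have "\<dots> \<le> cmod (inverse c) * norm (c *\<^sub>C f)"
      by (rule norm_scaleC_blinfun_le)
    also have "\<dots> = norm (c *\<^sub>C f) / cmod c"
      by (simp add: norm_inverse divide_inverse mult.commute)
    finally have "cmod c * norm f \<le> norm (c *\<^sub>C f)"
      using False by (simp add: pos_le_divide_eq mult.commute)
    then show ?thesis using norm_scaleC_blinfun_le[of c f] by simp
  qed
qed

end

section \<open>Approximable operators\<close>

definition clinear_op :: "('a::complex_banach \<Rightarrow>\<^sub>L 'b::complex_banach) \<Rightarrow> bool" where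
  "clinear_op T \<longleftrightarrow> (\<forall>c x. blinfun_apply T (c *\<^sub>C x) = c *\<^sub>C blinfun_apply T x)"

definition finite_rank :: "('a::complex_banach \<Rightarrow>\<^sub>L 'b::complex_banach) \<Rightarrow> bool" where
  "finite_rank T \<longleftrightarrow> clinear_op T \<and>
     (\<exists>B. finite B \<and> range (blinfun_apply T) \<subseteq> complex_vector.span B)"

definition approximable :: "('a::complex_banach \<Rightarrow>\<^sub>L 'a) set" where
  "approximable = closure {T. finite_rank T}"

section \<open>Banach algebras, bimodules and amenability\<close>

definition banach_algebra :: "'a::complex_banach set \<Rightarrow> ('a \<Rightarrow> 'a \<Rightarrow> 'a) \<Rightarrow> bool" where
  "banach_algebra A m \<longleftrightarrow>
     complex_vector.subspace A \<and> closed A \<and>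
     (\<forall>a\<in>A. \<forall>b\<in>A. m a b \<in> A) \<and>
     (\<forall>a\<in>A. \<forall>b\<in>A. \<forall>c\<in>A. m (m a b) c = m a (m b c)) \<and>
     (\<forall>a\<in>A. \<forall>b\<in>A. \<forall>c\<in>A. m (a + b) c = m a c + m b c \<and> m a (b + c) = m a b + m a c) \<and>
     (\<forall>a\<in>A. \<forall>b\<in>A. \<forall>t. m (t *\<^sub>C a) b = t *\<^sub>C m a b \<and> m a (t *\<^sub>C b) = t *\<^sub>C m a b) \<and>
     (\<forall>a\<in>A. \<forall>b\<in>A. norm (m a b) \<le> norm a * norm b)"

text \<open>
  Amenability quantifies over all Banach bimodules, so modules cannot be types of class
  \<open>complex_banach\<close>: they are Banach space structures on subsets of a type \<open>'z\<close>.
\<close>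

record 'z banach_structure =
  points :: "'z set"
  vadd :: "'z \<Rightarrow> 'z \<Rightarrow> 'z"
  vzero :: 'z
  vscale :: "complex \<Rightarrow> 'z \<Rightarrow> 'z"
  vnorm :: "'z \<Rightarrow> real"

definition vdist :: "'z banach_structure \<Rightarrow> 'z \<Rightarrow> 'z \<Rightarrow> real" where
  "vdist Z x y = vnorm Z (vadd Z x (vscale Z (-1) y))"

definition banach_space :: "'z banach_structure \<Rightarrow> bool" where
  "banach_space Z \<longleftrightarrow>
     vzero Z \<in> points Z \<and>
     (\<forall>x\<in>points Z. \<forall>y\<in>points Z. vadd Z x y \<in> points Z) \<and>
     (\<forall>c. \<forall>x\<in>points Z. vscale Z c x \<in> points Z) \<and>
     (\<forall>x\<in>points Z. \<forall>y\<in>points Z. \<forall>z\<in>points Z.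
        vadd Z (vadd Z x y) z = vadd Z x (vadd Z y z)) \<and>
     (\<forall>x\<in>points Z. \<forall>y\<in>points Z. vadd Z x y = vadd Z y x) \<and>
     (\<forall>x\<in>points Z. vadd Z (vzero Z) x = x) \<and>
     (\<forall>x\<in>points Z. vadd Z x (vscale Z (-1) x) = vzero Z) \<and>
     (\<forall>c. \<forall>x\<in>points Z. \<forall>y\<in>points Z.
        vscale Z c (vadd Z x y) = vadd Z (vscale Z c x) (vscale Z c y)) \<and>
     (\<forall>c d. \<forall>x\<in>points Z. vscale Z (c + d) x = vadd Z (vscale Z c x) (vscale Z d x)) \<and>
     (\<forall>c d. \<forall>x\<in>points Z. vscale Z c (vscale Z d x) = vscale Z (c * d) x) \<and>
     (\<forall>x\<in>points Z. vscale Z 1 x = x) \<and>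
     (\<forall>x\<in>points Z. 0 \<le> vnorm Z x \<and> (vnorm Z x = 0 \<longleftrightarrow> x = vzero Z)) \<and>
     (\<forall>c. \<forall>x\<in>points Z. vnorm Z (vscale Z c x) = cmod c * vnorm Z x) \<and>
     (\<forall>x\<in>points Z. \<forall>y\<in>points Z. vnorm Z (vadd Z x y) \<le> vnorm Z x + vnorm Z y) \<and>
     (\<forall>s :: nat \<Rightarrow> 'z. (\<forall>n. s n \<in> points Z) \<and>
        (\<forall>e>0. \<exists>N. \<forall>i\<ge>N. \<forall>j\<ge>N. vdist Z (s i) (s j) < e) \<longrightarrow>
        (\<exists>l\<in>points Z. (\<lambda>n. vdist Z (s n) l) \<longlonglongrightarrow> 0))"

text \<open>Here \<open>l a z\<close> and \<open>r z a\<close> are the left action $a\cdot z$ and the right action $z\cdot a$.\<close>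

definition banach_bimodule ::
  "'a::complex_banach set \<Rightarrow> ('a \<Rightarrow> 'a \<Rightarrow> 'a) \<Rightarrow>
   'z banach_structure \<Rightarrow> ('a \<Rightarrow> 'z \<Rightarrow> 'z) \<Rightarrow> ('z \<Rightarrow> 'a \<Rightarrow> 'z) \<Rightarrow> bool" where
  "banach_bimodule A m Z l r \<longleftrightarrow>
     banach_space Z \<and>
     (\<forall>a\<in>A. \<forall>z\<in>points Z. l a z \<in> points Z \<and> r z a \<in> points Z) \<and>
     (\<forall>a\<in>A. \<forall>b\<in>A. \<forall>z\<in>points Z.
        l (a + b) z = vadd Z (l a z) (l b z) \<and> r z (a + b) = vadd Z (r z a) (r z b)) \<and>
     (\<forall>c. \<forall>a\<in>A. \<forall>z\<in>points Z.
        l (c *\<^sub>C a) z = vscale Z c (l a z) \<and> r z (c *\<^sub>C a) = vscale Z c (r z a)) \<and>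
     (\<forall>a\<in>A. \<forall>y\<in>points Z. \<forall>z\<in>points Z.
        l a (vadd Z y z) = vadd Z (l a y) (l a z) \<and> r (vadd Z y z) a = vadd Z (r y a) (r z a)) \<and>
     (\<forall>c. \<forall>a\<in>A. \<forall>z\<in>points Z.
        l a (vscale Z c z) = vscale Z c (l a z) \<and> r (vscale Z c z) a = vscale Z c (r z a)) \<and>
     (\<forall>a\<in>A. \<forall>b\<in>A. \<forall>z\<in>points Z.
        l a (l b z) = l (m a b) z \<and> r (r z a) b = r z (m a b) \<and> r (l a z) b = l a (r z b)) \<and>
     (\<exists>K. \<forall>a\<in>A. \<forall>z\<in>points Z.
        vnorm Z (l a z) \<le> K * norm a * vnorm Z z \<and> vnorm Z (r z a) \<le> K * norm a * vnorm Z z)"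

text \<open>
  Functionals are functions on the whole type \<open>'z\<close>; only their values on \<open>points Z\<close> matter, so
  equality in $Z^*$ is always stated as equality on \<open>points Z\<close>.
\<close>

definition dual :: "'z banach_structure \<Rightarrow> ('z \<Rightarrow> complex) set" where
  "dual Z = {f.
     (\<forall>x\<in>points Z. \<forall>y\<in>points Z. f (vadd Z x y) = f x + f y) \<and>
     (\<forall>c. \<forall>x\<in>points Z. f (vscale Z c x) = c * f x) \<and>
     (\<exists>K. \<forall>x\<in>points Z. cmod (f x) \<le> K * vnorm Z x)}"

definition dual_lact :: "('z \<Rightarrow> 'a \<Rightarrow> 'z) \<Rightarrow> 'a \<Rightarrow> ('z \<Rightarrow> complex) \<Rightarrow> ('z \<Rightarrow> complex)" where
  "dual_lact r a f = (\<lambda>z. f (r z a))"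

definition dual_ract :: "('a \<Rightarrow> 'z \<Rightarrow> 'z) \<Rightarrow> ('z \<Rightarrow> complex) \<Rightarrow> 'a \<Rightarrow> ('z \<Rightarrow> complex)" where
  "dual_ract l f a = (\<lambda>z. f (l a z))"

text \<open>
  The last clause is boundedness, i.e. continuity, of the linear map \<open>D\<close> for the dual norm:
  $\|D(a)\| \le K \|a\|$.
\<close>

definition dual_derivation ::
  "'a::complex_banach set \<Rightarrow> ('a \<Rightarrow> 'a \<Rightarrow> 'a) \<Rightarrow>
   'z banach_structure \<Rightarrow> ('a \<Rightarrow> 'z \<Rightarrow> 'z) \<Rightarrow> ('z \<Rightarrow> 'a \<Rightarrow> 'z) \<Rightarrow> ('a \<Rightarrow> 'z \<Rightarrow> complex) \<Rightarrow> bool" where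
  "dual_derivation A m Z l r D \<longleftrightarrow>
     (\<forall>a\<in>A. D a \<in> dual Z) \<and>
     (\<forall>a\<in>A. \<forall>b\<in>A. \<forall>z\<in>points Z. D (a + b) z = D a z + D b z) \<and>
     (\<forall>c. \<forall>a\<in>A. \<forall>z\<in>points Z. D (c *\<^sub>C a) z = c * D a z) \<and>
     (\<forall>a\<in>A. \<forall>b\<in>A. \<forall>z\<in>points Z.
        D (m a b) z = dual_lact r a (D b) z + dual_ract l (D a) b z) \<and>
     (\<exists>K. \<forall>a\<in>A. \<forall>z\<in>points Z. cmod (D a z) \<le> K * norm a * vnorm Z z)"

definition inner_derivation ::
  "'a set \<Rightarrow> 'z banach_structure \<Rightarrow> ('a \<Rightarrow> 'z \<Rightarrow> 'z) \<Rightarrow> ('z \<Rightarrow> 'a \<Rightarrow> 'z) \<Rightarrow>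
   ('a \<Rightarrow> 'z \<Rightarrow> complex) \<Rightarrow> bool" where
  "inner_derivation A Z l r D \<longleftrightarrow>
     (\<exists>f\<in>dual Z. \<forall>a\<in>A. \<forall>z\<in>points Z. D a z = dual_lact r a f z - dual_ract l f a z)"

text \<open>
  HOL has no quantification over types inside a formula, so the type \<open>'z\<close> from which the points
  of the modules are drawn is a parameter.  A theorem concluding \<open>amenable TYPE('z) A m\<close> for a
  type variable \<open>'z\<close> yields amenability with respect to all Banach bimodules.
\<close>

definition amenable ::
  "'z itself \<Rightarrow> 'a::complex_banach set \<Rightarrow> ('a \<Rightarrow> 'a \<Rightarrow> 'a) \<Rightarrow> bool" where
  "amenable (_ :: 'z itself) A m \<longleftrightarrow>
     banach_algebra A m \<and>
     (\<forall>(Z :: 'z banach_structure) l r. banach_bimodule A m Z l r \<longrightarrow>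
        (\<forall>D. dual_derivation A m Z l r D \<longrightarrow> inner_derivation A Z l r D))"

text \<open>
  As a hypothesis, amenability has to be required over one particular type, and that type must be
  large enough for this to mean amenability with respect to all modules.  The following one is:
  it contains copies of $A^*$ and of the quotient of the space $\mathrm{BL}^2(A)$ of bounded
  bilinear forms by the closed span of the forms $(a,b) \mapsto \varphi(ab)$ with
  $\varphi \in A^*$.  Derivations into the duals of these two modules (with suitable actions)
  already give a bounded approximate identity and a virtual diagonal for $A$, from which every
  continuous derivation into every dual module is inner (Johnson).
\<close>

type_synonym 'a module_universe = "('a \<Rightarrow> 'a \<Rightarrow> complex) set"

section \<open>Algebraic tensor products, crossnorms and completions\<close>

text \<open>
  $X \otimes Y$ is realised as the space of linear functionals on the bilinear forms on
  $X \times Y$ spanned by the evaluations $x \otimes y : B \mapsto B(x,y)$.  Functionals are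
  set to $0$ at functions that are not bilinear.  As $c(x \otimes y) = (cx) \otimes y$, the
  span consists of the finite sums of elementary tensors.
\<close>

type_synonym ('x, 'y) tensor = "('x \<Rightarrow> 'y \<Rightarrow> complex) \<Rightarrow> complex"

definition cbilinear_form :: "('x::complex_banach \<Rightarrow> 'y::complex_banach \<Rightarrow> complex) \<Rightarrow> bool" where
  "cbilinear_form B \<longleftrightarrow>
     (\<forall>x x' y. B (x + x') y = B x y + B x' y) \<and> (\<forall>c x y. B (c *\<^sub>C x) y = c * B x y) \<and>
     (\<forall>x y y'. B x (y + y') = B x y + B x y') \<and> (\<forall>c x y. B x (c *\<^sub>C y) = c * B x y)"

definition elem_tensor :: "'x::complex_banach \<Rightarrow> 'y::complex_banach \<Rightarrow> ('x, 'y) tensor" where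
  "elem_tensor x y = (\<lambda>B. if cbilinear_form B then B x y else 0)"

definition tensor_product :: "('x::complex_banach, 'y::complex_banach) tensor set" where
  "tensor_product =
     {u. \<exists>(n::nat) x y. u = (\<lambda>B. \<Sum>i<n. elem_tensor (x i) (y i) B)}"

definition crossnorm :: "(('x::complex_banach, 'y::complex_banach) tensor \<Rightarrow> real) \<Rightarrow> bool" where
  "crossnorm \<alpha> \<longleftrightarrow>
     (\<forall>u\<in>tensor_product. 0 \<le> \<alpha> u \<and> (\<alpha> u = 0 \<longleftrightarrow> u = (\<lambda>B. 0))) \<and>
     (\<forall>c. \<forall>u\<in>tensor_product. \<alpha> (\<lambda>B. c * u B) = cmod c * \<alpha> u) \<and>
     (\<forall>u\<in>tensor_product. \<forall>v\<in>tensor_product. \<alpha> (\<lambda>B. u B + v B) \<le> \<alpha> u + \<alpha> v) \<and>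
     (\<forall>x y. \<alpha> (elem_tensor x y) = norm x * norm y)"

text \<open>
  The Banach space \<open>'w\<close>, together with the embedding \<open>\<iota>\<close> of $X \otimes Y$, is a completion of
  $(X \otimes Y, \alpha)$.
\<close>

definition is_completion ::
  "(('x::complex_banach, 'y::complex_banach) tensor \<Rightarrow> real) \<Rightarrow>
   (('x, 'y) tensor \<Rightarrow> 'w::complex_banach) \<Rightarrow> bool" where
  "is_completion \<alpha> \<iota> \<longleftrightarrow>
     (\<forall>u\<in>tensor_product. \<forall>v\<in>tensor_product. \<iota> (\<lambda>B. u B + v B) = \<iota> u + \<iota> v) \<and>
     (\<forall>c. \<forall>u\<in>tensor_product. \<iota> (\<lambda>B. c * u B) = c *\<^sub>C \<iota> u) \<and>
     (\<forall>u\<in>tensor_product. norm (\<iota> u) = \<alpha> u) \<and>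
     closure (\<iota> ` tensor_product) = UNIV"

section \<open>Tight tensor products\<close>

definition tensor_op ::
  "('x::complex_banach \<Rightarrow>\<^sub>L 'x) \<Rightarrow> ('y::complex_banach \<Rightarrow>\<^sub>L 'y) \<Rightarrow> ('x, 'y) tensor \<Rightarrow> ('x, 'y) tensor" where
  "tensor_op S T u =
     (\<lambda>B. if cbilinear_form B then u (\<lambda>x y. B (blinfun_apply S x) (blinfun_apply T y)) else 0)"

text \<open>
  \<open>R\<close> is the extension of $S \otimes T$ to the completion; it is unique, as the range of \<open>\<iota>\<close> on
  $X \otimes Y$ is dense.
\<close>

definition extends_tensor_op ::
  "(('x::complex_banach, 'y::complex_banach) tensor \<Rightarrow> 'w::complex_banach) \<Rightarrow>
   ('x \<Rightarrow>\<^sub>L 'x) \<Rightarrow> ('y \<Rightarrow>\<^sub>L 'y) \<Rightarrow> ('w \<Rightarrow>\<^sub>L 'w) \<Rightarrow> bool" where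
  "extends_tensor_op \<iota> S T R \<longleftrightarrow>
     (\<forall>u\<in>tensor_product. blinfun_apply R (\<iota> u) = \<iota> (tensor_op S T u))"

definition tight_tensor_product ::
  "(('x::complex_banach, 'y::complex_banach) tensor \<Rightarrow> real) \<Rightarrow>
   (('x, 'y) tensor \<Rightarrow> 'w::complex_banach) \<Rightarrow> bool" where
  "tight_tensor_product \<alpha> \<iota> \<longleftrightarrow>
     (\<exists>K>0. \<forall>S\<in>approximable. \<forall>T\<in>approximable. \<forall>u\<in>tensor_product.
        \<alpha> (tensor_op S T u) \<le> K * norm S * norm T * \<alpha> u) \<and>
     closure (complex_vector.span
        {R. \<exists>S\<in>approximable. \<exists>T\<in>approximable. extends_tensor_op \<iota> S T R}) = approximable"

section \<open>Basic facts\<close>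

lemma subspace_finite_rank:
  "complex_vector.subspace {T :: 'a::complex_banach \<Rightarrow>\<^sub>L 'b::complex_banach. finite_rank T}"
proof (rule complex_vector.subspaceI)
  show "0 \<in> {T :: 'a \<Rightarrow>\<^sub>L 'b. finite_rank T}"
    by (auto simp: finite_rank_def clinear_op_def intro!: exI[of _ "{}"])
next
  fix S T :: "'a \<Rightarrow>\<^sub>L 'b"
  assume "S \<in> {T. finite_rank T}" "T \<in> {T. finite_rank T}"
  then obtain B C where B: "finite B" "range S \<subseteq> complex_vector.span B"
    and C: "finite C" "range T \<subseteq> complex_vector.span C"
    and lin: "clinear_op S" "clinear_op T"
    by (auto simp: finite_rank_def)
  have "range (S + T) \<subseteq> complex_vector.span (B \<union> C)"
  proof clarify
    fix x
    have "S x \<in> complex_vector.span (B \<union> C)" "T x \<in> complex_vector.span (B \<union> C)"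
      using B C complex_vector.span_mono[of B "B \<union> C"] complex_vector.span_mono[of C "B \<union> C"]
      by auto
    then show "(S + T) x \<in> complex_vector.span (B \<union> C)"
      by (simp add: blinfun.add_left complex_vector.span_add)
  qed
  moreover have "clinear_op (S + T)"
    using lin by (simp add: clinear_op_def blinfun.add_left scaleC_add_right)
  ultimately show "S + T \<in> {T. finite_rank T}"
    using B C by (auto simp: finite_rank_def intro!: exI[of _ "B \<union> C"])
next
  fix c and T :: "'a \<Rightarrow>\<^sub>L 'b"
  assume "T \<in> {T. finite_rank T}"
  then show "c *\<^sub>C T \<in> {T. finite_rank T}"
    by (fastforce simp: finite_rank_def clinear_op_def scaleC_blinfun.rep_eq scaleC_scaleC
        mult.commute intro: complex_vector.span_scale)
qed

lemma finite_rank_compose: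
  assumes "finite_rank S" "finite_rank T"
  shows "finite_rank (S o\<^sub>L T)"
  using assms by (fastforce simp: finite_rank_def clinear_op_def)

lemma banach_algebra_approximable:
  "banach_algebra (approximable :: ('a::complex_banach \<Rightarrow>\<^sub>L 'a) set) (o\<^sub>L)"
proof -
  let ?F = "{T :: 'a \<Rightarrow>\<^sub>L 'a. finite_rank T}"
  have sub: "complex_vector.subspace (closure ?F)"
  proof (rule complex_vector.subspaceI)
    show "0 \<in> closure ?F"
      using complex_vector.subspace_0[OF subspace_finite_rank] closure_subset by blast
  next
    fix S T :: "'a \<Rightarrow>\<^sub>L 'a"
    assume "S \<in> closure ?F" "T \<in> closure ?F"
    then obtain s t where "\<forall>n. s n \<in> ?F" "s \<longlonglongrightarrow> S" "\<forall>n. t n \<in> ?F" "t \<longlonglongrightarrow> T"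
      by (auto simp: closure_sequential)
    then show "S + T \<in> closure ?F"
      unfolding closure_sequential
      using complex_vector.subspace_add[OF subspace_finite_rank]
      by (intro exI[of _ "\<lambda>n. s n + t n"]) (auto intro: tendsto_add)
  next
    fix c and T :: "'a \<Rightarrow>\<^sub>L 'a"
    assume "T \<in> closure ?F"
    then obtain t where "\<forall>n. t n \<in> ?F" "t \<longlonglongrightarrow> T"
      by (auto simp: closure_sequential)
    then show "c *\<^sub>C T \<in> closure ?F"
      unfolding closure_sequential
      using complex_vector.subspace_scale[OF subspace_finite_rank]
      by (intro exI[of _ "\<lambda>n. c *\<^sub>C t n"])
         (auto intro: bounded_linear.tendsto[OF bounded_linear_scaleC])
  qed
  have mult: "S o\<^sub>L T \<in> closure ?F" if "S \<in> closure ?F" "T \<in> closure ?F" for S T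
  proof -
    from that obtain s t where "\<forall>n. s n \<in> ?F" "s \<longlonglongrightarrow> S" "\<forall>n. t n \<in> ?F" "t \<longlonglongrightarrow> T"
      by (auto simp: closure_sequential)
    then show ?thesis
      unfolding closure_sequential
      by (intro exI[of _ "\<lambda>n. s n o\<^sub>L t n"])
         (auto intro: finite_rank_compose
           bounded_bilinear.tendsto[OF bounded_bilinear_blinfun_compose])
  qed
  have closed_clinear: "clinear_op T" if "T \<in> closure ?F" for T
  proof -
    from that obtain t where t: "\<forall>n. finite_rank (t n)" "t \<longlonglongrightarrow> T"
      by (auto simp: closure_sequential)
    show ?thesis
      unfolding clinear_op_def
    proof (intro allI)
      fix c x
      have ev: "(\<lambda>n. t n y) \<longlonglongrightarrow> T y" for y
        using t(2) by (intro blinfun.tendsto) auto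
      have "(\<lambda>n. t n (c *\<^sub>C x)) = (\<lambda>n. c *\<^sub>C t n x)"
        using t(1) by (auto simp: finite_rank_def clinear_op_def)
      then show "T (c *\<^sub>C x) = c *\<^sub>C T x"
        using LIMSEQ_unique[OF ev[of "c *\<^sub>C x"]]
          bounded_linear.tendsto[OF bounded_linear_scaleC ev[of x]] by metis
    qed
  qed
  show ?thesis
    unfolding banach_algebra_def approximable_def
    using sub mult closed_clinear
    by (auto simp: norm_blinfun_compose clinear_op_def scaleC_blinfun.rep_eq
        blinfun.add_left blinfun.add_right intro!: blinfun_eqI)
qed

lemma tensor_op_elem_tensor:
  assumes "clinear_op S" "clinear_op T"
  shows "tensor_op S T (elem_tensor x y) = elem_tensor (blinfun_apply S x) (blinfun_apply T y)"
  using assms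
  by (auto simp: fun_eq_iff tensor_op_def elem_tensor_def cbilinear_form_def clinear_op_def
      blinfun.add_right)

end

theory Submission
  imports Defs
begin

text \<open>
  By Johnson, $A$ is amenable if and only if it has a virtual diagonal: a bounded functional $M$ on
  the bounded bilinear forms on $A$ with $M(F(cx,y)) = M(F(x,yc))$ and $M(\varphi(xyc)) = \varphi(c)$.
  If $M_X$ and $M_Y$ are virtual diagonals of $\mathcal{F}(X)$ and $\mathcal{F}(Y)$, then iterating them,
  $F \mapsto M_X((S,S') \mapsto M_Y((T,T') \mapsto F(S \otimes T, S' \otimes T')))$,
  satisfies both identities for $c = S_0 \otimes T_0$, hence by density for all $c$ in
  $\mathcal{F}(X \otimes_\alpha Y)$.
\<close>

section \<open>Spaces of bounded forms\<close>

text \<open>Two type constraints shape the proof. Amenability of the factors is available only for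
  modules whose points inject into \<open>module_universe\<close>, so their virtual diagonals must
  come from modules made of linear and bilinear forms on the algebra itself. In the other direction,
  a virtual diagonal has to serve modules over an arbitrary type. Nets and weak-star limits do not
  occur: a bounded approximate identity is replaced by a functional \<open>E\<close> on linear
  forms, for which \<open>E (\<lambda>x. z (a \<odot> x)) = z a\<close> stands for the equation a E
  = a in the bidual. Two obstacles remain. Johnson's module for the diagonal is a quotient; a
  projection along the product forms takes its place, at the price of a twisted right action. And a
  module need not be essential, so contracting a derivation with the diagonal implements it only up
  to a derivation whose values are killed by the left action of A; a second functional removes this
  remainder, in place of a reduction by Cohen factorisation.\<close>

definition wbounded :: "'i set \<Rightarrow> ('i \<Rightarrow> real) \<Rightarrow> real \<Rightarrow> ('i \<Rightarrow> complex) \<Rightarrow> bool" where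
  "wbounded I w K f \<longleftrightarrow> (\<forall>i\<in>I. cmod (f i) \<le> K * w i)"

lemma wboundedI: "(\<And>i. i \<in> I \<Longrightarrow> cmod (f i) \<le> K * w i) \<Longrightarrow> wbounded I w K f"
  by (simp add: wbounded_def)

lemma wboundedD: "wbounded I w K f \<Longrightarrow> i \<in> I \<Longrightarrow> cmod (f i) \<le> K * w i"
  by (simp add: wbounded_def)

lemma wbounded_add:
  assumes "wbounded I w K f" "wbounded I w K' g"
  shows "wbounded I w (K + K') (\<lambda>i. f i + g i)"
proof (rule wboundedI)
  fix i assume "i \<in> I"
  then show "cmod (f i + g i) \<le> (K + K') * w i"
    using norm_triangle_ineq[of "f i" "g i"] wboundedD[OF assms(1)] wboundedD[OF assms(2)]
    by (fastforce simp: distrib_right)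
qed

lemma wbounded_scale:
  assumes "wbounded I w K f"
  shows "wbounded I w (cmod c * K) (\<lambda>i. c * f i)"
  using assms by (auto simp: wbounded_def norm_mult mult.assoc intro: mult_left_mono)

text \<open>Forms on a subalgebra are functions on a whole type; this is the canonical
  representative among the functions that agree on \<open>I\<close>.\<close>

definition restrict_form :: "'i set \<Rightarrow> ('i \<Rightarrow> complex) \<Rightarrow> 'i \<Rightarrow> complex" where
  "restrict_form I f = (\<lambda>i. if i \<in> I then f i else 0)"

lemma restrict_form_apply [simp]: "i \<in> I \<Longrightarrow> restrict_form I f i = f i"
  by (simp add: restrict_form_def)

lemma restrict_form_outside [simp]: "i \<notin> I \<Longrightarrow> restrict_form I f i = 0"
  by (simp add: restrict_form_def)

lemma wbounded_restrict_form [simp]: "wbounded I w K (restrict_form I f) = wbounded I w K f"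
  by (simp add: wbounded_def)

text \<open>Instantiated twice: linear forms on \<open>A\<close> with weight \<open>norm\<close>,
  and bilinear forms on \<open>A \<times> A\<close> with weight \<open>norm2\<close>.
  \<open>limit_form\<close> asks for convergence on \<open>I\<close> only and for a bounded limit;
  completeness comes from it.\<close>

locale form_space =
  fixes I :: "'i set" and w :: "'i \<Rightarrow> real" and L :: "('i \<Rightarrow> complex) set"
  assumes weight_nonneg: "i \<in> I \<Longrightarrow> 0 \<le> w i"
    and zero_form: "(\<lambda>i. 0) \<in> L"
    and add_form: "f \<in> L \<Longrightarrow> g \<in> L \<Longrightarrow> (\<lambda>i. f i + g i) \<in> L"
    and scale_form: "f \<in> L \<Longrightarrow> (\<lambda>i. c * f i) \<in> L"
    and bounded_form: "f \<in> L \<Longrightarrow> \<exists>K. wbounded I w K f"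
    and limit_form: "(\<And>n. s n \<in> L) \<Longrightarrow> (\<And>i. i \<in> I \<Longrightarrow> (\<lambda>n::nat. s n i) \<longlonglongrightarrow> f i) \<Longrightarrow>
      wbounded I w K f \<Longrightarrow> f \<in> L"
begin

text \<open>The least admissible constant rather than a supremum of quotients, because the weight
  may vanish.\<close>

definition wnorm :: "('i \<Rightarrow> complex) \<Rightarrow> real" where
  "wnorm f = Inf {K. 0 \<le> K \<and> wbounded I w K f}"

text \<open>The axioms of a Banach space compare points by \<open>=\<close>, so forms are normalised to vanish off \<open>I\<close>.\<close>

definition forms :: "('i \<Rightarrow> complex) banach_structure" where
  "forms = \<lparr>points = {f \<in> L. \<forall>i. i \<notin> I \<longrightarrow> f i = 0}, vadd = (\<lambda>f g i. f i + g i),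
     vzero = (\<lambda>i. 0), vscale = (\<lambda>c f i. c * f i), vnorm = wnorm\<rparr>"

text \<open>A bounded functional on all of \<open>L\<close>, not only on the normalised forms. The
  bound refers to every admissible \<open>K\<close> instead of \<open>wnorm\<close>, so an estimate
  of a form on \<open>I\<close> can be used without computing its norm.\<close>

definition functional :: "(('i \<Rightarrow> complex) \<Rightarrow> complex) \<Rightarrow> bool" where
  "functional E \<longleftrightarrow>
     (\<forall>f\<in>L. \<forall>g\<in>L. E (\<lambda>i. f i + g i) = E f + E g) \<and>
     (\<forall>c. \<forall>f\<in>L. E (\<lambda>i. c * f i) = c * E f) \<and>
     (\<exists>C\<ge>0. \<forall>f\<in>L. \<forall>K\<ge>0. wbounded I w K f \<longrightarrow> cmod (E f) \<le> C * K)"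

lemma wbounded_mono: "wbounded I w K f \<Longrightarrow> K \<le> K' \<Longrightarrow> wbounded I w K' f"
  by (auto simp: wbounded_def intro: order_trans[OF _ mult_right_mono[OF _ weight_nonneg]])

lemma bounded_form_nonneg:
  assumes "f \<in> L" obtains K where "0 \<le> K" "wbounded I w K f"
proof -
  obtain K where "wbounded I w K f" using bounded_form[OF assms] by blast
  then have "wbounded I w (max 0 K) f" by (rule wbounded_mono) simp
  then show thesis using that[of "max 0 K"] by simp
qed

text \<open>The constant sequence \<open>f\<close> converges to \<open>g\<close> on
  \<open>I\<close>, so \<open>limit_form\<close> applies.\<close>

lemma cong_form:
  assumes "f \<in> L" "\<And>i. i \<in> I \<Longrightarrow> f i = g i"
  shows "g \<in> L"
proof -
  obtain K where "wbounded I w K f" using bounded_form assms(1) by blast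
  then have "wbounded I w K g" using assms(2) by (simp add: wbounded_def)
  then show ?thesis
    using limit_form[of "\<lambda>_. f" g K] assms by simp
qed

lemma restrict_form_in: "f \<in> L \<Longrightarrow> restrict_form I f \<in> L"
  using cong_form[of f "restrict_form I f"] by simp

lemma diff_form: "f \<in> L \<Longrightarrow> g \<in> L \<Longrightarrow> (\<lambda>i. f i - g i) \<in> L"
  using add_form[OF _ scale_form[of g "-1"], of f] by simp

lemma wnorm_least: "0 \<le> K \<Longrightarrow> wbounded I w K f \<Longrightarrow> wnorm f \<le> K"
  unfolding wnorm_def by (rule cInf_lower) (auto intro: bdd_belowI[of _ 0])

lemma wnorm_nonneg: "f \<in> L \<Longrightarrow> 0 \<le> wnorm f"
  unfolding wnorm_def by (rule cInf_greatest) (use bounded_form_nonneg in blast)+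

text \<open>The infimum is attained: where the weight is positive one divides by it, and where it is
  0 any admissible constant already forces the value 0.\<close>

lemma wbounded_wnorm:
  assumes "f \<in> L" shows "wbounded I w (wnorm f) f"
proof (rule wboundedI)
  fix i assume i: "i \<in> I"
  let ?S = "{K. 0 \<le> K \<and> wbounded I w K f}"
  have ne: "?S \<noteq> {}" using bounded_form_nonneg[OF assms] by blast
  show "cmod (f i) \<le> wnorm f * w i"
  proof (cases "w i = 0")
    case True
    then show ?thesis using ne i by (auto dest: wboundedD)
  next
    case False
    then have pos: "w i > 0" using weight_nonneg[OF i] by simp
    have "cmod (f i) / w i \<le> wnorm f"
      unfolding wnorm_def
      by (rule cInf_greatest[OF ne]) (use pos i in \<open>auto simp: divide_le_eq dest: wboundedD\<close>)
    then show ?thesis using pos by (simp add: divide_le_eq)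
  qed
qed

lemma norm_le_wnorm: "f \<in> L \<Longrightarrow> i \<in> I \<Longrightarrow> cmod (f i) \<le> wnorm f * w i"
  by (rule wboundedD[OF wbounded_wnorm])

lemma wnorm_add: "f \<in> L \<Longrightarrow> g \<in> L \<Longrightarrow> wnorm (\<lambda>i. f i + g i) \<le> wnorm f + wnorm g"
  by (intro wnorm_least wbounded_add wbounded_wnorm add_nonneg_nonneg wnorm_nonneg)

lemma wnorm_scale_le: "f \<in> L \<Longrightarrow> wnorm (\<lambda>i. c * f i) \<le> cmod c * wnorm f"
  by (intro wnorm_least wbounded_scale wbounded_wnorm mult_nonneg_nonneg wnorm_nonneg norm_ge_zero)

lemma wnorm_zero: "wnorm (\<lambda>i. 0) = 0"
  using wnorm_least[of 0 "\<lambda>i. 0"] wnorm_nonneg[OF zero_form] by (simp add: wbounded_def)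

lemma wnorm_scale:
  assumes "f \<in> L" shows "wnorm (\<lambda>i. c * f i) = cmod c * wnorm f"
proof (cases "c = 0")
  case True
  then show ?thesis by (simp add: wnorm_zero)
next
  case False
  have "wnorm (\<lambda>i. inverse c * (c * f i)) \<le> inverse (cmod c) * wnorm (\<lambda>i. c * f i)"
    unfolding norm_inverse[symmetric] using wnorm_scale_le scale_form assms by blast
  moreover have "(\<lambda>i. inverse c * (c * f i)) = f" using False by (auto simp: mult.assoc[symmetric])
  ultimately have "cmod c * wnorm f \<le> wnorm (\<lambda>i. c * f i)"
    using False by (simp add: inverse_eq_divide pos_le_divide_eq mult.commute)
  then show ?thesis using wnorm_scale_le[OF assms, of c] by simp
qed

section \<open>The Banach space of normalised forms\<close>

lemma forms_simps [simp]:
  "f \<in> points forms \<longleftrightarrow> f \<in> L \<and> (\<forall>i. i \<notin> I \<longrightarrow> f i = 0)"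
  "vadd forms f g = (\<lambda>i. f i + g i)" "vzero forms = (\<lambda>i. 0)"
  "vscale forms c f = (\<lambda>i. c * f i)" "vnorm forms = wnorm"
  "vdist forms f g = wnorm (\<lambda>i. f i - g i)"
  by (simp_all add: forms_def vdist_def)

text \<open>As for a sup norm: a Cauchy sequence is pointwise Cauchy on \<open>I\<close> with
  uniform control relative to the weight, and this control passes to the pointwise limit.\<close>

lemma forms_complete:
  assumes s: "\<And>n. s n \<in> points forms"
    and cauchy: "\<And>e. e > 0 \<Longrightarrow> \<exists>N. \<forall>i\<ge>N. \<forall>j\<ge>N. vdist forms (s i) (s j) < e"
  shows "\<exists>l\<in>points forms. (\<lambda>n. vdist forms (s n) l) \<longlonglongrightarrow> 0"
proof -
  have sL: "s n \<in> L" for n using s by simp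
  have close: "\<exists>N. \<forall>p\<ge>N. \<forall>q\<ge>N. \<forall>i\<in>I. cmod (s p i - s q i) \<le> e * w i" if e: "e > 0" for e
  proof -
    obtain N where "\<forall>p\<ge>N. \<forall>q\<ge>N. vdist forms (s p) (s q) < e"
      using cauchy[OF e] by blast
    then have N: "wnorm (\<lambda>i. s p i - s q i) < e" if "p \<ge> N" "q \<ge> N" for p q
      using that by simp
    have "cmod (s p i - s q i) \<le> e * w i" if "p \<ge> N" "q \<ge> N" "i \<in> I" for p q i
      using norm_le_wnorm[OF diff_form[OF sL[of p] sL[of q]] that(3)]
        mult_right_mono[OF less_imp_le[OF N[OF that(1,2)]] weight_nonneg[OF that(3)]] by linarith
    then show ?thesis by blast
  qed
  have "Cauchy (\<lambda>n. s n i)" if i: "i \<in> I" for i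
  proof (rule metric_CauchyI)
    fix e :: real assume e: "e > 0"
    \<comment> \<open>The added 1 keeps the denominator positive where the weight is 0.\<close>
    have pos: "w i + 1 > 0" using weight_nonneg[OF i] by simp
    obtain N where N: "cmod (s p i - s q i) \<le> e / (w i + 1) * w i" if "p \<ge> N" "q \<ge> N" for p q
      using close[of "e / (w i + 1)"] e pos i by fastforce
    have "e / (w i + 1) * w i < e" using e pos by (simp add: field_simps)
    then show "\<exists>N. \<forall>p\<ge>N. \<forall>q\<ge>N. dist (s p i) (s q i) < e"
      using order_le_less_trans[OF N] by (auto simp: dist_norm)
  qed
  then have lim: "(\<lambda>n. s n i) \<longlonglongrightarrow> lim (\<lambda>n. s n i)" if "i \<in> I" for i
    using that Cauchy_convergent convergent_LIMSEQ_iff by blast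
  define f where "f = restrict_form I (\<lambda>i. lim (\<lambda>n. s n i))"
  have lim_f: "(\<lambda>n. s n i) \<longlonglongrightarrow> f i" if "i \<in> I" for i
    using lim[OF that] that by (simp add: f_def)
  have near: "\<exists>N. \<forall>p\<ge>N. wbounded I w e (\<lambda>i. s p i - f i)" if e: "e > 0" for e
  proof -
    obtain N where N: "\<And>p q i. p \<ge> N \<Longrightarrow> q \<ge> N \<Longrightarrow> i \<in> I \<Longrightarrow> cmod (s p i - s q i) \<le> e * w i"
      using close[OF e] by blast
    have "cmod (s p i - f i) \<le> e * w i" if "p \<ge> N" "i \<in> I" for p i
    proof (rule LIMSEQ_le_const2)
      show "(\<lambda>q. cmod (s p i - s q i)) \<longlonglongrightarrow> cmod (s p i - f i)"
        by (intro tendsto_intros lim_f that)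
      show "\<exists>N. \<forall>q\<ge>N. cmod (s p i - s q i) \<le> e * w i" using N that by blast
    qed
    then show ?thesis by (auto simp: wbounded_def)
  qed
  \<comment> \<open>Boundedness of the limit, through \<open>f = s N - (s N - f)\<close> with both
    terms bounded.\<close>
  obtain N where N: "wbounded I w 1 (\<lambda>i. s N i - f i)" using near[of 1] by auto
  obtain K where K: "wbounded I w K (s N)" using bounded_form[OF sL] by blast
  have "wbounded I w (K + cmod (-1) * 1) (\<lambda>i. s N i + (-1) * (s N i - f i))"
    by (rule wbounded_add[OF K wbounded_scale[OF N]])
  then have fL: "f \<in> L" using limit_form[OF sL lim_f] by simp
  have "(\<lambda>n. wnorm (\<lambda>i. s n i - f i)) \<longlonglongrightarrow> 0"
  proof (rule LIMSEQ_I)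
    fix e :: real assume e: "e > 0"
    obtain N where N: "\<And>p. p \<ge> N \<Longrightarrow> wbounded I w (e/2) (\<lambda>i. s p i - f i)"
      using near[of "e/2"] e by auto
    have "norm (wnorm (\<lambda>i. s p i - f i) - 0) < e" if "p \<ge> N" for p
      using wnorm_least[OF _ N[OF that]] wnorm_nonneg[OF diff_form[OF sL fL], of p] e by simp
    then show "\<exists>no. \<forall>n\<ge>no. norm (wnorm (\<lambda>i. s n i - f i) - 0) < e" by blast
  qed
  then show ?thesis using fL by (intro bexI[of _ f]) (auto simp: f_def)
qed

lemma wnorm_eq_0:
  assumes "f \<in> points forms" shows "wnorm f = 0 \<longleftrightarrow> f = (\<lambda>i. 0)"
proof
  assume "wnorm f = 0"
  then have "f i = 0" for i
    using norm_le_wnorm[of f i] assms by (cases "i \<in> I") auto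
  then show "f = (\<lambda>i. 0)" by auto
qed (simp add: wnorm_zero)

lemma banach_space_forms: "banach_space forms"
  unfolding banach_space_def
proof (intro conjI allI ballI impI)
  fix s :: "nat \<Rightarrow> 'i \<Rightarrow> complex"
  assume "(\<forall>n. s n \<in> points forms) \<and>
    (\<forall>e>0. \<exists>N. \<forall>i\<ge>N. \<forall>j\<ge>N. vdist forms (s i) (s j) < e)"
  then show "\<exists>l\<in>points forms. (\<lambda>n. vdist forms (s n) l) \<longlonglongrightarrow> 0"
    using forms_complete by blast
next
  fix f assume "f \<in> points forms"
  then show "0 \<le> vnorm forms f" "vnorm forms f = 0 \<longleftrightarrow> f = vzero forms"
    using wnorm_nonneg wnorm_eq_0 by simp_all
next
  fix c d f assume "f \<in> points forms"
  then show "vnorm forms (vscale forms c f) = cmod c * vnorm forms f"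
      "vscale forms (c + d) f = vadd forms (vscale forms c f) (vscale forms d f)"
      "vscale forms c (vscale forms d f) = vscale forms (c * d) f"
      "vscale forms c f \<in> points forms"
    by (simp_all add: wnorm_scale scale_form distrib_right mult.assoc)
next
  fix f g assume "f \<in> points forms" "g \<in> points forms"
  then show "vnorm forms (vadd forms f g) \<le> vnorm forms f + vnorm forms g"
      "vadd forms f g \<in> points forms"
    by (simp_all add: wnorm_add add_form)
qed (simp_all add: zero_form distrib_left ac_simps)

section \<open>Bounded functionals on forms and the dual of \<open>forms\<close>\<close>

lemma functional_add: "functional E \<Longrightarrow> f \<in> L \<Longrightarrow> g \<in> L \<Longrightarrow> E (\<lambda>i. f i + g i) = E f + E g"
  by (simp add: functional_def)

lemma functional_scale: "functional E \<Longrightarrow> f \<in> L \<Longrightarrow> E (\<lambda>i. c * f i) = c * E f"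
  by (simp add: functional_def)

lemma functional_zero: "functional E \<Longrightarrow> E (\<lambda>i. 0) = 0"
  using functional_scale[OF _ zero_form, of E 0] by simp

lemma functional_diff: "functional E \<Longrightarrow> f \<in> L \<Longrightarrow> g \<in> L \<Longrightarrow> E (\<lambda>i. f i - g i) = E f - E g"
  using functional_add[of E f "\<lambda>i. (-1) * g i"] functional_scale[of E g "-1"] scale_form[of g "-1"]
  by simp

lemma functional_bound:
  assumes "functional E"
  obtains C where "0 \<le> C" "\<forall>f\<in>L. \<forall>K\<ge>0. wbounded I w K f \<longrightarrow> cmod (E f) \<le> C * K"
  using assms unfolding functional_def by blast

lemma functionalI:
  assumes "\<And>f g. f \<in> L \<Longrightarrow> g \<in> L \<Longrightarrow> E (\<lambda>i. f i + g i) = E f + E g"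
    and "\<And>c f. f \<in> L \<Longrightarrow> E (\<lambda>i. c * f i) = c * E f"
    and "0 \<le> C" "\<And>f K. f \<in> L \<Longrightarrow> 0 \<le> K \<Longrightarrow> wbounded I w K f \<Longrightarrow> cmod (E f) \<le> C * K"
  shows "functional E"
  using assms unfolding functional_def by blast

text \<open>A difference vanishing on \<open>I\<close> admits the bound 0, so a functional kills it.
  This justifies rewriting under a functional by identities that hold only for elements of the
  algebra.\<close>

lemma functional_cong:
  assumes E: "functional E" and "f \<in> L" and eq: "\<And>i. i \<in> I \<Longrightarrow> f i = g i"
  shows "E f = E g"
proof -
  have g: "g \<in> L" using cong_form assms by blast
  obtain C where C: "\<forall>f\<in>L. \<forall>K\<ge>0. wbounded I w K f \<longrightarrow> cmod (E f) \<le> C * K"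
    by (rule functional_bound[OF E])
  have "cmod (E (\<lambda>i. f i - g i)) \<le> C * 0"
    using assms g by (intro C[rule_format] diff_form) (auto simp: wbounded_def)
  then show ?thesis using functional_diff[OF E \<open>f \<in> L\<close> g] by simp
qed

lemma functional_dual: "functional E \<Longrightarrow> E \<in> dual forms"
proof -
  assume E: "functional E"
  obtain C where "\<forall>f\<in>L. \<forall>K\<ge>0. wbounded I w K f \<longrightarrow> cmod (E f) \<le> C * K"
    by (rule functional_bound[OF E])
  then have "\<forall>f\<in>points forms. cmod (E f) \<le> C * wnorm f"
    using wnorm_nonneg wbounded_wnorm by simp
  then show ?thesis
    using functional_add[OF E] functional_scale[OF E] by (auto simp: dual_def simp del: forms_simps(1)) auto
qed

text \<open>Membership in the dual constrains \<open>N\<close> on normalised forms only; normalising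
  the argument first gives a functional on all of \<open>L\<close>.\<close>

lemma dual_functional:
  assumes "N \<in> dual forms"
  shows "functional (\<lambda>f. N (restrict_form I f))"
proof -
  obtain C where C: "\<And>f. f \<in> points forms \<Longrightarrow> cmod (N f) \<le> C * wnorm f"
    using assms unfolding dual_def forms_simps(5) by blast
  have add: "N (\<lambda>i. f i + g i) = N f + N g" if "f \<in> points forms" "g \<in> points forms" for f g
    using assms that by (simp add: dual_def)
  have scale: "N (\<lambda>i. c * f i) = c * N f" if "f \<in> points forms" for f c
    using assms that by (simp add: dual_def)
  have r: "restrict_form I f \<in> points forms" if "f \<in> L" for f
    using restrict_form_in[OF that] by simp
  show ?thesis
  proof (rule functionalI)
    fix f g assume "f \<in> L" "g \<in> L"
    moreover have "restrict_form I (\<lambda>i. f i + g i) = (\<lambda>i. restrict_form I f i + restrict_form I g i)"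
      by (auto simp: restrict_form_def)
    ultimately show "N (restrict_form I (\<lambda>i. f i + g i)) = N (restrict_form I f) + N (restrict_form I g)"
      using add r by simp
  next
    fix f c assume "f \<in> L"
    moreover have "restrict_form I (\<lambda>i. c * f i) = (\<lambda>i. c * restrict_form I f i)"
      by (auto simp: restrict_form_def)
    ultimately show "N (restrict_form I (\<lambda>i. c * f i)) = c * N (restrict_form I f)"
      using scale r by simp
  next
    fix f K assume f: "f \<in> L" and K: "0 \<le> K" "wbounded I w K f"
    have "cmod (N (restrict_form I f)) \<le> C * wnorm (restrict_form I f)" using C r f by blast
    \<comment> \<open>\<open>dual\<close> does not ask its constant to be nonnegative, but
      multiplying the two inequalities does.\<close>
    also have "\<dots> \<le> max 0 C * K"
      using K wnorm_nonneg[OF restrict_form_in[OF f]] by (intro mult_mono wnorm_least) auto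
    finally show "cmod (N (restrict_form I f)) \<le> max 0 C * K" .
  qed simp
qed

lemma points_eqI:
  assumes "f \<in> points forms" "g \<in> points forms" "\<And>i. i \<in> I \<Longrightarrow> f i = g i"
  shows "f = g"
proof
  fix i show "f i = g i" using assms by (cases "i \<in> I") auto
qed

text \<open>Normalised forms are equal once they agree on \<open>I\<close>, so each module law may
  be checked pointwise there.\<close>

lemma forms_bimoduleI:
  assumes alg: "banach_algebra A m"
    and l: "\<And>a f. a \<in> A \<Longrightarrow> f \<in> points forms \<Longrightarrow> l a f \<in> points forms"
    and r: "\<And>a f. a \<in> A \<Longrightarrow> f \<in> points forms \<Longrightarrow> r f a \<in> points forms"
    and add_alg: "\<And>a b f i. a \<in> A \<Longrightarrow> b \<in> A \<Longrightarrow> f \<in> points forms \<Longrightarrow> i \<in> I \<Longrightarrow>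
      l (a + b) f i = l a f i + l b f i \<and> r f (a + b) i = r f a i + r f b i"
    and scale_alg: "\<And>a c f i. a \<in> A \<Longrightarrow> f \<in> points forms \<Longrightarrow> i \<in> I \<Longrightarrow>
      l (c *\<^sub>C a) f i = c * l a f i \<and> r f (c *\<^sub>C a) i = c * r f a i"
    and add: "\<And>a f g i. a \<in> A \<Longrightarrow> f \<in> points forms \<Longrightarrow> g \<in> points forms \<Longrightarrow> i \<in> I \<Longrightarrow>
      l a (\<lambda>i. f i + g i) i = l a f i + l a g i \<and> r (\<lambda>i. f i + g i) a i = r f a i + r g a i"
    and scale: "\<And>a c f i. a \<in> A \<Longrightarrow> f \<in> points forms \<Longrightarrow> i \<in> I \<Longrightarrow>
      l a (\<lambda>i. c * f i) i = c * l a f i \<and> r (\<lambda>i. c * f i) a i = c * r f a i"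
    and assoc: "\<And>a b f i. a \<in> A \<Longrightarrow> b \<in> A \<Longrightarrow> f \<in> points forms \<Longrightarrow> i \<in> I \<Longrightarrow>
      l a (l b f) i = l (m a b) f i \<and> r (r f a) b i = r f (m a b) i \<and> r (l a f) b i = l a (r f b) i"
    and K: "0 \<le> K"
    and bound: "\<And>a f C. a \<in> A \<Longrightarrow> f \<in> points forms \<Longrightarrow> 0 \<le> C \<Longrightarrow> wbounded I w C f \<Longrightarrow>
      wbounded I w (K * norm a * C) (l a f) \<and> wbounded I w (K * norm a * C) (r f a)"
  shows "banach_bimodule A m forms l r"
proof -
  have memA: "a + b \<in> A" "c *\<^sub>C a \<in> A" "m a b \<in> A" if "a \<in> A" "b \<in> A" for a b c
    using alg that by (auto simp: banach_algebra_def complex_vector.subspace_def)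
  have P: "(\<lambda>i. f i + g i) \<in> points forms" "(\<lambda>i. c * f i) \<in> points forms"
    if "f \<in> points forms" "g \<in> points forms" for f g c
    using that add_form scale_form by auto
  note pts = l r P memA
  have "l (a + b) f = (\<lambda>i. l a f i + l b f i)" "r f (a + b) = (\<lambda>i. r f a i + r f b i)"
    if "a \<in> A" "b \<in> A" "f \<in> points forms" for a b f
    using that add_alg by (auto intro!: points_eqI pts simp del: forms_simps(1))
  moreover have "l (c *\<^sub>C a) f = (\<lambda>i. c * l a f i)" "r f (c *\<^sub>C a) = (\<lambda>i. c * r f a i)"
    if "a \<in> A" "f \<in> points forms" for a c f
    using that scale_alg by (auto intro!: points_eqI pts simp del: forms_simps(1))
  moreover have "l a (\<lambda>i. f i + g i) = (\<lambda>i. l a f i + l a g i)"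
      "r (\<lambda>i. f i + g i) a = (\<lambda>i. r f a i + r g a i)"
    if "a \<in> A" "f \<in> points forms" "g \<in> points forms" for a f g
    using that add by (auto intro!: points_eqI pts simp del: forms_simps(1))
  moreover have "l a (\<lambda>i. c * f i) = (\<lambda>i. c * l a f i)" "r (\<lambda>i. c * f i) a = (\<lambda>i. c * r f a i)"
    if "a \<in> A" "f \<in> points forms" for a c f
    using that scale by (auto intro!: points_eqI pts simp del: forms_simps(1))
  moreover have "l a (l b f) = l (m a b) f" "r (r f a) b = r f (m a b)" "r (l a f) b = l a (r f b)"
    if "a \<in> A" "b \<in> A" "f \<in> points forms" for a b f
    using that assoc by (auto intro!: points_eqI pts simp del: forms_simps(1))
  moreover have "\<exists>K. \<forall>a\<in>A. \<forall>f\<in>points forms.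
      wnorm (l a f) \<le> K * norm a * wnorm f \<and> wnorm (r f a) \<le> K * norm a * wnorm f"
  proof (intro exI[of _ K] ballI)
    fix a f assume af: "a \<in> A" "f \<in> points forms"
    then have f: "f \<in> L" by simp
    have "0 \<le> K * norm a * wnorm f" using K wnorm_nonneg[OF f] by simp
    then show "wnorm (l a f) \<le> K * norm a * wnorm f \<and> wnorm (r f a) \<le> K * norm a * wnorm f"
      using bound[OF af wnorm_nonneg[OF f] wbounded_wnorm[OF f]] by (simp add: wnorm_least)
  qed
  ultimately show ?thesis
    unfolding banach_bimodule_def
    using l r banach_space_forms by (simp del: forms_simps(1))
qed

end

section \<open>Amenability tested on modules over a smaller type\<close>

lemma banach_spaceD:
  assumes "banach_space Z"
  shows "vzero Z \<in> points Z"
    and "x \<in> points Z \<Longrightarrow> y \<in> points Z \<Longrightarrow> vadd Z x y \<in> points Z"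
    and "x \<in> points Z \<Longrightarrow> vscale Z c x \<in> points Z"
    and "x \<in> points Z \<Longrightarrow> 0 \<le> vnorm Z x"
  using assms by (simp_all add: banach_space_def)

lemma banach_space_complete:
  assumes "banach_space Z" "\<forall>n. s n \<in> points Z"
    and "\<forall>e>0. \<exists>N. \<forall>i\<ge>N. \<forall>j\<ge>N. vdist Z (s i) (s j) < e"
  shows "\<exists>k\<in>points Z. (\<lambda>n. vdist Z (s n) k) \<longlonglongrightarrow> 0"
proof -
  have "\<forall>s :: nat \<Rightarrow> 'a. (\<forall>n. s n \<in> points Z) \<and>
        (\<forall>e>0. \<exists>N. \<forall>i\<ge>N. \<forall>j\<ge>N. vdist Z (s i) (s j) < e) \<longrightarrow>
        (\<exists>l\<in>points Z. (\<lambda>n. vdist Z (s n) l) \<longlonglongrightarrow> 0)"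
    using assms(1) unfolding banach_space_def by (elim conjE)
  then show ?thesis using assms(2,3) by simp
qed

text \<open>Transport the module, its actions and the derivation along \<open>h\<close>, then pull
  the implementing functional back. This is how amenability over \<open>module_universe\<close> is
  applied to modules of forms.\<close>

lemma amenable_transfer:
  fixes h :: "'v \<Rightarrow> 'u" and A :: "'a::complex_banach set" and Z :: "'v banach_structure"
  assumes am: "amenable TYPE('u) A m" and h: "inj h"
    and bim: "banach_bimodule A m Z l r" and D: "dual_derivation A m Z l r D"
  shows "inner_derivation A Z l r D"
proof -
  define g where "g = inv h"
  have [simp]: "g (h x) = x" for x by (simp add: g_def h)
  note [simp] = inj_image_mem_iff[OF h] inj_eq[OF h]
  define Z' where "Z' = \<lparr>points = h ` points Z, vadd = (\<lambda>u v. h (vadd Z (g u) (g v))),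
    vzero = h (vzero Z), vscale = (\<lambda>c u. h (vscale Z c (g u))), vnorm = (\<lambda>u. vnorm Z (g u))\<rparr>"
  have [simp]: "points Z' = h ` points Z" "vadd Z' u v = h (vadd Z (g u) (g v))"
    "vzero Z' = h (vzero Z)" "vscale Z' c u = h (vscale Z c (g u))" "vnorm Z' u = vnorm Z (g u)"
    for u v c by (simp_all add: Z'_def)
  define l' where "l' a u = h (l a (g u))" for a u
  define r' where "r' u a = h (r (g u) a)" for a u
  have bs: "banach_space Z" using bim by (simp add: banach_bimodule_def)
  have dist: "vdist Z' u v = vdist Z (g u) (g v)" for u v by (simp add: vdist_def)
  have complete: "\<exists>k\<in>points Z'. (\<lambda>n. vdist Z' (s n) k) \<longlonglongrightarrow> 0"
    if s: "\<forall>n. s n \<in> points Z'"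
      and c: "\<forall>e>0. \<exists>N. \<forall>i\<ge>N. \<forall>j\<ge>N. vdist Z' (s i) (s j) < e" for s :: "nat \<Rightarrow> 'u"
  proof -
    have "\<forall>n. g (s n) \<in> points Z"
    proof
      fix n show "g (s n) \<in> points Z" using s[rule_format, of n] by auto
    qed
    moreover have "\<forall>e>0. \<exists>N. \<forall>i\<ge>N. \<forall>j\<ge>N. vdist Z (g (s i)) (g (s j)) < e"
      using c by (simp add: dist)
    ultimately obtain k where "k \<in> points Z" "(\<lambda>n. vdist Z (g (s n)) k) \<longlonglongrightarrow> 0"
      using banach_space_complete[OF bs, of "\<lambda>n. g (s n)"] by blast
    then show ?thesis by (intro bexI[of _ "h k"]) (simp_all add: dist)
  qed
  have assoc: "\<forall>x\<in>points Z. \<forall>y\<in>points Z. \<forall>z\<in>points Z.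
        vadd Z (vadd Z x y) z = vadd Z x (vadd Z y z)"
    and comm: "\<forall>x\<in>points Z. \<forall>y\<in>points Z. vadd Z x y = vadd Z y x"
    and zero: "\<forall>x\<in>points Z. vadd Z (vzero Z) x = x"
    using bs unfolding banach_space_def by - (elim conjE, assumption)+
  have bs': "banach_space Z'"
    unfolding banach_space_def
    \<comment> \<open>Completeness, associativity, commutativity and the zero law are brought
      forward and solved from the facts prepared above; the other clauses transport by
      simplification.\<close>
    apply (intro conjI)
                  prefer 15
    subgoal using complete by blast
                 prefer 4
    subgoal using assoc by (simp add: banach_spaceD(2)[OF bs])
                prefer 4
    subgoal using comm by (simp add: ball_simps)
               prefer 4
    subgoal using zero by (simp add: ball_simps)
    using bs[unfolded banach_space_def] by (simp_all add: ball_simps)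
  have "banach_bimodule A m Z' l' r'"
    using bim bs' unfolding banach_bimodule_def by (simp add: l'_def r'_def)
  moreover have "dual_derivation A m Z' l' r' (\<lambda>a u. D a (g u))"
    using D unfolding dual_derivation_def
    by (simp add: dual_def dual_lact_def dual_ract_def l'_def r'_def)
  ultimately have "inner_derivation A Z' l' r' (\<lambda>a u. D a (g u))"
    using am by (simp add: amenable_def)
  then obtain f where f: "f \<in> dual Z'"
      "\<forall>a\<in>A. \<forall>u\<in>points Z'. D a (g u) = dual_lact r' a f u - dual_ract l' f a u"
    by (auto simp: inner_derivation_def)
  show ?thesis
    unfolding inner_derivation_def
  proof (intro bexI[of _ "\<lambda>z. f (h z)"] ballI)
    show "(\<lambda>z. f (h z)) \<in> dual Z" using f(1) by (simp add: dual_def)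
    show "D a z = dual_lact r a (\<lambda>z. f (h z)) z - dual_ract l (\<lambda>z. f (h z)) a z"
      if "a \<in> A" "z \<in> points Z" for a z
      using f(2) that by (simp add: dual_lact_def dual_ract_def l'_def r'_def)
  qed
qed

section \<open>Bounded linear and bilinear forms on a Banach algebra\<close>

definition clinear_form :: "'a::complex_banach set \<Rightarrow> ('a \<Rightarrow> complex) \<Rightarrow> bool" where
  "clinear_form A \<phi> \<longleftrightarrow>
     (\<forall>x\<in>A. \<forall>y\<in>A. \<phi> (x + y) = \<phi> x + \<phi> y) \<and> (\<forall>c. \<forall>x\<in>A. \<phi> (c *\<^sub>C x) = c * \<phi> x)"

definition linear_forms :: "'a::complex_banach set \<Rightarrow> ('a \<Rightarrow> complex) set" where
  "linear_forms A = {\<phi>. clinear_form A \<phi> \<and> (\<exists>K. wbounded A norm K \<phi>)}"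

definition norm2 :: "'a::real_normed_vector \<times> 'b::real_normed_vector \<Rightarrow> real" where
  "norm2 = (\<lambda>(x, y). norm x * norm y)"

lemma norm2_Pair [simp]: "norm2 (x, y) = norm x * norm y"
  by (simp add: norm2_def)

text \<open>The argument is a pair, not curried, so that these forms fit \<open>form_space\<close>
  with index set \<open>A \<times> A\<close>.\<close>

definition bilinear_forms :: "'a::complex_banach set \<Rightarrow> ('a \<times> 'a \<Rightarrow> complex) set" where
  "bilinear_forms A = {F. (\<forall>y\<in>A. clinear_form A (\<lambda>x. F (x, y))) \<and>
     (\<forall>x\<in>A. clinear_form A (\<lambda>y. F (x, y))) \<and> (\<exists>K. wbounded (A \<times> A) norm2 K F)}"

definition bounded_map :: "'a::complex_banach set \<Rightarrow> 'b::complex_banach set \<Rightarrow> ('a \<Rightarrow> 'b) \<Rightarrow> bool" where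
  "bounded_map A B u \<longleftrightarrow> (\<forall>x\<in>A. u x \<in> B) \<and> (\<forall>x\<in>A. \<forall>y\<in>A. u (x + y) = u x + u y) \<and>
     (\<forall>c. \<forall>x\<in>A. u (c *\<^sub>C x) = c *\<^sub>C u x) \<and> (\<exists>K\<ge>0. \<forall>x\<in>A. norm (u x) \<le> K * norm x)"

lemma linear_formsI:
  assumes "\<And>x y. x \<in> A \<Longrightarrow> y \<in> A \<Longrightarrow> \<phi> (x + y) = \<phi> x + \<phi> y"
    and "\<And>c x. x \<in> A \<Longrightarrow> \<phi> (c *\<^sub>C x) = c * \<phi> x"
    and "\<And>x. x \<in> A \<Longrightarrow> cmod (\<phi> x) \<le> K * norm x"
  shows "\<phi> \<in> linear_forms A"
  using assms unfolding linear_forms_def clinear_form_def wbounded_def by blast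

lemma bilinear_formsI:
  assumes "\<And>x x' y. x \<in> A \<Longrightarrow> x' \<in> A \<Longrightarrow> y \<in> A \<Longrightarrow> F (x + x', y) = F (x, y) + F (x', y)"
    and "\<And>c x y. x \<in> A \<Longrightarrow> y \<in> A \<Longrightarrow> F (c *\<^sub>C x, y) = c * F (x, y)"
    and "\<And>x y y'. x \<in> A \<Longrightarrow> y \<in> A \<Longrightarrow> y' \<in> A \<Longrightarrow> F (x, y + y') = F (x, y) + F (x, y')"
    and "\<And>c x y. x \<in> A \<Longrightarrow> y \<in> A \<Longrightarrow> F (x, c *\<^sub>C y) = c * F (x, y)"
    and "\<And>x y. x \<in> A \<Longrightarrow> y \<in> A \<Longrightarrow> cmod (F (x, y)) \<le> K * (norm x * norm y)"
  shows "F \<in> bilinear_forms A"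
proof -
  have "wbounded (A \<times> A) norm2 K F" using assms(5) by (auto simp: wbounded_def)
  then show ?thesis using assms(1-4) by (auto simp: bilinear_forms_def clinear_form_def)
qed

lemma linear_formsD:
  assumes "\<phi> \<in> linear_forms A"
  shows "x \<in> A \<Longrightarrow> y \<in> A \<Longrightarrow> \<phi> (x + y) = \<phi> x + \<phi> y"
    and "x \<in> A \<Longrightarrow> \<phi> (c *\<^sub>C x) = c * \<phi> x"
  using assms by (simp_all add: linear_forms_def clinear_form_def)

lemma bilinear_formsD:
  assumes "F \<in> bilinear_forms A"
  shows "x \<in> A \<Longrightarrow> x' \<in> A \<Longrightarrow> y \<in> A \<Longrightarrow> F (x + x', y) = F (x, y) + F (x', y)"
    and "x \<in> A \<Longrightarrow> y \<in> A \<Longrightarrow> F (c *\<^sub>C x, y) = c * F (x, y)"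
    and "x \<in> A \<Longrightarrow> y \<in> A \<Longrightarrow> y' \<in> A \<Longrightarrow> F (x, y + y') = F (x, y) + F (x, y')"
    and "x \<in> A \<Longrightarrow> y \<in> A \<Longrightarrow> F (x, c *\<^sub>C y) = c * F (x, y)"
  using assms by (simp_all add: bilinear_forms_def clinear_form_def)

lemma linear_forms_bound:
  assumes "\<phi> \<in> linear_forms A"
  obtains K where "0 \<le> K" "wbounded A norm K \<phi>"
proof -
  obtain K where K: "wbounded A norm K \<phi>" using assms by (auto simp: linear_forms_def)
  have "wbounded A norm (max 0 K) \<phi>"
    by (auto simp: wbounded_def intro!: order_trans[OF wboundedD[OF K]] mult_right_mono)
  then show thesis using that[of "max 0 K"] by simp
qed

lemma bilinear_forms_bound:
  assumes "F \<in> bilinear_forms A"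
  obtains K where "0 \<le> K" "wbounded (A \<times> A) norm2 K F"
proof -
  obtain K where K: "wbounded (A \<times> A) norm2 K F" using assms by (auto simp: bilinear_forms_def)
  have "wbounded (A \<times> A) norm2 (max 0 K) F"
    by (auto simp: wbounded_def intro!: order_trans[OF wboundedD[OF K]] mult_right_mono)
  then show thesis using that[of "max 0 K"] by simp
qed

lemma bounded_mapD:
  assumes "bounded_map A B u"
  shows "x \<in> A \<Longrightarrow> u x \<in> B" and "x \<in> A \<Longrightarrow> y \<in> A \<Longrightarrow> u (x + y) = u x + u y"
    and "x \<in> A \<Longrightarrow> u (c *\<^sub>C x) = c *\<^sub>C u x"
  using assms by (simp_all add: bounded_map_def)

lemma bounded_map_bound:
  assumes "bounded_map A B u"
  obtains K where "0 \<le> K" "\<forall>x\<in>A. norm (u x) \<le> K * norm x"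
  using assms unfolding bounded_map_def by blast

lemma bounded_map_id [simp]: "bounded_map A A (\<lambda>x. x)"
  by (auto simp: bounded_map_def intro!: exI[of _ 1])

lemma linear_forms_compose:
  assumes \<phi>: "\<phi> \<in> linear_forms B" and u: "bounded_map A B u"
  shows "(\<lambda>x. \<phi> (u x)) \<in> linear_forms A"
proof -
  obtain K where K: "0 \<le> K" "wbounded B norm K \<phi>" by (rule linear_forms_bound[OF \<phi>])
  obtain C where C: "0 \<le> C" "\<forall>x\<in>A. norm (u x) \<le> C * norm x" by (rule bounded_map_bound[OF u])
  show ?thesis
  proof (rule linear_formsI)
    fix x assume x: "x \<in> A"
    have "cmod (\<phi> (u x)) \<le> K * norm (u x)"
      using wboundedD[OF K(2)] bounded_mapD(1)[OF u x] by blast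
    also have "\<dots> \<le> K * (C * norm x)" using K C x by (intro mult_left_mono) auto
    finally show "cmod (\<phi> (u x)) \<le> (K * C) * norm x" by (simp add: mult.assoc)
  qed (simp_all add: bounded_mapD[OF u] linear_formsD[OF \<phi>])
qed

lemma bilinear_forms_compose:
  assumes F: "F \<in> bilinear_forms B" and u: "bounded_map A B u" and v: "bounded_map A B v"
  shows "(\<lambda>(x, y). F (u x, v y)) \<in> bilinear_forms A"
proof -
  obtain K where K: "0 \<le> K" "wbounded (B \<times> B) norm2 K F" by (rule bilinear_forms_bound[OF F])
  obtain C where C: "0 \<le> C" "\<forall>x\<in>A. norm (u x) \<le> C * norm x" by (rule bounded_map_bound[OF u])
  obtain C' where C': "0 \<le> C'" "\<forall>x\<in>A. norm (v x) \<le> C' * norm x" by (rule bounded_map_bound[OF v])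
  show ?thesis
  proof (rule bilinear_formsI)
    fix x y assume xy: "x \<in> A" "y \<in> A"
    have "cmod (F (u x, v y)) \<le> K * (norm (u x) * norm (v y))"
      using wboundedD[OF K(2), of "(u x, v y)"] bounded_mapD(1)[OF u] bounded_mapD(1)[OF v] xy by simp
    also have "\<dots> \<le> K * ((C * norm x) * (C' * norm y))"
      using K C C' xy by (intro mult_left_mono mult_mono) auto
    finally show "cmod (case (x, y) of (x, y) \<Rightarrow> F (u x, v y)) \<le> (K * C * C') * (norm x * norm y)"
      by (simp add: mult_ac)
  qed (simp_all add: bounded_mapD[OF u] bounded_mapD[OF v] bilinear_formsD[OF F])
qed

lemma bilinear_forms_section:
  assumes F: "F \<in> bilinear_forms A"
  shows "y \<in> A \<Longrightarrow> (\<lambda>x. F (x, y)) \<in> linear_forms A"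
    and "x \<in> A \<Longrightarrow> (\<lambda>y. F (x, y)) \<in> linear_forms A"
    and "0 \<le> K \<Longrightarrow> wbounded (A \<times> A) norm2 K F \<Longrightarrow> x \<in> A \<Longrightarrow>
      wbounded A norm (K * norm x) (\<lambda>y. F (x, y))"
proof -
  show w: "wbounded A norm (K * norm x) (\<lambda>y. F (x, y))"
    if "wbounded (A \<times> A) norm2 K F" "x \<in> A" for K x
    using that by (auto simp: wbounded_def mult.assoc)
  obtain K where K: "0 \<le> K" "wbounded (A \<times> A) norm2 K F" by (rule bilinear_forms_bound[OF F])
  have "wbounded A norm (K * norm y) (\<lambda>x. F (x, y))" if "y \<in> A" for y
    using that K(2) by (auto simp: wbounded_def mult_ac)
  then show "y \<in> A \<Longrightarrow> (\<lambda>x. F (x, y)) \<in> linear_forms A"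
    using F by (auto simp: linear_forms_def bilinear_forms_def)
  show "x \<in> A \<Longrightarrow> (\<lambda>y. F (x, y)) \<in> linear_forms A"
    using F w[OF K(2)] by (auto simp: linear_forms_def bilinear_forms_def)
qed

section \<open>Forms on a fixed Banach algebra and their translates\<close>

locale banach_alg =
  fixes A :: "'a::complex_banach set" and mult :: "'a \<Rightarrow> 'a \<Rightarrow> 'a" (infixl \<open>\<odot>\<close> 70)
  assumes banach_alg: "banach_algebra A mult"
begin

lemma zero_mem [simp]: "0 \<in> A"
  using banach_alg by (simp add: banach_algebra_def complex_vector.subspace_def)

lemma add_mem [simp]: "x \<in> A \<Longrightarrow> y \<in> A \<Longrightarrow> x + y \<in> A"
  using banach_alg by (simp add: banach_algebra_def complex_vector.subspace_def)

lemma scale_mem [simp]: "x \<in> A \<Longrightarrow> c *\<^sub>C x \<in> A"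
  using banach_alg by (simp add: banach_algebra_def complex_vector.subspace_def)

lemma mult_mem [simp]: "x \<in> A \<Longrightarrow> y \<in> A \<Longrightarrow> x \<odot> y \<in> A"
  using banach_alg by (simp add: banach_algebra_def)

lemma mult_simps:
  "x \<in> A \<Longrightarrow> y \<in> A \<Longrightarrow> z \<in> A \<Longrightarrow> x \<odot> y \<odot> z = x \<odot> (y \<odot> z)"
  "x \<in> A \<Longrightarrow> y \<in> A \<Longrightarrow> z \<in> A \<Longrightarrow> (x + y) \<odot> z = x \<odot> z + y \<odot> z"
  "x \<in> A \<Longrightarrow> y \<in> A \<Longrightarrow> z \<in> A \<Longrightarrow> x \<odot> (y + z) = x \<odot> y + x \<odot> z"
  "x \<in> A \<Longrightarrow> y \<in> A \<Longrightarrow> (c *\<^sub>C x) \<odot> y = c *\<^sub>C (x \<odot> y)"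
  "x \<in> A \<Longrightarrow> y \<in> A \<Longrightarrow> x \<odot> (c *\<^sub>C y) = c *\<^sub>C (x \<odot> y)"
  using banach_alg by (simp_all add: banach_algebra_def)

lemma norm_mult_le: "x \<in> A \<Longrightarrow> y \<in> A \<Longrightarrow> norm (x \<odot> y) \<le> norm x * norm y"
  using banach_alg by (simp add: banach_algebra_def)

lemma bounded_map_mult [simp]:
  assumes "a \<in> A"
  shows "bounded_map A A (\<lambda>x. x \<odot> a)" "bounded_map A A (\<lambda>x. a \<odot> x)"
  using assms norm_mult_le
  by (auto simp: bounded_map_def mult_simps mult.commute intro!: exI[of _ "norm a"])

lemma mult_bilinear_form:
  assumes \<phi>: "\<phi> \<in> linear_forms A"
  shows "(\<lambda>(x, y). \<phi> (x \<odot> y)) \<in> bilinear_forms A"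
proof -
  obtain K where K: "0 \<le> K" "wbounded A norm K \<phi>" by (rule linear_forms_bound[OF \<phi>])
  show ?thesis
  proof (rule bilinear_formsI)
    fix x y assume xy: "x \<in> A" "y \<in> A"
    have "cmod (\<phi> (x \<odot> y)) \<le> K * norm (x \<odot> y)"
      using wboundedD[OF K(2)] xy by simp
    also have "\<dots> \<le> K * (norm x * norm y)" using K xy norm_mult_le by (intro mult_left_mono) auto
    finally show "cmod (case (x, y) of (x, y) \<Rightarrow> \<phi> (x \<odot> y)) \<le> K * (norm x * norm y)"
      by simp
  qed (simp_all add: mult_simps linear_formsD[OF \<phi>])
qed

lemma linear_forms_mult:
  assumes "z \<in> linear_forms A" "a \<in> A"
  shows "(\<lambda>x. z (x \<odot> a)) \<in> linear_forms A" "(\<lambda>x. z (a \<odot> x)) \<in> linear_forms A"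
  using assms by (simp_all add: linear_forms_compose[of z A A])

lemma wbounded_mult:
  assumes "0 \<le> K" "wbounded A norm K \<phi>"
  shows "wbounded (A \<times> A) norm2 K (\<lambda>(x, y). \<phi> (x \<odot> y))"
proof (rule wboundedI, clarify)
  fix x y assume xy: "x \<in> A" "y \<in> A"
  have "cmod (\<phi> (x \<odot> y)) \<le> K * norm (x \<odot> y)"
    using wboundedD[OF assms(2)] xy by simp
  also have "\<dots> \<le> K * norm2 (x, y)"
    using assms(1) norm_mult_le xy by (simp add: mult_left_mono)
  finally show "cmod (\<phi> (x \<odot> y)) \<le> K * norm2 (x, y)" .
qed

sublocale L1: form_space A norm "linear_forms A"
proof
  show "(\<lambda>x. 0) \<in> linear_forms A" by (rule linear_formsI[where K = 0]) auto
next
  fix f g assume fg: "f \<in> linear_forms A" "g \<in> linear_forms A"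
  then obtain K K' where "wbounded A norm K f" "wbounded A norm K' g"
    by (auto simp: linear_forms_def)
  from wbounded_add[OF this] have "\<exists>K. wbounded A norm K (\<lambda>x. f x + g x)" by (rule exI)
  then show "(\<lambda>x. f x + g x) \<in> linear_forms A"
    using fg by (simp add: linear_forms_def clinear_form_def distrib_left)
next
  fix f c assume f: "f \<in> linear_forms A"
  then obtain K where "wbounded A norm K f" by (auto simp: linear_forms_def)
  from wbounded_scale[OF this] have "\<exists>K. wbounded A norm K (\<lambda>x. c * f x)" by (rule exI)
  then show "(\<lambda>x. c * f x) \<in> linear_forms A"
    using f by (simp add: linear_forms_def clinear_form_def distrib_left)
next
  fix f assume "f \<in> linear_forms A"
  then show "\<exists>K. wbounded A norm K f" by (simp add: linear_forms_def)
next
  fix s :: "nat \<Rightarrow> 'a \<Rightarrow> complex" and f K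
  assume s: "\<And>n. s n \<in> linear_forms A" and lim: "\<And>x. x \<in> A \<Longrightarrow> (\<lambda>n. s n x) \<longlonglongrightarrow> f x"
    and K: "wbounded A norm K f"
  show "f \<in> linear_forms A"
  proof (rule linear_formsI)
    fix x y c assume x: "x \<in> A"
    show "f (c *\<^sub>C x) = c * f x"
      using lim[of "c *\<^sub>C x"] tendsto_mult_left[OF lim[OF x], of c] x
      by (intro LIMSEQ_unique) (auto simp: linear_formsD[OF s])
    show "f (x + y) = f x + f y" if y: "y \<in> A"
      using lim[of "x + y"] tendsto_add[OF lim[OF x] lim[OF y]] x y
      by (intro LIMSEQ_unique) (auto simp: linear_formsD[OF s])
  qed (use K in \<open>auto dest: wboundedD\<close>)
qed simp

sublocale L2: form_space "A \<times> A" norm2 "bilinear_forms A"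
proof
  show "(\<lambda>x. 0) \<in> bilinear_forms A" by (rule bilinear_formsI[where K = 0]) auto
next
  fix f g assume fg: "f \<in> bilinear_forms A" "g \<in> bilinear_forms A"
  then obtain K K' where "wbounded (A \<times> A) norm2 K f" "wbounded (A \<times> A) norm2 K' g"
    by (auto simp: bilinear_forms_def)
  from wbounded_add[OF this] have "\<exists>K. wbounded (A \<times> A) norm2 K (\<lambda>x. f x + g x)" by (rule exI)
  then show "(\<lambda>x. f x + g x) \<in> bilinear_forms A"
    using fg by (simp add: bilinear_forms_def clinear_form_def distrib_left)
next
  fix f c assume f: "f \<in> bilinear_forms A"
  then obtain K where "wbounded (A \<times> A) norm2 K f" by (auto simp: bilinear_forms_def)
  from wbounded_scale[OF this] have "\<exists>K. wbounded (A \<times> A) norm2 K (\<lambda>x. c * f x)" by (rule exI)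
  then show "(\<lambda>x. c * f x) \<in> bilinear_forms A"
    using f by (simp add: bilinear_forms_def clinear_form_def distrib_left)
next
  fix f assume "f \<in> bilinear_forms A"
  then show "\<exists>K. wbounded (A \<times> A) norm2 K f" by (simp add: bilinear_forms_def)
next
  fix s :: "nat \<Rightarrow> 'a \<times> 'a \<Rightarrow> complex" and f K
  assume s: "\<And>n. s n \<in> bilinear_forms A"
    and lim: "\<And>p. p \<in> A \<times> A \<Longrightarrow> (\<lambda>n. s n p) \<longlonglongrightarrow> f p" and K: "wbounded (A \<times> A) norm2 K f"
  show "f \<in> bilinear_forms A"
  proof (rule bilinear_formsI)
    fix x y c assume xy: "x \<in> A" "y \<in> A"
    have l: "(\<lambda>n. s n (x, y)) \<longlonglongrightarrow> f (x, y)" if "x \<in> A" "y \<in> A" for x y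
      using lim that by simp
    show "f (c *\<^sub>C x, y) = c * f (x, y)"
      using l[of "c *\<^sub>C x" y] tendsto_mult_left[OF l[OF xy], of c] xy
      by (intro LIMSEQ_unique) (auto simp: bilinear_formsD[OF s])
    show "f (x, c *\<^sub>C y) = c * f (x, y)"
      using l[of x "c *\<^sub>C y"] tendsto_mult_left[OF l[OF xy], of c] xy
      by (intro LIMSEQ_unique) (auto simp: bilinear_formsD[OF s])
    show "f (x + x', y) = f (x, y) + f (x', y)" if "x' \<in> A" for x'
      using l[of "x + x'" y] tendsto_add[OF l[OF xy] l[of x' y]] xy that
      by (intro LIMSEQ_unique) (auto simp: bilinear_formsD[OF s])
    show "f (x, y + y') = f (x, y) + f (x, y')" if "y' \<in> A" for y'
      using l[of x "y + y'"] tendsto_add[OF l[OF xy] l[of x y']] xy that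
      by (intro LIMSEQ_unique) (auto simp: bilinear_formsD[OF s])
    show "cmod (f (x, y)) \<le> K * (norm x * norm y)" using wboundedD[OF K, of "(x, y)"] xy by simp
  qed
qed (auto simp: norm2_def)

text \<open>A bounded bilinear form is a bounded operator from A to its dual, and \<open>E\<close>
  is composed with this operator.\<close>

lemma partial_functional_form:
  assumes E: "L1.functional E" and F: "F \<in> bilinear_forms A"
  shows "(\<lambda>x. E (\<lambda>y. F (x, y))) \<in> linear_forms A" "(\<lambda>y. E (\<lambda>x. F (x, y))) \<in> linear_forms A"
proof -
  obtain C where C: "0 \<le> C" "\<forall>f\<in>linear_forms A. \<forall>K\<ge>0. wbounded A norm K f \<longrightarrow> cmod (E f) \<le> C * K"
    by (rule L1.functional_bound[OF E])
  have *: "(\<lambda>x. E (\<lambda>y. F (x, y))) \<in> linear_forms A" if F: "F \<in> bilinear_forms A" for F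
  proof -
    obtain K where K: "0 \<le> K" "wbounded (A \<times> A) norm2 K F" by (rule bilinear_forms_bound[OF F])
    note sec = bilinear_forms_section(2)[OF F]
    show ?thesis
    proof (rule linear_formsI)
      fix x assume x: "x \<in> A"
      have "cmod (E (\<lambda>y. F (x, y))) \<le> C * (K * norm x)"
        using C sec[OF x] bilinear_forms_section(3)[OF F K x] K by simp
      then show "cmod (E (\<lambda>y. F (x, y))) \<le> (C * K) * norm x" by (simp add: mult.assoc)
      fix c
      have "E (\<lambda>y. F (c *\<^sub>C x, y)) = E (\<lambda>y. c * F (x, y))"
        using x by (intro L1.functional_cong[OF E] sec) (simp_all add: bilinear_formsD[OF F])
      then show "E (\<lambda>y. F (c *\<^sub>C x, y)) = c * E (\<lambda>y. F (x, y))"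
        using L1.functional_scale[OF E sec[OF x]] by simp
    next
      fix x x' assume x: "x \<in> A" "x' \<in> A"
      have "E (\<lambda>y. F (x + x', y)) = E (\<lambda>y. F (x, y) + F (x', y))"
        using x by (intro L1.functional_cong[OF E] sec) (simp_all add: bilinear_formsD[OF F])
      then show "E (\<lambda>y. F (x + x', y)) = E (\<lambda>y. F (x, y)) + E (\<lambda>y. F (x', y))"
        using L1.functional_add[OF E sec sec] x by simp
    qed
  qed
  show "(\<lambda>x. E (\<lambda>y. F (x, y))) \<in> linear_forms A" by (rule *[OF F])
  \<comment> \<open>The second claim is the first one for the transposed form.\<close>
  have "(\<lambda>(y, x). F (x, y)) \<in> bilinear_forms A"
  proof -
    obtain K where K: "0 \<le> K" "wbounded (A \<times> A) norm2 K F" by (rule bilinear_forms_bound[OF F])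
    show ?thesis
    proof (rule bilinear_formsI)
      fix y x assume "y \<in> A" "x \<in> A"
      then show "cmod (case (y, x) of (y, x) \<Rightarrow> F (x, y)) \<le> K * (norm y * norm x)"
        using wboundedD[OF K(2), of "(x, y)"] by (simp add: mult.commute)
    qed (simp_all add: bilinear_formsD[OF F])
  qed
  from *[OF this] show "(\<lambda>y. E (\<lambda>x. F (x, y))) \<in> linear_forms A" by simp
qed

text \<open>On a form \<open>\<lambda>(x, y). z (x \<odot> y)\<close> the value is that of the first
  Arens product of \<open>E\<close> and \<open>E'\<close> at \<open>z\<close>.\<close>

lemma iterated_functional:
  assumes E: "L1.functional E" and E': "L1.functional E'"
  shows "L2.functional (\<lambda>F. E (\<lambda>x. E' (\<lambda>y. F (x, y))))"
proof -
  obtain C where C: "0 \<le> C" "\<forall>f\<in>linear_forms A. \<forall>K\<ge>0. wbounded A norm K f \<longrightarrow> cmod (E f) \<le> C * K"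
    by (rule L1.functional_bound[OF E])
  obtain C' where C': "0 \<le> C'" "\<forall>f\<in>linear_forms A. \<forall>K\<ge>0. wbounded A norm K f \<longrightarrow> cmod (E' f) \<le> C' * K"
    by (rule L1.functional_bound[OF E'])
  note part = partial_functional_form(1)[OF E']
  note sec = bilinear_forms_section(2)
  show ?thesis
  proof (rule L2.functionalI)
    fix F G assume F: "F \<in> bilinear_forms A" and G: "G \<in> bilinear_forms A"
    have "E (\<lambda>x. E' (\<lambda>y. F (x, y) + G (x, y))) = E (\<lambda>x. E' (\<lambda>y. F (x, y)) + E' (\<lambda>y. G (x, y)))"
      using part[OF L2.add_form[OF F G]]
      by (intro L1.functional_cong[OF E]) (simp_all add: L1.functional_add[OF E'] sec[OF F] sec[OF G])
    then show "E (\<lambda>x. E' (\<lambda>y. F (x, y) + G (x, y))) =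
        E (\<lambda>x. E' (\<lambda>y. F (x, y))) + E (\<lambda>x. E' (\<lambda>y. G (x, y)))"
      by (simp add: L1.functional_add[OF E part[OF F] part[OF G]])
  next
    fix F c assume F: "F \<in> bilinear_forms A"
    have "E (\<lambda>x. E' (\<lambda>y. c * F (x, y))) = E (\<lambda>x. c * E' (\<lambda>y. F (x, y)))"
      using part[OF L2.scale_form[OF F]]
      by (intro L1.functional_cong[OF E]) (simp_all add: L1.functional_scale[OF E'] sec[OF F])
    then show "E (\<lambda>x. E' (\<lambda>y. c * F (x, y))) = c * E (\<lambda>x. E' (\<lambda>y. F (x, y)))"
      by (simp add: L1.functional_scale[OF E part[OF F]])
  next
    fix F K assume F: "F \<in> bilinear_forms A" and K: "(0::real) \<le> K" "wbounded (A \<times> A) norm2 K F"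
    have "wbounded A norm (C' * K) (\<lambda>x. E' (\<lambda>y. F (x, y)))"
    proof (rule wboundedI)
      fix x assume x: "x \<in> A"
      have "cmod (E' (\<lambda>y. F (x, y))) \<le> C' * (K * norm x)"
        using C' sec[OF F x] bilinear_forms_section(3)[OF F K x] K by simp
      then show "cmod (E' (\<lambda>y. F (x, y))) \<le> (C' * K) * norm x" by (simp add: mult.assoc)
    qed
    then have "cmod (E (\<lambda>x. E' (\<lambda>y. F (x, y)))) \<le> C * (C' * K)"
      using C part[OF F] C' K by simp
    then show "cmod (E (\<lambda>x. E' (\<lambda>y. F (x, y)))) \<le> (C * C') * K" by (simp add: mult.assoc)
  qed (use C C' in simp)
qed

lemma bilinear_forms_mult:
  assumes "F \<in> bilinear_forms A" "a \<in> A"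
  shows "(\<lambda>(x, y). F (a \<odot> x, y)) \<in> bilinear_forms A" "(\<lambda>(x, y). F (x, y \<odot> a)) \<in> bilinear_forms A"
    and "(\<lambda>(x, y). F (a, x \<odot> y)) \<in> bilinear_forms A"
  using assms by (auto intro!: bilinear_forms_compose[of F A A] mult_bilinear_form
      bilinear_forms_section(2))

lemma wbounded_bilinear_mult:
  assumes K: "0 \<le> K" "wbounded (A \<times> A) norm2 K F" and a: "a \<in> A"
  shows "wbounded (A \<times> A) norm2 (K * norm a) (\<lambda>(x, y). F (a \<odot> x, y))"
    and "wbounded (A \<times> A) norm2 (K * norm a) (\<lambda>(x, y). F (x, y \<odot> a))"
    and "wbounded (A \<times> A) norm2 (K * norm a) (\<lambda>(x, y). F (a, x \<odot> y))"
proof (safe intro!: wboundedI)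
  fix x y assume xy: "x \<in> A" "y \<in> A"
  note le = wboundedD[OF K(2), of "(_, _)", simplified]
  note mono = mult_left_mono[OF _ K(1)]
  have "cmod (F (a \<odot> x, y)) \<le> K * (norm (a \<odot> x) * norm y)" using le xy a by simp
  also have "\<dots> \<le> K * ((norm a * norm x) * norm y)"
    using norm_mult_le[OF a xy(1)] by (intro mono mult_right_mono) auto
  finally show "cmod (F (a \<odot> x, y)) \<le> K * norm a * norm2 (x, y)" by (simp add: mult_ac)
  have "cmod (F (x, y \<odot> a)) \<le> K * (norm x * norm (y \<odot> a))" using le xy a by simp
  also have "\<dots> \<le> K * (norm x * (norm y * norm a))"
    using norm_mult_le[OF xy(2) a] by (intro mono mult_left_mono) auto
  finally show "cmod (F (x, y \<odot> a)) \<le> K * norm a * norm2 (x, y)" by (simp add: mult_ac)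
  have "cmod (F (a, x \<odot> y)) \<le> K * (norm a * norm (x \<odot> y))" using le xy a by simp
  also have "\<dots> \<le> K * (norm a * (norm x * norm y))"
    using norm_mult_le[OF xy] by (intro mono mult_left_mono) auto
  finally show "cmod (F (a, x \<odot> y)) \<le> K * norm a * norm2 (x, y)" by (simp add: mult_ac)
qed

text \<open>The two sides of the commutation law of a virtual diagonal are bounded linear in
  \<open>c\<close>. Hence the law can be tested on a set with dense span, and the commutator of a
  functional with \<open>c\<close> depends linearly on \<open>c\<close>, as a derivation
  must.\<close>

lemma functional_mult_form:
  assumes M: "L2.functional M" and F: "F \<in> bilinear_forms A"
  shows "(\<lambda>c. M (\<lambda>(x, y). F (c \<odot> x, y))) \<in> linear_forms A"
    and "(\<lambda>c. M (\<lambda>(x, y). F (x, y \<odot> c))) \<in> linear_forms A"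
proof -
  obtain C where C: "0 \<le> C" "\<forall>F\<in>bilinear_forms A. \<forall>K\<ge>0. wbounded (A \<times> A) norm2 K F \<longrightarrow>
      cmod (M F) \<le> C * K" by (rule L2.functional_bound[OF M])
  obtain K where K: "0 \<le> K" "wbounded (A \<times> A) norm2 K F" by (rule bilinear_forms_bound[OF F])
  note form = bilinear_forms_mult(1,2)[OF F]
  note cong = L2.functional_cong[OF M]
  have bound: "cmod (M (\<lambda>(x, y). F (c \<odot> x, y))) \<le> (C * K) * norm c"
    "cmod (M (\<lambda>(x, y). F (x, y \<odot> c))) \<le> (C * K) * norm c" if c: "c \<in> A" for c
    using C(2) form[OF c] wbounded_bilinear_mult(1,2)[OF K c] K(1) by (simp_all add: mult.assoc)
  show "(\<lambda>c. M (\<lambda>(x, y). F (c \<odot> x, y))) \<in> linear_forms A"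
  proof (rule linear_formsI)
    fix a b k assume a: "a \<in> A" and b: "b \<in> A"
    have "M (\<lambda>(x, y). F ((a + b) \<odot> x, y)) =
        M (\<lambda>p. (case p of (x, y) \<Rightarrow> F (a \<odot> x, y)) + (case p of (x, y) \<Rightarrow> F (b \<odot> x, y)))"
      using a b by (intro cong[OF form(1)]) (auto simp: bilinear_formsD[OF F] mult_simps)
    then show "M (\<lambda>(x, y). F ((a + b) \<odot> x, y)) =
        M (\<lambda>(x, y). F (a \<odot> x, y)) + M (\<lambda>(x, y). F (b \<odot> x, y))"
      by (simp add: L2.functional_add[OF M form(1)[OF a] form(1)[OF b]])
  next
    fix k a assume a: "a \<in> A"
    have "M (\<lambda>(x, y). F ((k *\<^sub>C a) \<odot> x, y)) = M (\<lambda>p. k * (case p of (x, y) \<Rightarrow> F (a \<odot> x, y)))"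
      using a by (intro cong[OF form(1)]) (auto simp: bilinear_formsD[OF F] mult_simps)
    then show "M (\<lambda>(x, y). F ((k *\<^sub>C a) \<odot> x, y)) = k * M (\<lambda>(x, y). F (a \<odot> x, y))"
      by (simp add: L2.functional_scale[OF M form(1)[OF a]])
  qed (rule bound(1))
  show "(\<lambda>c. M (\<lambda>(x, y). F (x, y \<odot> c))) \<in> linear_forms A"
  proof (rule linear_formsI)
    fix a b k assume a: "a \<in> A" and b: "b \<in> A"
    have "M (\<lambda>(x, y). F (x, y \<odot> (a + b))) =
        M (\<lambda>p. (case p of (x, y) \<Rightarrow> F (x, y \<odot> a)) + (case p of (x, y) \<Rightarrow> F (x, y \<odot> b)))"
      using a b by (intro cong[OF form(2)]) (auto simp: bilinear_formsD[OF F] mult_simps)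
    then show "M (\<lambda>(x, y). F (x, y \<odot> (a + b))) =
        M (\<lambda>(x, y). F (x, y \<odot> a)) + M (\<lambda>(x, y). F (x, y \<odot> b))"
      by (simp add: L2.functional_add[OF M form(2)[OF a] form(2)[OF b]])
  next
    fix k a assume a: "a \<in> A"
    have "M (\<lambda>(x, y). F (x, y \<odot> (k *\<^sub>C a))) = M (\<lambda>p. k * (case p of (x, y) \<Rightarrow> F (x, y \<odot> a)))"
      using a by (intro cong[OF form(2)]) (auto simp: bilinear_formsD[OF F] mult_simps)
    then show "M (\<lambda>(x, y). F (x, y \<odot> (k *\<^sub>C a))) = k * M (\<lambda>(x, y). F (x, y \<odot> a))"
      by (simp add: L2.functional_scale[OF M form(2)[OF a]])
  qed (rule bound(2))
qed

text \<open>Serves the tensor product: the diagonal of the second factor, shifted by one of its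
  elements, can again be applied inside a form on the large algebra.\<close>

lemma functional_mult_right:
  assumes M: "L2.functional M" and c: "c \<in> A"
  shows "L2.functional (\<lambda>F. M (\<lambda>(x, y). F (x, y \<odot> c)))"
proof -
  obtain C where C: "0 \<le> C" "\<forall>F\<in>bilinear_forms A. \<forall>K\<ge>0. wbounded (A \<times> A) norm2 K F \<longrightarrow>
      cmod (M F) \<le> C * K" by (rule L2.functional_bound[OF M])
  note form = bilinear_forms_mult(2)[OF _ c]
  show ?thesis
  proof (rule L2.functionalI)
    fix F G assume F: "F \<in> bilinear_forms A" and G: "G \<in> bilinear_forms A"
    show "M (\<lambda>(x, y). F (x, y \<odot> c) + G (x, y \<odot> c)) =
        M (\<lambda>(x, y). F (x, y \<odot> c)) + M (\<lambda>(x, y). G (x, y \<odot> c))"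
      using L2.functional_add[OF M form[OF F] form[OF G]] by (simp add: case_prod_unfold)
  next
    fix F k assume F: "F \<in> bilinear_forms A"
    show "M (\<lambda>(x, y). k * F (x, y \<odot> c)) = k * M (\<lambda>(x, y). F (x, y \<odot> c))"
      using L2.functional_scale[OF M form[OF F]] by (simp add: case_prod_unfold)
  next
    fix F K assume F: "F \<in> bilinear_forms A" and K: "(0::real) \<le> K" "wbounded (A \<times> A) norm2 K F"
    have "cmod (M (\<lambda>(x, y). F (x, y \<odot> c))) \<le> C * (K * norm c)"
      using C(2) form[OF F] wbounded_bilinear_mult(2)[OF K c] K(1) by simp
    then show "cmod (M (\<lambda>(x, y). F (x, y \<odot> c))) \<le> (C * norm c) * K" by (simp add: mult_ac)
  qed (use C in simp)
qed

section \<open>Virtual identities and virtual diagonals\<close>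

text \<open>The dual of the module below is the bidual of \<open>A\<close> with one of its two actions replaced by
  \<open>0\<close>, so that the canonical embedding of \<open>A\<close> is a derivation.\<close>

lemma amenable_one_sided_identity:
  fixes s t :: complex
  assumes am: "amenable TYPE('a module_universe) A mult"
    and st: "s \<in> {0, 1}" "t = 1 - s"
  obtains E where "L1.functional E"
    "\<forall>z\<in>linear_forms A. \<forall>a\<in>A. z a = E (\<lambda>x. t * z (a \<odot> x)) - E (\<lambda>x. s * z (x \<odot> a))"
proof -
  define l where "l a z = restrict_form A (\<lambda>x. s * z (x \<odot> a))" for a z
  define r where "r z a = restrict_form A (\<lambda>x. t * z (a \<odot> x))" for a z
  \<comment> \<open>One of \<open>s\<close>, \<open>t\<close> is 0 and the other 1. Idempotence
    makes the scaled actions associative, and \<open>s + t = 1\<close> gives the product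
    rule.\<close>
  have idem: "s * (s * c) = s * c" "t * (t * c) = t * c" "s * c + t * c = c" "t * c + s * c = c" for c
    using st by auto
  have le: "cmod s \<le> 1" "cmod t \<le> 1" using st by auto
  have form: "(\<lambda>x. s * z (x \<odot> a)) \<in> linear_forms A" "(\<lambda>x. t * z (a \<odot> x)) \<in> linear_forms A"
    if "z \<in> linear_forms A" "a \<in> A" for z a
    using linear_forms_compose[OF that(1) bounded_map_mult(1)[OF that(2)]]
      linear_forms_compose[OF that(1) bounded_map_mult(2)[OF that(2)]]
    by (auto intro: L1.scale_form)
  have "banach_bimodule A mult L1.forms l r"
  proof (rule L1.forms_bimoduleI[OF banach_alg, where K = 1])
    fix a z and C :: real
    assume a: "a \<in> A" and z: "z \<in> points L1.forms" and C: "0 \<le> C" "wbounded A norm C z"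
    have "wbounded A norm (norm a * C) (\<lambda>x. s * z (x \<odot> a))"
      "wbounded A norm (norm a * C) (\<lambda>x. t * z (a \<odot> x))"
    proof (auto intro!: wboundedI)
      fix x assume x: "x \<in> A"
      have 1: "cmod (z (x \<odot> a)) \<le> C * norm (x \<odot> a)" "cmod (z (a \<odot> x)) \<le> C * norm (a \<odot> x)"
        using wboundedD[OF C(2)] a x by auto
      have 2: "C * norm (x \<odot> a) \<le> C * (norm x * norm a)" "C * norm (a \<odot> x) \<le> C * (norm a * norm x)"
        using a x C norm_mult_le by (auto intro!: mult_left_mono)
      show "cmod (s * z (x \<odot> a)) \<le> norm a * C * norm x"
        using mult_mono[OF le(1) order_trans[OF 1(1) 2(1)]] by (simp add: norm_mult mult_ac)
      show "cmod (t * z (a \<odot> x)) \<le> norm a * C * norm x"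
        using mult_mono[OF le(2) order_trans[OF 1(2) 2(2)]] by (simp add: norm_mult mult_ac)
    qed
    then show "wbounded A norm (1 * norm a * C) (l a z) \<and> wbounded A norm (1 * norm a * C) (r z a)"
      by (simp add: l_def r_def)
  qed (use st in \<open>auto simp: l_def r_def form L1.restrict_form_in linear_formsD mult_simps algebra_simps idem\<close>)
  moreover have "dual_derivation A mult L1.forms l r (\<lambda>a z. z a)"
    unfolding dual_derivation_def
  proof (intro conjI ballI allI)
    fix a assume a: "a \<in> A"
    show "(\<lambda>z. z a) \<in> dual L1.forms"
      unfolding dual_def using a L1.norm_le_wnorm[of _ a]
      by (auto intro!: exI[of _ "norm a"] simp: mult.commute)
  next
    show "\<exists>K. \<forall>a\<in>A. \<forall>z\<in>points L1.forms. cmod (z a) \<le> K * norm a * vnorm L1.forms z"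
      using L1.norm_le_wnorm by (auto intro!: exI[of _ 1] simp: mult.commute)
  \<comment> \<open>The two action terms of the product rule are \<open>t * z (a \<odot> b)\<close>
    and \<open>s * z (a \<odot> b)\<close>.\<close>
  qed (auto simp: linear_formsD dual_lact_def dual_ract_def l_def r_def idem)
  \<comment> \<open>A form is coded in \<open>module_universe\<close> as the singleton of a function
    of two variables; a linear form ignores the second one.\<close>
  moreover have "inj (\<lambda>\<phi>. {\<lambda>(x::'a) (y::'a). \<phi> x :: complex})"
    by (auto simp: inj_def fun_eq_iff)
  ultimately have "inner_derivation A L1.forms l r (\<lambda>a z. z a)"
    using amenable_transfer[OF am] by blast
  then obtain f where f: "f \<in> dual L1.forms"
      "\<forall>a\<in>A. \<forall>z\<in>points L1.forms. z a = f (r z a) - f (l a z)"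
    by (auto simp: inner_derivation_def dual_lact_def dual_ract_def)
  show thesis
  proof (rule that[OF L1.dual_functional[OF f(1)]], intro ballI)
    fix z a assume z: "z \<in> linear_forms A" and a: "a \<in> A"
    have "restrict_form A z \<in> points L1.forms" using L1.restrict_form_in[OF z] by simp
    then have "restrict_form A z a = f (r (restrict_form A z) a) - f (l a (restrict_form A z))"
      using f(2) a by blast
    moreover have "l a (restrict_form A z) = restrict_form A (\<lambda>x. s * z (x \<odot> a))"
      "r (restrict_form A z) a = restrict_form A (\<lambda>x. t * z (a \<odot> x))"
      using a by (auto simp: l_def r_def restrict_form_def)
    ultimately show "z a = f (restrict_form A (\<lambda>x. t * z (a \<odot> x))) -
        f (restrict_form A (\<lambda>x. s * z (x \<odot> a)))"
      using a by simp
  qed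
qed

text \<open>The bidual counterpart of a bounded two-sided approximate identity: the conditions read
  a E = a and E a = a for a in A.\<close>

definition virtual_identity :: "(('a \<Rightarrow> complex) \<Rightarrow> complex) \<Rightarrow> bool" where
  "virtual_identity E \<longleftrightarrow> L1.functional E \<and>
     (\<forall>z\<in>linear_forms A. \<forall>a\<in>A. E (\<lambda>x. z (a \<odot> x)) = z a \<and> E (\<lambda>x. z (x \<odot> a)) = z a)"

text \<open>Switching off the left action gives \<open>R\<close> with a R = a, switching off the
  right one gives \<open>L'\<close> with L' a = - a, the sign being that of the second term of an
  inner derivation. The Arens product merges the two one-sided identities.\<close>

lemma amenable_virtual_identity:
  assumes am: "amenable TYPE('a module_universe) A mult"
  obtains E where "virtual_identity E"
proof -
  obtain R where R: "L1.functional R"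
    and R1: "\<forall>z\<in>linear_forms A. \<forall>a\<in>A. z a = R (\<lambda>x. 1 * z (a \<odot> x)) - R (\<lambda>x. 0 * z (x \<odot> a))"
    by (rule amenable_one_sided_identity[OF am, of 0 1]) auto
  have R_id: "R (\<lambda>x. z (a \<odot> x)) = z a" if "z \<in> linear_forms A" "a \<in> A" for z a
    using R1[rule_format, OF that] by (simp add: L1.functional_zero[OF R])
  obtain L' where L': "L1.functional L'"
    and L1: "\<forall>z\<in>linear_forms A. \<forall>a\<in>A. z a = L' (\<lambda>x. 0 * z (a \<odot> x)) - L' (\<lambda>x. 1 * z (x \<odot> a))"
    by (rule amenable_one_sided_identity[OF am, of 1 0]) auto
  have L_id: "- L' (\<lambda>x. z (x \<odot> a)) = z a" if "z \<in> linear_forms A" "a \<in> A" for z a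
    using L1[rule_format, OF that] by (simp add: L1.functional_zero[OF L'])
  txt \<open>With \<open>e = - L'\<close> and \<open>f = R\<close> \<open>E\<close> is the two-sided unit \<open>e + f - f e\<close>.\<close>
  define J where "J z = L' z - R z - R (\<lambda>x. L' (\<lambda>y. z (x \<odot> y)))" for z
  define E where "E z = - J z" for z
  note inner_form = partial_functional_form(1)[OF L' mult_bilinear_form, simplified]
  have "L1.functional E"
  proof -
    obtain C where C: "0 \<le> C" "\<forall>f\<in>linear_forms A. \<forall>K\<ge>0. wbounded A norm K f \<longrightarrow> cmod (R f) \<le> C * K"
      by (rule L1.functional_bound[OF R])
    obtain C' where C': "0 \<le> C'" "\<forall>f\<in>linear_forms A. \<forall>K\<ge>0. wbounded A norm K f \<longrightarrow> cmod (L' f) \<le> C' * K"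
      by (rule L1.functional_bound[OF L'])
    have RL: "L2.functional (\<lambda>F. R (\<lambda>x. L' (\<lambda>y. F (x, y))))"
      by (rule iterated_functional[OF R L'])
    obtain B where B: "0 \<le> B" "\<forall>F\<in>bilinear_forms A. \<forall>K\<ge>0. wbounded (A \<times> A) norm2 K F \<longrightarrow>
        cmod (R (\<lambda>x. L' (\<lambda>y. F (x, y)))) \<le> B * K"
      by (rule L2.functional_bound[OF RL])
    show ?thesis
    proof (rule L1.functionalI)
      fix f g assume f: "f \<in> linear_forms A" and g: "g \<in> linear_forms A"
      show "E (\<lambda>i. f i + g i) = E f + E g"
        using L2.functional_add[OF RL mult_bilinear_form[OF f] mult_bilinear_form[OF g]]
        by (simp add: E_def J_def L1.functional_add[OF R f g] L1.functional_add[OF L' f g])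
    next
      fix f c assume f: "f \<in> linear_forms A"
      show "E (\<lambda>i. c * f i) = c * E f"
        using L2.functional_scale[OF RL mult_bilinear_form[OF f], of c]
        by (simp add: E_def J_def L1.functional_scale[OF R f] L1.functional_scale[OF L' f] algebra_simps)
    next
      fix f K assume f: "f \<in> linear_forms A" and K: "(0::real) \<le> K" "wbounded A norm K f"
      have "wbounded (A \<times> A) norm2 K (\<lambda>(x, y). f (x \<odot> y))"
        by (rule wbounded_mult[OF K])
      then have "cmod (R (\<lambda>x. L' (\<lambda>y. f (x \<odot> y)))) \<le> B * K"
        using B(2)[rule_format, OF mult_bilinear_form[OF f] K(1)] by simp
      moreover have "cmod (R f) \<le> C * K" "cmod (L' f) \<le> C' * K" using C C' f K by blast+
      moreover have "cmod (E f) \<le> cmod (L' f) + cmod (R f) + cmod (R (\<lambda>x. L' (\<lambda>y. f (x \<odot> y))))"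
        unfolding E_def J_def norm_minus_cancel
        using norm_triangle_ineq4[of "L' f - R f" "R (\<lambda>x. L' (\<lambda>y. f (x \<odot> y)))"]
          norm_triangle_ineq4[of "L' f" "R f"] by linarith
      ultimately show "cmod (E f) \<le> (C + C' + B) * K" by (simp add: algebra_simps)
    qed (use B C C' in simp)
  qed
  moreover have "E (\<lambda>x. z (a \<odot> x)) = z a" if z: "z \<in> linear_forms A" and a: "a \<in> A" for z a
  proof -
    \<comment> \<open>a (f e) = (a f) e = a e, so a E reduces to a f = a.\<close>
    have "R (\<lambda>x. L' (\<lambda>y. z (a \<odot> (x \<odot> y)))) = R (\<lambda>x. L' (\<lambda>y. z ((a \<odot> x) \<odot> y)))"
    proof (rule L1.functional_cong[OF R])
      show "(\<lambda>x. L' (\<lambda>y. z (a \<odot> (x \<odot> y)))) \<in> linear_forms A"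
        using inner_form[OF linear_forms_mult(2)[OF z a]] .
      show "L' (\<lambda>y. z (a \<odot> (x \<odot> y))) = L' (\<lambda>y. z ((a \<odot> x) \<odot> y))" if x: "x \<in> A" for x
        using a x linear_forms_mult(2)[OF linear_forms_mult(2)[OF z a] x]
        by (intro L1.functional_cong[OF L']) (simp_all add: mult_simps)
    qed
    also have "\<dots> = L' (\<lambda>y. z (a \<odot> y))"
      using R_id[OF inner_form[OF z] a] .
    finally show ?thesis by (simp add: E_def J_def R_id[OF z a])
  qed
  moreover have "E (\<lambda>x. z (x \<odot> a)) = z a" if z: "z \<in> linear_forms A" and a: "a \<in> A" for z a
  proof -
    \<comment> \<open>(f e) a = f (e a) = f a, so E a reduces to e a = a.\<close>
    have "R (\<lambda>x. L' (\<lambda>y. z (x \<odot> y \<odot> a))) = R (\<lambda>x. - z (x \<odot> a))"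
    proof (rule L1.functional_cong[OF R])
      show "(\<lambda>x. L' (\<lambda>y. z (x \<odot> y \<odot> a))) \<in> linear_forms A"
        using inner_form[OF linear_forms_mult(1)[OF z a]] .
      show "L' (\<lambda>y. z (x \<odot> y \<odot> a)) = - z (x \<odot> a)" if x: "x \<in> A" for x
      proof -
        have "L' (\<lambda>y. z (x \<odot> y \<odot> a)) = L' (\<lambda>y. z (x \<odot> (y \<odot> a)))"
          using a x linear_forms_mult(2)[OF linear_forms_mult(1)[OF z a] x]
          by (intro L1.functional_cong[OF L']) (simp_all add: mult_simps)
        then show ?thesis using L_id[OF linear_forms_mult(2)[OF z x] a] by (simp add: minus_equation_iff)
      qed
    qed
    also have "\<dots> = - R (\<lambda>x. z (x \<odot> a))"
      using L1.functional_scale[OF R linear_forms_mult(1)[OF z a], of "-1"] by simp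
    finally show ?thesis using L_id[OF z a] by (simp add: E_def J_def)
  qed
  ultimately show thesis using that[of E] by (simp add: virtual_identity_def)
qed

text \<open>The Arens square of a virtual identity is again one. So \<open>E\<close> applied in both
  variables already satisfies the unit law of a diagonal, and only commutation with A is left to be
  corrected.\<close>

lemma virtual_identity_twice:
  assumes E: "virtual_identity E" and \<phi>: "\<phi> \<in> linear_forms A" and a: "a \<in> A"
  shows "E (\<lambda>x. E (\<lambda>y. \<phi> (a \<odot> (x \<odot> y)))) = \<phi> a" "E (\<lambda>x. E (\<lambda>y. \<phi> (x \<odot> y \<odot> a))) = \<phi> a"
proof -
  have id: "E (\<lambda>x. z (a \<odot> x)) = z a" "E (\<lambda>x. z (x \<odot> a)) = z a"
    if "z \<in> linear_forms A" "a \<in> A" for z a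
    using E that by (simp_all add: virtual_identity_def)
  have fE: "L1.functional E" using E by (simp add: virtual_identity_def)
  note form = partial_functional_form(1)[OF fE mult_bilinear_form, simplified]
  note lm = linear_forms_mult
  have "E (\<lambda>x. E (\<lambda>y. \<phi> (a \<odot> (x \<odot> y)))) = E (\<lambda>x. \<phi> (a \<odot> x))"
  proof (rule L1.functional_cong[OF fE form[OF lm(2)[OF \<phi> a]]])
    fix x assume x: "x \<in> A"
    have "E (\<lambda>y. \<phi> (a \<odot> (x \<odot> y))) = E (\<lambda>y. \<phi> (a \<odot> x \<odot> y))"
      using a x lm(2)[OF lm(2)[OF \<phi> a] x]
      by (intro L1.functional_cong[OF fE]) (simp_all add: mult_simps)
    then show "E (\<lambda>y. \<phi> (a \<odot> (x \<odot> y))) = \<phi> (a \<odot> x)" using id(1)[OF \<phi>] a x by simp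
  qed
  then show "E (\<lambda>x. E (\<lambda>y. \<phi> (a \<odot> (x \<odot> y)))) = \<phi> a" by (simp add: id[OF \<phi> a])
  have "E (\<lambda>x. E (\<lambda>y. \<phi> (x \<odot> y \<odot> a))) = E (\<lambda>x. \<phi> (x \<odot> a))"
  proof (rule L1.functional_cong[OF fE form[OF lm(1)[OF \<phi> a]]])
    fix x assume x: "x \<in> A"
    have "E (\<lambda>y. \<phi> (x \<odot> y \<odot> a)) = E (\<lambda>y. \<phi> (x \<odot> (y \<odot> a)))"
      using a x lm(2)[OF lm(1)[OF \<phi> a] x]
      by (intro L1.functional_cong[OF fE]) (simp_all add: mult_simps)
    then show "E (\<lambda>y. \<phi> (x \<odot> y \<odot> a)) = \<phi> (x \<odot> a)" using id(2)[OF lm(2)[OF \<phi> x] a] by simp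
  qed
  then show "E (\<lambda>x. E (\<lambda>y. \<phi> (x \<odot> y \<odot> a))) = \<phi> a" by (simp add: id[OF \<phi> a])
qed

text \<open>Bounded bilinear forms are the dual of the projective tensor square of A, so
  \<open>M\<close> is an element of its bidual. The laws say that c M = M c and that the product of
  M is a left identity for A.\<close>

definition virtual_diagonal :: "(('a \<times> 'a \<Rightarrow> complex) \<Rightarrow> complex) \<Rightarrow> bool" where
  "virtual_diagonal M \<longleftrightarrow> L2.functional M \<and>
     (\<forall>F\<in>bilinear_forms A. \<forall>c\<in>A. M (\<lambda>(x, y). F (c \<odot> x, y)) = M (\<lambda>(x, y). F (x, y \<odot> c))) \<and>
     (\<forall>\<phi>\<in>linear_forms A. \<forall>c\<in>A. M (\<lambda>(x, y). \<phi> (x \<odot> y \<odot> c)) = \<phi> c)"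

text \<open>\<open>E2\<close> has the right product but need not commute with A. Its commutator
  \<open>D a\<close>, that is a E2 - E2 a, is a derivation that annihilates all product forms
  \<open>\<phi> (x \<odot> y)\<close>. If \<open>D\<close> is implemented by a functional
  annihilating them as well, subtracting that functional from \<open>E2\<close> gives a diagonal.
  Amenability supplies \<open>N\<close>, and composing it with the projection \<open>Q\<close> makes
  it annihilate the product forms.\<close>

lemma amenable_virtual_diagonal:
  assumes am: "amenable TYPE('a module_universe) A mult"
  obtains M where "virtual_diagonal M"
proof -
  obtain E where E: "virtual_identity E" by (rule amenable_virtual_identity[OF am])
  have fE: "L1.functional E" using E by (simp add: virtual_identity_def)
  have idE: "E (\<lambda>x. z (a \<odot> x)) = z a" "E (\<lambda>x. z (x \<odot> a)) = z a"
    if "z \<in> linear_forms A" "a \<in> A" for z a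
    using E that by (simp_all add: virtual_identity_def)
  define E2 where "E2 F = E (\<lambda>x. E (\<lambda>y. F (x, y)))" for F :: "'a \<times> 'a \<Rightarrow> complex"
  have fE2: "L2.functional E2" unfolding E2_def by (rule iterated_functional[OF fE fE])
  have E2_mult: "E2 (\<lambda>(x, y). \<phi> (a \<odot> (x \<odot> y))) = \<phi> a" "E2 (\<lambda>(x, y). \<phi> (x \<odot> y \<odot> a)) = \<phi> a"
    if "\<phi> \<in> linear_forms A" "a \<in> A" for \<phi> a
    using virtual_identity_twice[OF E that] by (simp_all add: E2_def)
  note form = bilinear_forms_mult
  note cong = L2.functional_cong[OF fE2]
  define D where "D a F = E2 (\<lambda>(x, y). F (a \<odot> x, y)) - E2 (\<lambda>(x, y). F (x, y \<odot> a))" for a F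
  define R where "R F a = (\<lambda>(x, y). F (a \<odot> x, y) - F (a, x \<odot> y))"
    for F :: "'a \<times> 'a \<Rightarrow> complex" and a
  txt \<open>Johnson's module is the quotient of the bilinear forms by the forms \<open>\<phi> (x \<odot> y)\<close>.  Splitting the
    quotient map by \<open>F \<mapsto> Q F\<close> below turns it into the following twisted right action on all
    bilinear forms, for which no quotient is needed.\<close>
  define l where "l a F = restrict_form (A \<times> A) (\<lambda>(x, y). F (x, y \<odot> a))" for a F
  define r where "r F a = restrict_form (A \<times> A) (R F a)" for F a
  have formR: "R F a \<in> bilinear_forms A" if "F \<in> bilinear_forms A" "a \<in> A" for F a
    using L2.diff_form[OF form(1,3)[OF that]] by (simp add: R_def case_prod_unfold)
  have D_cong: "D a F = D a G" if "F \<in> bilinear_forms A" "a \<in> A"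
    and "\<And>x y. x \<in> A \<Longrightarrow> y \<in> A \<Longrightarrow> F (x, y) = G (x, y)" for a F G
  proof -
    have "E2 (\<lambda>(x, y). F (a \<odot> x, y)) = E2 (\<lambda>(x, y). G (a \<odot> x, y))"
      by (rule cong[OF form(1)]) (use that in auto)
    moreover have "E2 (\<lambda>(x, y). F (x, y \<odot> a)) = E2 (\<lambda>(x, y). G (x, y \<odot> a))"
      by (rule cong[OF form(2)]) (use that in auto)
    ultimately show ?thesis by (simp add: D_def)
  qed
  have D_form: "(\<lambda>a. D a F) \<in> linear_forms A" if F: "F \<in> bilinear_forms A" for F
    unfolding D_def by (intro L1.diff_form functional_mult_form[OF fE2 F])
  have bim: "banach_bimodule A mult L2.forms l r"
  proof (rule L2.forms_bimoduleI[OF banach_alg, where K = 2])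
    fix a F and C :: real
    assume a: "a \<in> A" and F: "F \<in> points L2.forms" and C: "0 \<le> C" "wbounded (A \<times> A) norm2 C F"
    note w = wbounded_bilinear_mult[OF C a]
    have "wbounded (A \<times> A) norm2 (C * norm a + cmod (-1) * (C * norm a))
        (\<lambda>p. (case p of (x, y) \<Rightarrow> F (a \<odot> x, y)) + (-1) * (case p of (x, y) \<Rightarrow> F (a, x \<odot> y)))"
      by (rule wbounded_add[OF w(1) wbounded_scale[OF w(3)]])
    then have "wbounded (A \<times> A) norm2 (2 * norm a * C) (r F a)"
      by (simp add: r_def R_def case_prod_unfold mult_ac)
    moreover have "wbounded (A \<times> A) norm2 (2 * norm a * C) (l a F)"
      using L2.wbounded_mono[OF w(2), of "2 * norm a * C"] C by (simp add: l_def)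
    ultimately show "wbounded (A \<times> A) norm2 (2 * norm a * C) (l a F) \<and>
        wbounded (A \<times> A) norm2 (2 * norm a * C) (r F a)" by simp
  next
    fix a F assume a: "a \<in> A" and F: "F \<in> points L2.forms"
    then show "l a F \<in> points L2.forms" "r F a \<in> points L2.forms"
      by (auto simp: l_def r_def formR form intro!: L2.restrict_form_in)
  \<comment> \<open>The right action is associative because in \<open>R (R F a) b\<close> the term
    \<open>F (a, b \<odot> x \<odot> y)\<close> arises twice, with opposite signs.\<close>
  qed (auto simp: l_def r_def R_def bilinear_formsD mult_simps algebra_simps)
  have D_fun: "L2.functional (D a)" if a: "a \<in> A" for a
  proof -
    obtain C where C: "0 \<le> C" "\<forall>F\<in>bilinear_forms A. \<forall>K\<ge>0. wbounded (A \<times> A) norm2 K F \<longrightarrow>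
        cmod (E2 F) \<le> C * K" by (rule L2.functional_bound[OF fE2])
    show ?thesis
    proof (rule L2.functionalI)
      fix F G assume F: "F \<in> bilinear_forms A" and G: "G \<in> bilinear_forms A"
      show "D a (\<lambda>p. F p + G p) = D a F + D a G"
        using L2.functional_add[OF fE2 form(1)[OF F a] form(1)[OF G a]]
          L2.functional_add[OF fE2 form(2)[OF F a] form(2)[OF G a]]
        by (simp add: D_def case_prod_unfold)
    next
      fix F c assume F: "F \<in> bilinear_forms A"
      show "D a (\<lambda>p. c * F p) = c * D a F"
        using L2.functional_scale[OF fE2 form(1)[OF F a], of c]
          L2.functional_scale[OF fE2 form(2)[OF F a], of c]
        by (simp add: D_def case_prod_unfold right_diff_distrib)
    next
      fix F K assume F: "F \<in> bilinear_forms A" and K: "(0::real) \<le> K" "wbounded (A \<times> A) norm2 K F"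
      have "cmod (E2 (\<lambda>(x, y). F (a \<odot> x, y))) \<le> C * (K * norm a)"
        "cmod (E2 (\<lambda>(x, y). F (x, y \<odot> a))) \<le> C * (K * norm a)"
        using C(2) form[OF F a] wbounded_bilinear_mult[OF K a] K(1) by simp_all
      then show "cmod (D a F) \<le> 2 * C * norm a * K"
        unfolding D_def using norm_triangle_ineq4[of "E2 (\<lambda>(x, y). F (a \<odot> x, y))"
            "E2 (\<lambda>(x, y). F (x, y \<odot> a))"] by (simp add: mult_ac)
    qed (use C in simp)
  qed
  have D_prod: "D (a \<odot> b) F = D b (R F a) + D a (\<lambda>(x, y). F (x, y \<odot> b))"
    if F: "F \<in> bilinear_forms A" and a: "a \<in> A" and b: "b \<in> A" for a b F
  proof -
    \<comment> \<open>On \<open>R F a\<close> the correction term contributes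
      \<open>F (a, b)\<close> to both halves of \<open>D b\<close>, by the two unit laws of
      \<open>E2\<close>, and so cancels. \<open>G\<close> is the middle term that cancels between
      the two summands of the product rule.\<close>
    define G where "G = E2 (\<lambda>(x, y). F (a \<odot> x, y \<odot> b))"
    note sec = bilinear_forms_section(2)[OF F a]
    have "E2 (\<lambda>(x, y). R F a (b \<odot> x, y)) =
        E2 (\<lambda>p. (case p of (x, y) \<Rightarrow> F (a \<odot> b \<odot> x, y)) - (case p of (x, y) \<Rightarrow> F (a, b \<odot> (x \<odot> y))))"
      using a b by (intro cong[OF form(1)[OF formR[OF F a] b]]) (auto simp: R_def mult_simps)
    also have "\<dots> = E2 (\<lambda>(x, y). F (a \<odot> b \<odot> x, y)) - F (a, b)"
      using L2.functional_diff[OF fE2 form(1)[OF F] mult_bilinear_form[OF linear_forms_mult(2)[OF sec b]]]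
        E2_mult(1)[OF sec b] a b by simp
    finally have 1: "E2 (\<lambda>(x, y). R F a (b \<odot> x, y)) = E2 (\<lambda>(x, y). F (a \<odot> b \<odot> x, y)) - F (a, b)" .
    have "E2 (\<lambda>(x, y). R F a (x, y \<odot> b)) =
        E2 (\<lambda>p. (case p of (x, y) \<Rightarrow> F (a \<odot> x, y \<odot> b)) - (case p of (x, y) \<Rightarrow> F (a, x \<odot> y \<odot> b)))"
      using a b by (intro cong[OF form(2)[OF formR[OF F a] b]]) (auto simp: R_def mult_simps)
    also have "\<dots> = G - F (a, b)"
      using L2.functional_diff[OF fE2 form(1)[OF form(2)[OF F b] a]
          mult_bilinear_form[OF linear_forms_mult(1)[OF sec b]]]
        E2_mult(2)[OF sec b] a b by (simp add: G_def)
    finally have 2: "E2 (\<lambda>(x, y). R F a (x, y \<odot> b)) = G - F (a, b)" .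
    have 3: "E2 (\<lambda>(x, y). F (x, y \<odot> a \<odot> b)) = E2 (\<lambda>(x, y). F (x, y \<odot> (a \<odot> b)))"
      using a b form(2)[OF form(2)[OF F b] a] by (intro cong) (auto simp: mult_simps)
    show ?thesis
      using 1 2 3 by (simp add: D_def G_def)
  qed
  have der: "dual_derivation A mult L2.forms l r D"
    unfolding dual_derivation_def
  proof (intro conjI ballI allI)
    fix a assume a: "a \<in> A"
    show "D a \<in> dual L2.forms" by (rule L2.functional_dual[OF D_fun[OF a]])
  next
    fix a b F assume a: "a \<in> A" and b: "b \<in> A" and "F \<in> points L2.forms"
    then have F: "F \<in> bilinear_forms A" by simp
    show "D (a + b) F = D a F + D b F"
      by (rule linear_formsD(1)[OF D_form[OF F] a b])
    have "D b (r F a) = D b (R F a)"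
      by (rule D_cong[symmetric]) (use a b F formR in \<open>auto simp: r_def\<close>)
    moreover have "D a (l b F) = D a (\<lambda>(x, y). F (x, y \<odot> b))"
      by (rule D_cong[symmetric]) (use a b form(2)[OF F b] in \<open>auto simp: l_def\<close>)
    ultimately show "D (a \<odot> b) F = dual_lact r a (D b) F + dual_ract l (D a) b F"
      using D_prod[OF F a b] by (simp add: dual_lact_def dual_ract_def)
  next
    fix a c F assume a: "a \<in> A" and "F \<in> points L2.forms"
    then have F: "F \<in> bilinear_forms A" by simp
    show "D (c *\<^sub>C a) F = c * D a F" by (rule linear_formsD(2)[OF D_form[OF F] a])
  next
    obtain C where C: "0 \<le> C" "\<forall>F\<in>bilinear_forms A. \<forall>K\<ge>0. wbounded (A \<times> A) norm2 K F \<longrightarrow>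
        cmod (E2 F) \<le> C * K" by (rule L2.functional_bound[OF fE2])
    show "\<exists>K. \<forall>a\<in>A. \<forall>F\<in>points L2.forms. cmod (D a F) \<le> K * norm a * vnorm L2.forms F"
    proof (intro exI[of _ "2 * C"] ballI)
      fix a F assume a: "a \<in> A" and "F \<in> points L2.forms"
      then have F: "F \<in> bilinear_forms A" by simp
      note K = L2.wnorm_nonneg[OF F] L2.wbounded_wnorm[OF F]
      have "cmod (E2 (\<lambda>(x, y). F (a \<odot> x, y))) \<le> C * (L2.wnorm F * norm a)"
        "cmod (E2 (\<lambda>(x, y). F (x, y \<odot> a))) \<le> C * (L2.wnorm F * norm a)"
        using C(2) form[OF F a] wbounded_bilinear_mult[OF K a] K(1) by simp_all
      then show "cmod (D a F) \<le> 2 * C * norm a * vnorm L2.forms F"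
        unfolding D_def using norm_triangle_ineq4[of "E2 (\<lambda>(x, y). F (a \<odot> x, y))"
            "E2 (\<lambda>(x, y). F (x, y \<odot> a))"] by (simp add: mult_ac)
    qed
  qed
  have "inj (\<lambda>F. {\<lambda>(x::'a) (y::'a). F (x, y) :: complex})"
    by (auto simp: inj_def fun_eq_iff)
  from amenable_transfer[OF am this bim der]
  obtain N0 where N0: "N0 \<in> dual L2.forms"
      "\<forall>a\<in>A. \<forall>F\<in>points L2.forms. D a F = N0 (r F a) - N0 (l a F)"
    by (auto simp: inner_derivation_def dual_lact_def dual_ract_def)
  define N where "N F = N0 (restrict_form (A \<times> A) F)" for F
  have fN: "L2.functional N" unfolding N_def by (rule L2.dual_functional[OF N0(1)])
  have N: "D a F = N (R F a) - N (\<lambda>(x, y). F (x, y \<odot> a))" if F: "F \<in> bilinear_forms A" and a: "a \<in> A" for a F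
  proof -
    let ?F = "restrict_form (A \<times> A) F"
    have "?F \<in> points L2.forms" using L2.restrict_form_in[OF F] by simp
    then have "D a ?F = N0 (r ?F a) - N0 (l a ?F)" using N0(2) a by blast
    moreover have "l a ?F = restrict_form (A \<times> A) (\<lambda>(x, y). F (x, y \<odot> a))"
      "r ?F a = restrict_form (A \<times> A) (R F a)"
      using a by (auto simp: l_def r_def R_def restrict_form_def)
    moreover have "D a ?F = D a F"
      by (rule D_cong[symmetric]) (use F a in auto)
    ultimately show ?thesis by (simp add: N_def)
  qed
  \<comment> \<open>For \<open>F (x, y) = \<phi> (x \<odot> y)\<close> the form \<open>w F\<close>
    is \<open>\<phi>\<close> on A, since E c = c. So on \<open>A \<times> A\<close> the map
    \<open>Q\<close> is a projection whose kernel is the product forms. As c E = c too,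
    \<open>R F a\<close> is \<open>Q\<close> of the form \<open>F (a \<odot> x, y)\<close>.\<close>
  define w where "w F = (\<lambda>c. E (\<lambda>x. F (x, c)))" for F :: "'a \<times> 'a \<Rightarrow> complex"
  define Q where "Q F = (\<lambda>(x, y). F (x, y) - w F (x \<odot> y))" for F :: "'a \<times> 'a \<Rightarrow> complex"
  have w: "w F \<in> linear_forms A" if "F \<in> bilinear_forms A" for F
    unfolding w_def by (rule partial_functional_form(2)[OF fE that])
  have Q: "Q F \<in> bilinear_forms A" if F: "F \<in> bilinear_forms A" for F
    using L2.diff_form[OF F mult_bilinear_form[OF w[OF F]]] by (simp add: Q_def case_prod_unfold)
  define M where "M F = E2 F - N (Q F)" for F
  have "L2.functional M"
  proof -
    obtain C where C: "0 \<le> C" "\<forall>f\<in>linear_forms A. \<forall>K\<ge>0. wbounded A norm K f \<longrightarrow> cmod (E f) \<le> C * K"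
      by (rule L1.functional_bound[OF fE])
    obtain C2 where C2: "0 \<le> C2" "\<forall>F\<in>bilinear_forms A. \<forall>K\<ge>0. wbounded (A \<times> A) norm2 K F \<longrightarrow>
        cmod (E2 F) \<le> C2 * K" by (rule L2.functional_bound[OF fE2])
    obtain CN where CN: "0 \<le> CN" "\<forall>F\<in>bilinear_forms A. \<forall>K\<ge>0. wbounded (A \<times> A) norm2 K F \<longrightarrow>
        cmod (N F) \<le> CN * K" by (rule L2.functional_bound[OF fN])
    note sec = bilinear_forms_section(1)
    show ?thesis
    proof (rule L2.functionalI)
      fix F G assume F: "F \<in> bilinear_forms A" and G: "G \<in> bilinear_forms A"
      note FG = L2.add_form[OF F G]
      have "N (Q (\<lambda>p. F p + G p)) = N (\<lambda>p. Q F p + Q G p)"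
        by (rule L2.functional_cong[OF fN Q[OF FG]])
          (auto simp: Q_def w_def L1.functional_add[OF fE] sec[OF F] sec[OF G])
      then show "M (\<lambda>p. F p + G p) = M F + M G"
        by (simp add: M_def L2.functional_add[OF fE2 F G] L2.functional_add[OF fN Q[OF F] Q[OF G]])
    next
      fix F c assume F: "F \<in> bilinear_forms A"
      have "N (Q (\<lambda>p. c * F p)) = N (\<lambda>p. c * Q F p)"
        by (rule L2.functional_cong[OF fN Q[OF L2.scale_form[OF F]]])
          (auto simp: Q_def w_def L1.functional_scale[OF fE] sec[OF F] right_diff_distrib)
      then show "M (\<lambda>p. c * F p) = c * M F"
        by (simp add: M_def L2.functional_scale[OF fE2 F] L2.functional_scale[OF fN Q[OF F]]
            right_diff_distrib)
    next
      fix F K assume F: "F \<in> bilinear_forms A" and K: "(0::real) \<le> K" "wbounded (A \<times> A) norm2 K F"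
      have "wbounded A norm (C * K) (w F)"
      proof (rule wboundedI)
        fix c assume c: "c \<in> A"
        have "wbounded A norm (K * norm c) (\<lambda>x. F (x, c))"
          using wboundedD[OF K(2), of "(_, c)"] c by (auto intro!: wboundedI simp: mult_ac)
        then have "cmod (E (\<lambda>x. F (x, c))) \<le> C * (K * norm c)" using C(2) sec[OF F c] K(1) by simp
        then show "cmod (w F c) \<le> C * K * norm c" by (simp add: w_def mult.assoc)
      qed
      then have "wbounded (A \<times> A) norm2 (C * K) (\<lambda>(x, y). w F (x \<odot> y))"
        using C(1) K(1) by (intro wbounded_mult) simp_all
      from wbounded_add[OF K(2) wbounded_scale[OF this, of "-1"]]
      have "wbounded (A \<times> A) norm2 (K + C * K) (Q F)"
        by (simp add: Q_def case_prod_unfold)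
      then have "cmod (N (Q F)) \<le> CN * (K + C * K)" using CN(2) Q[OF F] K(1) C(1) by simp
      moreover have "cmod (E2 F) \<le> C2 * K" using C2(2) F K by simp
      ultimately show "cmod (M F) \<le> (C2 + CN * (1 + C)) * K"
        unfolding M_def using norm_triangle_ineq4[of "E2 F" "N (Q F)"] by (simp add: algebra_simps)
    qed (use C C2 CN in simp)
  qed
  moreover have "M (\<lambda>(x, y). F (c \<odot> x, y)) = M (\<lambda>(x, y). F (x, y \<odot> c))"
    if F: "F \<in> bilinear_forms A" and c: "c \<in> A" for F c
  proof -
    \<comment> \<open>Both halves equal \<open>w F c\<close>, by the two unit laws of
      \<open>E2\<close>.\<close>
    have "D c (\<lambda>(x, y). w F (x \<odot> y)) = 0"
    proof -
      have "E2 (\<lambda>(x, y). w F (c \<odot> x \<odot> y)) = E2 (\<lambda>(x, y). w F (c \<odot> (x \<odot> y)))"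
        using c form(1)[OF mult_bilinear_form[OF w[OF F]] c]
        by (intro cong) (auto simp: mult_simps)
      moreover have "E2 (\<lambda>(x, y). w F (x \<odot> (y \<odot> c))) = E2 (\<lambda>(x, y). w F (x \<odot> y \<odot> c))"
        using c form(2)[OF mult_bilinear_form[OF w[OF F]] c]
        by (intro cong) (auto simp: mult_simps)
      ultimately show ?thesis by (simp add: D_def E2_mult[OF w[OF F] c])
    qed
    then have "D c (Q F) = D c F"
      using L2.functional_diff[OF D_fun[OF c] F mult_bilinear_form[OF w[OF F]]]
      by (simp add: Q_def case_prod_unfold)
    \<comment> \<open>In \<open>R (Q F) c\<close> the two \<open>w F\<close> terms cancel. The
      remaining correction \<open>F (c, x \<odot> y)\<close> is \<open>w\<close> of the shifted form
      at \<open>x \<odot> y\<close>.\<close>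
    moreover have "N (R (Q F) c) = N (Q (\<lambda>(x, y). F (c \<odot> x, y)))"
    proof (rule L2.functional_cong[OF fN formR[OF Q[OF F] c]], clarify)
      fix x y assume xy: "x \<in> A" "y \<in> A"
      have "w (\<lambda>(x, y). F (c \<odot> x, y)) (x \<odot> y) = F (c, x \<odot> y)"
        using idE(1)[OF bilinear_forms_section(1)[OF F] c] xy by (simp add: w_def)
      then show "R (Q F) c (x, y) = Q (\<lambda>(x, y). F (c \<odot> x, y)) (x, y)"
        using xy c by (simp add: R_def Q_def mult_simps)
    qed
    moreover have "N (\<lambda>(x, y). Q F (x, y \<odot> c)) = N (Q (\<lambda>(x, y). F (x, y \<odot> c)))"
      by (rule L2.functional_cong[OF fN form(2)[OF Q[OF F] c]])
        (use c in \<open>auto simp: Q_def w_def mult_simps\<close>)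
    ultimately have "D c F = N (Q (\<lambda>(x, y). F (c \<odot> x, y))) - N (Q (\<lambda>(x, y). F (x, y \<odot> c)))"
      using N[OF Q[OF F] c] by simp
    then show ?thesis by (simp add: M_def D_def algebra_simps)
  qed
  moreover have "M (\<lambda>(x, y). \<phi> (x \<odot> y \<odot> c)) = \<phi> c" if \<phi>: "\<phi> \<in> linear_forms A" and c: "c \<in> A" for \<phi> c
  proof -
    let ?F = "\<lambda>(x, y). \<phi> (x \<odot> y \<odot> c)"
    have F: "?F \<in> bilinear_forms A" using mult_bilinear_form[OF linear_forms_mult(1)[OF \<phi> c]] .
    have "w ?F e = \<phi> (e \<odot> c)" if e: "e \<in> A" for e
    proof -
      have "E (\<lambda>x. \<phi> (x \<odot> e \<odot> c)) = E (\<lambda>x. \<phi> (x \<odot> (e \<odot> c)))"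
        using c e linear_forms_mult(1)[OF linear_forms_mult(1)[OF \<phi> c] e]
        by (intro L1.functional_cong[OF fE]) (simp_all add: mult_simps)
      then show ?thesis using idE(2)[OF \<phi>, of "e \<odot> c"] c e by (simp add: w_def)
    qed
    \<comment> \<open>\<open>?F\<close> is a product form, so \<open>Q\<close> kills it and the unit
      law of \<open>E2\<close> is all that remains.\<close>
    then have "N (Q ?F) = N (\<lambda>p. 0)"
      by (intro L2.functional_cong[OF fN Q[OF F]]) (use c in \<open>auto simp: Q_def\<close>)
    then show ?thesis by (simp add: M_def E2_mult[OF \<phi> c] L2.functional_zero[OF fN])
  qed
  ultimately show thesis using that[of M] by (simp add: virtual_diagonal_def)
qed

section \<open>Amenability from a virtual diagonal\<close>

text \<open>Write M formally as a sum of tensors of x and y. The functional \<open>f\<close> is then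
  the sum of the x . D(y), and it would implement \<open>D\<close> if the product of M acted as the
  identity on the dual module. It does so only after a further left action by A, and
  \<open>g\<close> takes care of the difference.\<close>

lemma virtual_diagonal_inner:
  assumes M: "virtual_diagonal M" and bim: "banach_bimodule A mult Z l r"
    and der: "dual_derivation A mult Z l r D"
  shows "inner_derivation A Z l r D"
proof -
  have fM: "L2.functional M" using M by (simp add: virtual_diagonal_def)
  have M_comm: "M (\<lambda>(x, y). F (c \<odot> x, y)) = M (\<lambda>(x, y). F (x, y \<odot> c))"
    if "F \<in> bilinear_forms A" "c \<in> A" for F c
    using M that by (simp add: virtual_diagonal_def)
  have M_unit: "M (\<lambda>(x, y). \<phi> (x \<odot> y \<odot> c)) = \<phi> c" if "\<phi> \<in> linear_forms A" "c \<in> A" for \<phi> c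
    using M that by (simp add: virtual_diagonal_def)
  obtain CM where CM: "0 \<le> CM" "\<forall>F\<in>bilinear_forms A. \<forall>K\<ge>0. wbounded (A \<times> A) norm2 K F \<longrightarrow>
      cmod (M F) \<le> CM * K" by (rule L2.functional_bound[OF fM])
  have bs: "banach_space Z" using bim by (simp add: banach_bimodule_def)
  note bsD = banach_spaceD[OF bs]
  have P: "l a z \<in> points Z" "r z a \<in> points Z" if "a \<in> A" "z \<in> points Z" for a z
    using bim that by (simp_all add: banach_bimodule_def)
  have add_alg: "l (a + b) z = vadd Z (l a z) (l b z)" "r z (a + b) = vadd Z (r z a) (r z b)"
    if "a \<in> A" "b \<in> A" "z \<in> points Z" for a b z
    using bim that by (simp_all add: banach_bimodule_def)
  have scale_alg: "l (c *\<^sub>C a) z = vscale Z c (l a z)" "r z (c *\<^sub>C a) = vscale Z c (r z a)"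
    if "a \<in> A" "z \<in> points Z" for a c z
    using bim that by (simp_all add: banach_bimodule_def)
  have add: "l a (vadd Z y z) = vadd Z (l a y) (l a z)" "r (vadd Z y z) a = vadd Z (r y a) (r z a)"
    if "a \<in> A" "y \<in> points Z" "z \<in> points Z" for a y z
    using bim that by (simp_all add: banach_bimodule_def)
  have scale: "l a (vscale Z c z) = vscale Z c (l a z)" "r (vscale Z c z) a = vscale Z c (r z a)"
    if "a \<in> A" "z \<in> points Z" for a c z
    using bim that by (simp_all add: banach_bimodule_def)
  have assoc: "l a (l b z) = l (a \<odot> b) z" "r (r z a) b = r z (a \<odot> b)" "r (l a z) b = l a (r z b)"
    if "a \<in> A" "b \<in> A" "z \<in> points Z" for a b z
    using bim that by (simp_all add: banach_bimodule_def)
  have nonneg: "0 \<le> vnorm Z z" if "z \<in> points Z" for z by (rule bsD(4)[OF that])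
  obtain K0 where K0: "\<forall>a\<in>A. \<forall>z\<in>points Z.
      vnorm Z (l a z) \<le> K0 * norm a * vnorm Z z \<and> vnorm Z (r z a) \<le> K0 * norm a * vnorm Z z"
    using bim by (auto simp: banach_bimodule_def)
  \<comment> \<open>The constants in the definitions of module and derivation may be negative, while
    the estimates below multiply by them.\<close>
  define K where "K = max 0 K0"
  have K: "0 \<le> K" "vnorm Z (l a z) \<le> K * norm a * vnorm Z z" "vnorm Z (r z a) \<le> K * norm a * vnorm Z z"
    if "a \<in> A" "z \<in> points Z" for a z
    unfolding K_def using K0 that nonneg[OF that(2)]
    by (auto intro: order_trans[OF _ mult_right_mono[OF mult_right_mono[of K0 "max 0 K0"]]])
  have K_nonneg: "0 \<le> K" by (simp add: K_def)
  have dualD: "h (vadd Z x y) = h x + h y" "h (vscale Z c x) = c * h x"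
    if "h \<in> dual Z" "x \<in> points Z" "y \<in> points Z" for h x y c
    using that by (simp_all add: dual_def)
  have D_dual: "D a \<in> dual Z" if "a \<in> A" for a using der that by (simp add: dual_derivation_def)
  note D_lin = dualD[OF D_dual]
  have D_add: "D (a + b) z = D a z + D b z" if "a \<in> A" "b \<in> A" "z \<in> points Z" for a b z
    using der that by (simp add: dual_derivation_def)
  have D_scale: "D (c *\<^sub>C a) z = c * D a z" if "a \<in> A" "z \<in> points Z" for a c z
    using der that by (simp add: dual_derivation_def)
  have D_mult: "D (a \<odot> b) z = D b (r z a) + D a (l b z)" if "a \<in> A" "b \<in> A" "z \<in> points Z" for a b z
    using der that by (simp add: dual_derivation_def dual_lact_def dual_ract_def)
  obtain KD0 where KD0: "\<forall>a\<in>A. \<forall>z\<in>points Z. cmod (D a z) \<le> KD0 * norm a * vnorm Z z"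
    using der by (auto simp: dual_derivation_def)
  define KD where "KD = max 0 KD0"
  have KD_nonneg: "0 \<le> KD" by (simp add: KD_def)
  have KD: "cmod (D a z) \<le> KD * norm a * vnorm Z z" if "a \<in> A" "z \<in> points Z" for a z
    unfolding KD_def using KD0 that nonneg[OF that(2)]
    by (auto intro: order_trans[OF _ mult_right_mono[OF mult_right_mono[of KD0 "max 0 KD0"]]])
  have D_r: "cmod (D y (r z x)) \<le> (KD * K * vnorm Z z) * (norm x * norm y)"
    if "x \<in> A" "y \<in> A" "z \<in> points Z" for x y z
  proof -
    have "cmod (D y (r z x)) \<le> KD * norm y * vnorm Z (r z x)" using KD that P by simp
    also have "\<dots> \<le> KD * norm y * (K * norm x * vnorm Z z)"
      using K that KD_nonneg by (intro mult_left_mono) auto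
    finally show ?thesis by (simp add: mult_ac)
  qed
  define F where "F z = (\<lambda>(x, y). D y (r z x))" for z
  have F_form: "F z \<in> bilinear_forms A" if "z \<in> points Z" for z
    by (rule bilinear_formsI[where K = "KD * K * vnorm Z z"])
      (use that D_r in \<open>auto simp: F_def D_add D_scale D_lin P add_alg scale_alg\<close>)
  have F_bound: "wbounded (A \<times> A) norm2 (KD * K * vnorm Z z) (F z)" if "z \<in> points Z" for z
    using that D_r by (auto simp: F_def wbounded_def)
  define f where "f z = M (F z)" for z
  have f_dual: "f \<in> dual Z"
    unfolding dual_def
  proof (intro CollectI conjI ballI allI)
    fix y z assume yz: "y \<in> points Z" "z \<in> points Z"
    have "f (vadd Z y z) = M (\<lambda>p. F y p + F z p)"
      unfolding f_def using yz bsD F_form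
      by (intro L2.functional_cong[OF fM]) (auto simp: F_def add D_lin P)
    then show "f (vadd Z y z) = f y + f z"
      using L2.functional_add[OF fM F_form F_form] yz by (simp add: f_def)
  next
    fix c z assume z: "z \<in> points Z"
    have "f (vscale Z c z) = M (\<lambda>p. c * F z p)"
      unfolding f_def using z bsD F_form
      by (intro L2.functional_cong[OF fM]) (auto simp: F_def scale D_lin P)
    then show "f (vscale Z c z) = c * f z"
      using L2.functional_scale[OF fM F_form] z by (simp add: f_def)
  next
    have "cmod (f z) \<le> CM * (KD * K * vnorm Z z)" if "z \<in> points Z" for z
      unfolding f_def using CM(2) F_form[OF that] F_bound[OF that] KD_nonneg K_nonneg nonneg[OF that]
      by simp
    then show "\<exists>C. \<forall>z\<in>points Z. cmod (f z) \<le> C * vnorm Z z"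
      by (intro exI[of _ "CM * KD * K"]) (simp add: mult.assoc)
  qed
  have phi: "(\<lambda>e. D c (r z e)) \<in> linear_forms A" if "c \<in> A" "z \<in> points Z" for c z
    using bilinear_forms_section(1)[OF F_form[OF that(2)] that(1)] by (simp add: F_def)
  \<comment> \<open>Formally \<open>c f = \<Sum> cx D(y) = \<Sum> x D(yc) = (\<Sum> xy) D(c) + f
    c\<close>, by commutation and the product rule.\<close>
  have f_inner: "f (r z c) - f (l c z) = M (\<lambda>(x, y). D c (r z (x \<odot> y)))"
    if c: "c \<in> A" and z: "z \<in> points Z" for c z
  proof -
    note fl = F_form[OF P(1)[OF c z]]
    have "f (r z c) = M (\<lambda>(x, y). F z (c \<odot> x, y))"
      unfolding f_def using c z P F_form
      by (intro L2.functional_cong[OF fM]) (auto simp: F_def assoc)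
    also have "\<dots> = M (\<lambda>(x, y). F z (x, y \<odot> c))" by (rule M_comm[OF F_form[OF z] c])
    also have "\<dots> = M (\<lambda>p. (case p of (x, y) \<Rightarrow> D c (r z (x \<odot> y))) + F (l c z) p)"
      using c z P by (intro L2.functional_cong[OF fM bilinear_forms_mult(2)[OF F_form[OF z] c]])
        (auto simp: F_def D_mult assoc)
    also have "\<dots> = M (\<lambda>(x, y). D c (r z (x \<odot> y))) + f (l c z)"
      using L2.functional_add[OF fM mult_bilinear_form[OF phi[OF c z]] fl] by (simp add: f_def)
    finally show ?thesis by simp
  qed
  txt \<open>Subtracting the inner derivation given by \<open>f\<close> leaves a derivation whose values are
    annihilated by the left action of \<open>A\<close> on the dual.\<close>
  define D' where "D' c z = D c z - (f (r z c) - f (l c z))" for c z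
  have D'_r: "D' c (r z a) = 0" if c: "c \<in> A" and a: "a \<in> A" and z: "z \<in> points Z" for a c z
  proof -
    note form = mult_bilinear_form[OF phi[OF c z]]
    have "f (r (r z a) c) - f (l c (r z a)) = M (\<lambda>(x, y). D c (r (r z a) (x \<odot> y)))"
      using f_inner[OF c P(2)[OF a z]] .
    also have "\<dots> = M (\<lambda>(x, y). D c (r z (a \<odot> x \<odot> y)))"
      using a z by (intro L2.functional_cong[OF fM mult_bilinear_form[OF phi[OF c P(2)[OF a z]]]])
        (auto simp: assoc mult_simps)
    \<comment> \<open>Commutation carries \<open>a\<close> to the far right, where the unit law
      absorbs the diagonal.\<close>
    also have "\<dots> = M (\<lambda>(x, y). D c (r z (x \<odot> (y \<odot> a))))" using M_comm[OF form a] by simp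
    also have "\<dots> = M (\<lambda>(x, y). D c (r z (x \<odot> y \<odot> a)))"
      using a bilinear_forms_mult(2)[OF form a]
      by (intro L2.functional_cong[OF fM]) (auto simp: mult_simps)
    also have "\<dots> = D c (r z a)" by (rule M_unit[OF phi[OF c z] a])
    finally show ?thesis by (simp add: D'_def)
  qed
  have D'_mult: "D' (a \<odot> b) z = D' a (l b z)" if a: "a \<in> A" and b: "b \<in> A" and z: "z \<in> points Z" for a b z
  proof -
    have "D' (a \<odot> b) z = D' b (r z a) + D' a (l b z)"
      using a b z by (simp add: D'_def D_mult assoc)
    then show ?thesis using D'_r[OF b a z] by simp
  qed
  obtain Kf0 where Kf0: "\<forall>z\<in>points Z. cmod (f z) \<le> Kf0 * vnorm Z z"
    using f_dual by (auto simp: dual_def)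
  define Kf where "Kf = max 0 Kf0"
  have Kf: "cmod (f z) \<le> Kf * vnorm Z z" if "z \<in> points Z" for z
    unfolding Kf_def using Kf0 that nonneg[OF that]
    by (auto intro: order_trans[OF _ mult_right_mono[of Kf0 "max 0 Kf0"]])
  have Kf_nonneg: "0 \<le> Kf" by (simp add: Kf_def)
  define K' where "K' = KD + 2 * (Kf * K)"
  have K'_nonneg: "0 \<le> K'" using KD_nonneg Kf_nonneg K_nonneg by (simp add: K'_def)
  have D'_bound: "cmod (D' c z) \<le> K' * vnorm Z z * norm c" if c: "c \<in> A" and z: "z \<in> points Z" for c z
  proof -
    have "cmod (f (r z c)) \<le> Kf * (K * norm c * vnorm Z z)"
      using order_trans[OF Kf[OF P(2)[OF c z]] mult_left_mono[OF K(3)[OF c z] Kf_nonneg]] .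
    moreover have "cmod (f (l c z)) \<le> Kf * (K * norm c * vnorm Z z)"
      using order_trans[OF Kf[OF P(1)[OF c z]] mult_left_mono[OF K(2)[OF c z] Kf_nonneg]] .
    moreover have "cmod (D' c z) \<le> cmod (D c z) + (cmod (f (r z c)) + cmod (f (l c z)))"
      unfolding D'_def using norm_triangle_ineq4[of "D c z" "f (r z c) - f (l c z)"]
        norm_triangle_ineq4[of "f (r z c)" "f (l c z)"] by linarith
    ultimately have "cmod (D' c z) \<le> KD * norm c * vnorm Z z + 2 * (Kf * (K * norm c * vnorm Z z))"
      using KD[OF c z] by linarith
    then show ?thesis by (simp add: K'_def algebra_simps)
  qed
  note f_lin = dualD[OF f_dual]
  have D'_form: "(\<lambda>c. D' c z) \<in> linear_forms A" if z: "z \<in> points Z" for z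
    by (rule linear_formsI[where K = "K' * vnorm Z z"])
      (use z D'_bound in \<open>auto simp: D'_def D_add D_scale f_lin P add_alg scale_alg algebra_simps\<close>)
  have D'_lin: "D' c (vadd Z y z) = D' c y + D' c z" "D' c (vscale Z k y) = k * D' c y"
    if "c \<in> A" "y \<in> points Z" "z \<in> points Z" for c y z k
    using that by (simp_all add: D'_def D_lin f_lin P add scale algebra_simps)
  \<comment> \<open>\<open>D' (a \<odot> b)\<close> is \<open>D' a\<close> acted on by
    \<open>b\<close> from the right, so the unit law recovers \<open>D' c\<close> from the values of
    \<open>D'\<close> at \<open>x \<odot> y \<odot> c\<close>. The sign offsets the minus in front
    of the right action term of an inner derivation.\<close>
  define g where "g z = - M (\<lambda>(x, y). D' (x \<odot> y) z)" for z
  note G_form = mult_bilinear_form[OF D'_form]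
  have g_dual: "g \<in> dual Z"
    unfolding dual_def
  proof (intro CollectI conjI ballI allI)
    fix y z assume yz: "y \<in> points Z" "z \<in> points Z"
    have "M (\<lambda>(u, v). D' (u \<odot> v) (vadd Z y z)) =
        M (\<lambda>p. (case p of (u, v) \<Rightarrow> D' (u \<odot> v) y) + (case p of (u, v) \<Rightarrow> D' (u \<odot> v) z))"
      using yz bsD by (intro L2.functional_cong[OF fM G_form]) (auto simp: D'_lin)
    then show "g (vadd Z y z) = g y + g z"
      using L2.functional_add[OF fM G_form G_form] yz by (simp add: g_def)
  next
    fix c z assume z: "z \<in> points Z"
    have "M (\<lambda>(u, v). D' (u \<odot> v) (vscale Z c z)) = M (\<lambda>p. c * (case p of (u, v) \<Rightarrow> D' (u \<odot> v) z))"
      using z bsD by (intro L2.functional_cong[OF fM G_form]) (auto simp: D'_lin)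
    then show "g (vscale Z c z) = c * g z"
      using L2.functional_scale[OF fM G_form] z by (simp add: g_def)
  next
    have "cmod (g z) \<le> CM * (K' * vnorm Z z)" if z: "z \<in> points Z" for z
    proof -
      have 0: "0 \<le> K' * vnorm Z z" using K'_nonneg nonneg[OF z] by simp
      moreover have "wbounded A norm (K' * vnorm Z z) (\<lambda>c. D' c z)"
        using D'_bound z by (simp add: wbounded_def)
      ultimately show ?thesis
        unfolding g_def norm_minus_cancel
        using CM(2) G_form[OF z] wbounded_mult[OF 0, of "\<lambda>c. D' c z"] by blast
    qed
    then show "\<exists>C. \<forall>z\<in>points Z. cmod (g z) \<le> C * vnorm Z z"
      by (intro exI[of _ "CM * K'"]) (simp add: mult.assoc)
  qed
  have g_inner: "D' c z = g (r z c) - g (l c z)" if c: "c \<in> A" and z: "z \<in> points Z" for c z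
  proof -
    have "M (\<lambda>(x, y). D' (x \<odot> y) (r z c)) = M (\<lambda>p. 0)"
      using c z P by (intro L2.functional_cong[OF fM G_form]) (auto simp: D'_r)
    moreover have "M (\<lambda>(x, y). D' (x \<odot> y) (l c z)) = M (\<lambda>(x, y). D' (x \<odot> y \<odot> c) z)"
      using c z P by (intro L2.functional_cong[OF fM G_form]) (auto simp: D'_mult)
    ultimately show ?thesis
      using M_unit[OF D'_form[OF z] c] by (simp add: g_def L2.functional_zero[OF fM])
  qed
  show ?thesis
    unfolding inner_derivation_def dual_lact_def dual_ract_def
  proof (intro bexI[of _ "\<lambda>z. f z + g z"] ballI)
    show "D a z = f (r z a) + g (r z a) - (f (l a z) + g (l a z))" if "a \<in> A" "z \<in> points Z" for a z
      using g_inner[OF that] by (simp add: D'_def algebra_simps)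
    obtain Kg where Kg: "\<forall>z\<in>points Z. cmod (g z) \<le> Kg * vnorm Z z"
      using g_dual by (auto simp: dual_def)
    have "cmod (f z + g z) \<le> (Kf + Kg) * vnorm Z z" if "z \<in> points Z" for z
      using norm_triangle_ineq[of "f z" "g z"] Kf[OF that] Kg[rule_format, OF that]
      by (simp add: distrib_right)
    then have "\<exists>C. \<forall>z\<in>points Z. cmod (f z + g z) \<le> C * vnorm Z z" by blast
    then show "(\<lambda>z. f z + g z) \<in> dual Z"
      using f_lin dualD[OF g_dual] by (auto simp: dual_def distrib_left)
  qed
qed

lemma virtual_diagonal_amenable:
  assumes "virtual_diagonal M" shows "amenable TYPE('z) A mult"
  unfolding amenable_def by (intro conjI banach_alg allI impI virtual_diagonal_inner[OF assms])

end

section \<open>Virtual diagonals and bounded multiplicative bilinear maps\<close>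

text \<open>\<open>t\<close> stands for the map sending S and T to the extension of their tensor
  product. The transfer of diagonals takes place between three Banach algebras, without reference to
  the underlying spaces.\<close>

locale tensor_alg = A: banach_alg A mA + B: banach_alg B mB + C: banach_alg C mC
  for A :: "'a::complex_banach set" and mA and B :: "'b::complex_banach set" and mB
    and C :: "'c::complex_banach set" and mC +
  fixes t :: "'a \<Rightarrow> 'b \<Rightarrow> 'c" and K :: real
  assumes t_mem: "a \<in> A \<Longrightarrow> b \<in> B \<Longrightarrow> t a b \<in> C"
    and t_add: "a \<in> A \<Longrightarrow> a' \<in> A \<Longrightarrow> b \<in> B \<Longrightarrow> t (a + a') b = t a b + t a' b"
      "a \<in> A \<Longrightarrow> b \<in> B \<Longrightarrow> b' \<in> B \<Longrightarrow> t a (b + b') = t a b + t a b'"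
    and t_scale: "a \<in> A \<Longrightarrow> b \<in> B \<Longrightarrow> t (c *\<^sub>C a) b = c *\<^sub>C t a b"
      "a \<in> A \<Longrightarrow> b \<in> B \<Longrightarrow> t a (c *\<^sub>C b) = c *\<^sub>C t a b"
    and t_mult: "a \<in> A \<Longrightarrow> a' \<in> A \<Longrightarrow> b \<in> B \<Longrightarrow> b' \<in> B \<Longrightarrow>
      mC (t a b) (t a' b') = t (mA a a') (mB b b')"
    and K_nonneg: "0 \<le> K"
    and t_bound: "a \<in> A \<Longrightarrow> b \<in> B \<Longrightarrow> norm (t a b) \<le> K * norm a * norm b"
    and t_dense: "C \<subseteq> closure (complex_vector.span {t a b | a b. a \<in> A \<and> b \<in> B})"
begin

text \<open>The kernel of a bounded form is a closed subspace. Applied to the difference of the two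
  sides of a law that is linear in \<open>c\<close>, this reduces the law to
  \<open>c = t a b\<close>.\<close>

lemma linear_form_eq_0:
  assumes \<theta>: "\<theta> \<in> linear_forms C" and zero: "\<And>a b. a \<in> A \<Longrightarrow> b \<in> B \<Longrightarrow> \<theta> (t a b) = 0"
    and c: "c \<in> C"
  shows "\<theta> c = 0"
proof -
  have span: "x \<in> C \<and> \<theta> x = 0" if "x \<in> complex_vector.span {t a b | a b. a \<in> A \<and> b \<in> B}" for x
    using that
  proof (induction rule: complex_vector.span_induct_alt)
    case base
    have "\<theta> (0 *\<^sub>C 0) = 0 * \<theta> 0" by (rule linear_formsD(2)[OF \<theta>]) simp
    then show ?case by simp
  next
    case (step k x y)
    then show ?case by (auto simp: linear_formsD[OF \<theta>] t_mem zero)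
  qed
  obtain s where s: "\<And>n. s n \<in> complex_vector.span {t a b | a b. a \<in> A \<and> b \<in> B}" "s \<longlonglongrightarrow> c"
    using c t_dense closure_sequential by blast
  obtain k where k: "0 \<le> k" "wbounded C norm k \<theta>" by (rule linear_forms_bound[OF \<theta>])
  \<comment> \<open>\<open>\<theta>\<close> vanishes at \<open>s n\<close>, so its value at
    \<open>c\<close> is that at \<open>c - s n\<close>.\<close>
  have le: "cmod (\<theta> c) \<le> k * norm (c - s n)" for n
  proof -
    have sn: "s n \<in> C" "\<theta> (s n) = 0" using span[OF s(1)] by auto
    have "\<theta> (c - s n) = \<theta> c"
      using linear_formsD(1)[OF \<theta> c C.scale_mem[OF sn(1), of "-1"]]
        linear_formsD(2)[OF \<theta> sn(1), of "-1"] sn(2) by simp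
    moreover have "c - s n \<in> C"
      using C.add_mem[OF c C.scale_mem[OF sn(1), of "-1"]] by simp
    ultimately show ?thesis using wboundedD[OF k(2)] by fastforce
  qed
  have "(\<lambda>n. k * norm (c - s n)) \<longlonglongrightarrow> k * norm (c - c)"
    by (intro tendsto_intros s(2))
  then have "cmod (\<theta> c) \<le> 0"
    using le by (intro LIMSEQ_le_const) auto
  then show ?thesis by simp
qed

lemma bounded_map_t:
  assumes a: "a \<in> A" shows "bounded_map B C (t a)"
  using a t_bound K_nonneg
  by (auto simp: bounded_map_def t_mem t_add t_scale intro!: exI[of _ "K * norm a"])

lemma bounded_map_t':
  assumes b: "b \<in> B" shows "bounded_map A C (\<lambda>a. t a b)"
  using b t_bound K_nonneg
  by (auto simp: bounded_map_def t_mem t_add t_scale mult_ac intro!: exI[of _ "K * norm b"])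

text \<open>One factor \<open>K\<close> arises for each use of \<open>t_bound\<close>. The bound is
  proportional to \<open>norm a * norm a'\<close>, as needed for a functional of the slice to be a
  bounded bilinear form in \<open>(a, a')\<close>.\<close>

lemma slice_form:
  assumes F: "F \<in> bilinear_forms C" and a: "a \<in> A" "a' \<in> A"
  shows "(\<lambda>(b, b'). F (t a b, t a' b')) \<in> bilinear_forms B"
    and "0 \<le> k \<Longrightarrow> wbounded (C \<times> C) norm2 k F \<Longrightarrow>
      wbounded (B \<times> B) norm2 (k * (K * K) * (norm a * norm a')) (\<lambda>(b, b'). F (t a b, t a' b'))"
proof -
  show "(\<lambda>(b, b'). F (t a b, t a' b')) \<in> bilinear_forms B"
    by (rule bilinear_forms_compose[OF F bounded_map_t[OF a(1)] bounded_map_t[OF a(2)]])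
  assume k: "0 \<le> k" "wbounded (C \<times> C) norm2 k F"
  show "wbounded (B \<times> B) norm2 (k * (K * K) * (norm a * norm a')) (\<lambda>(b, b'). F (t a b, t a' b'))"
  proof (rule wboundedI, clarify)
    fix b b' assume b: "b \<in> B" "b' \<in> B"
    have "cmod (F (t a b, t a' b')) \<le> k * (norm (t a b) * norm (t a' b'))"
      using wboundedD[OF k(2), of "(t a b, t a' b')"] t_mem a b by simp
    also have "\<dots> \<le> k * ((K * norm a * norm b) * (K * norm a' * norm b'))"
      using t_bound a b k(1) K_nonneg by (intro mult_left_mono mult_mono) auto
    finally show "cmod (F (t a b, t a' b')) \<le> k * (K * K) * (norm a * norm a') * norm2 (b, b')"
      by (simp add: mult_ac)
  qed
qed

lemma inner_functional_form:
  assumes M: "B.L2.functional M" and F: "F \<in> bilinear_forms C"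
  shows "(\<lambda>(a, a'). M (\<lambda>(b, b'). F (t a b, t a' b'))) \<in> bilinear_forms A"
proof -
  obtain CM where CM: "0 \<le> CM" "\<forall>F\<in>bilinear_forms B. \<forall>k\<ge>0. wbounded (B \<times> B) norm2 k F \<longrightarrow>
      cmod (M F) \<le> CM * k" by (rule B.L2.functional_bound[OF M])
  obtain k where k: "0 \<le> k" "wbounded (C \<times> C) norm2 k F" by (rule bilinear_forms_bound[OF F])
  note form = slice_form(1)[OF F]
  note simps = t_mem t_add t_scale bilinear_formsD[OF F]
  have add1: "M (\<lambda>(b, b'). F (t (x + x') b, t y b')) =
      M (\<lambda>(b, b'). F (t x b, t y b')) + M (\<lambda>(b, b'). F (t x' b, t y b'))"
    if "x \<in> A" "x' \<in> A" "y \<in> A" for x x' y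
  proof -
    have "M (\<lambda>(b, b'). F (t (x + x') b, t y b')) =
        M (\<lambda>p. (case p of (b, b') \<Rightarrow> F (t x b, t y b')) + (case p of (b, b') \<Rightarrow> F (t x' b, t y b')))"
      using that by (intro B.L2.functional_cong[OF M form]) (auto simp: simps)
    then show ?thesis using that by (simp add: B.L2.functional_add[OF M form form])
  qed
  have add2: "M (\<lambda>(b, b'). F (t x b, t (y + y') b')) =
      M (\<lambda>(b, b'). F (t x b, t y b')) + M (\<lambda>(b, b'). F (t x b, t y' b'))"
    if "x \<in> A" "y \<in> A" "y' \<in> A" for x y y'
  proof -
    have "M (\<lambda>(b, b'). F (t x b, t (y + y') b')) =
        M (\<lambda>p. (case p of (b, b') \<Rightarrow> F (t x b, t y b')) + (case p of (b, b') \<Rightarrow> F (t x b, t y' b')))"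
      using that by (intro B.L2.functional_cong[OF M form]) (auto simp: simps)
    then show ?thesis using that by (simp add: B.L2.functional_add[OF M form form])
  qed
  have scale: "M (\<lambda>(b, b'). F (t (c *\<^sub>C x) b, t y b')) = c * M (\<lambda>(b, b'). F (t x b, t y b'))"
    "M (\<lambda>(b, b'). F (t x b, t (c *\<^sub>C y) b')) = c * M (\<lambda>(b, b'). F (t x b, t y b'))"
    if "x \<in> A" "y \<in> A" for x y c
  proof -
    have "M (\<lambda>(b, b'). F (t (c *\<^sub>C x) b, t y b')) = M (\<lambda>p. c * (case p of (b, b') \<Rightarrow> F (t x b, t y b')))"
      "M (\<lambda>(b, b'). F (t x b, t (c *\<^sub>C y) b')) = M (\<lambda>p. c * (case p of (b, b') \<Rightarrow> F (t x b, t y b')))"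
      using that by (auto intro!: B.L2.functional_cong[OF M form] simp: simps)
    then show "M (\<lambda>(b, b'). F (t (c *\<^sub>C x) b, t y b')) = c * M (\<lambda>(b, b'). F (t x b, t y b'))"
      "M (\<lambda>(b, b'). F (t x b, t (c *\<^sub>C y) b')) = c * M (\<lambda>(b, b'). F (t x b, t y b'))"
      using that by (simp_all add: B.L2.functional_scale[OF M form])
  qed
  have bound: "cmod (M (\<lambda>(b, b'). F (t x b, t y b'))) \<le> (CM * (k * (K * K))) * (norm x * norm y)"
    if "x \<in> A" "y \<in> A" for x y
    using CM(2) form[OF that] slice_form(2)[OF F that k] k(1) K_nonneg by (simp add: mult.assoc)
  show ?thesis
    by (rule bilinear_formsI[where K = "CM * (k * (K * K))"])
      (simp_all add: add1 add2 scale bound)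
qed

lemma virtual_diagonal_tensor:
  assumes MA: "A.virtual_diagonal MA" and MB: "B.virtual_diagonal MB"
  shows "C.virtual_diagonal (\<lambda>F. MA (\<lambda>(a, a'). MB (\<lambda>(b, b'). F (t a b, t a' b'))))"
    (is "C.virtual_diagonal ?M")
proof -
  have fA: "A.L2.functional MA" and fB: "B.L2.functional MB"
    using MA MB by (simp_all add: A.virtual_diagonal_def B.virtual_diagonal_def)
  have commA: "MA (\<lambda>(x, y). F (mA c x, y)) = MA (\<lambda>(x, y). F (x, mA y c))"
    if "F \<in> bilinear_forms A" "c \<in> A" for F c using MA that by (simp add: A.virtual_diagonal_def)
  have commB: "MB (\<lambda>(x, y). F (mB c x, y)) = MB (\<lambda>(x, y). F (x, mB y c))"
    if "F \<in> bilinear_forms B" "c \<in> B" for F c using MB that by (simp add: B.virtual_diagonal_def)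
  have unitA: "MA (\<lambda>(x, y). \<phi> (mA (mA x y) c)) = \<phi> c" if "\<phi> \<in> linear_forms A" "c \<in> A" for \<phi> c
    using MA that by (simp add: A.virtual_diagonal_def)
  have unitB: "MB (\<lambda>(x, y). \<phi> (mB (mB x y) c)) = \<phi> c" if "\<phi> \<in> linear_forms B" "c \<in> B" for \<phi> c
    using MB that by (simp add: B.virtual_diagonal_def)
  note form = inner_functional_form[OF fB]
  note slice = slice_form(1)
  note congA = A.L2.functional_cong[OF fA]
  note congB = B.L2.functional_cong[OF fB]
  have fC: "C.L2.functional ?M"
  proof -
    obtain CA where CA: "0 \<le> CA" "\<forall>F\<in>bilinear_forms A. \<forall>k\<ge>0. wbounded (A \<times> A) norm2 k F \<longrightarrow>
        cmod (MA F) \<le> CA * k" by (rule A.L2.functional_bound[OF fA])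
    obtain CB where CB: "0 \<le> CB" "\<forall>F\<in>bilinear_forms B. \<forall>k\<ge>0. wbounded (B \<times> B) norm2 k F \<longrightarrow>
        cmod (MB F) \<le> CB * k" by (rule B.L2.functional_bound[OF fB])
    show ?thesis
    proof (rule C.L2.functionalI)
      fix F G assume F: "F \<in> bilinear_forms C" and G: "G \<in> bilinear_forms C"
      have "?M (\<lambda>p. F p + G p) = MA (\<lambda>p. (case p of (a, a') \<Rightarrow> MB (\<lambda>(b, b'). F (t a b, t a' b'))) +
          (case p of (a, a') \<Rightarrow> MB (\<lambda>(b, b'). G (t a b, t a' b'))))"
      proof (rule congA[OF form[OF C.L2.add_form[OF F G]]], clarify)
        fix a a' assume "a \<in> A" "a' \<in> A"
        then show "MB (\<lambda>(b, b'). F (t a b, t a' b') + G (t a b, t a' b')) =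
            MB (\<lambda>(b, b'). F (t a b, t a' b')) + MB (\<lambda>(b, b'). G (t a b, t a' b'))"
          using B.L2.functional_add[OF fB slice[OF F] slice[OF G]] by (simp add: case_prod_unfold)
      qed
      then show "?M (\<lambda>p. F p + G p) = ?M F + ?M G"
        by (simp add: A.L2.functional_add[OF fA form[OF F] form[OF G]])
    next
      fix F c assume F: "F \<in> bilinear_forms C"
      have "?M (\<lambda>p. c * F p) = MA (\<lambda>p. c * (case p of (a, a') \<Rightarrow> MB (\<lambda>(b, b'). F (t a b, t a' b'))))"
      proof (rule congA[OF form[OF C.L2.scale_form[OF F]]], clarify)
        fix a a' assume "a \<in> A" "a' \<in> A"
        then show "MB (\<lambda>(b, b'). c * F (t a b, t a' b')) = c * MB (\<lambda>(b, b'). F (t a b, t a' b'))"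
          using B.L2.functional_scale[OF fB slice[OF F]] by (simp add: case_prod_unfold)
      qed
      then show "?M (\<lambda>p. c * F p) = c * ?M F"
        by (simp add: A.L2.functional_scale[OF fA form[OF F]])
    next
      fix F k assume F: "F \<in> bilinear_forms C" and k: "(0::real) \<le> k" "wbounded (C \<times> C) norm2 k F"
      have "wbounded (A \<times> A) norm2 (CB * (k * (K * K))) (\<lambda>(a, a'). MB (\<lambda>(b, b'). F (t a b, t a' b')))"
      proof (rule wboundedI, clarify)
        fix a a' assume a: "a \<in> A" "a' \<in> A"
        have "cmod (MB (\<lambda>(b, b'). F (t a b, t a' b'))) \<le> CB * (k * (K * K) * (norm a * norm a'))"
          using CB(2) slice[OF F a] slice_form(2)[OF F a k] k(1) K_nonneg by simp
        then show "cmod (MB (\<lambda>(b, b'). F (t a b, t a' b'))) \<le> CB * (k * (K * K)) * norm2 (a, a')"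
          by (simp add: mult.assoc)
      qed
      then have "cmod (?M F) \<le> CA * (CB * (k * (K * K)))"
        using CA(2) form[OF F] CB(1) k(1) K_nonneg by simp
      then show "cmod (?M F) \<le> (CA * CB * (K * K)) * k" by (simp add: mult_ac)
    qed (use CA CB K_nonneg in simp)
  qed
  have comm_t: "?M (\<lambda>(x, y). F (mC (t a\<^sub>0 b\<^sub>0) x, y)) = ?M (\<lambda>(x, y). F (x, mC y (t a\<^sub>0 b\<^sub>0)))"
    if F: "F \<in> bilinear_forms C" and a\<^sub>0: "a\<^sub>0 \<in> A" and b\<^sub>0: "b\<^sub>0 \<in> B" for F a\<^sub>0 b\<^sub>0
  proof -
    note c = t_mem[OF a\<^sub>0 b\<^sub>0]
    \<comment> \<open>The inner diagonal moves \<open>b\<^sub>0\<close> while \<open>a\<close> and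
      \<open>a'\<close> are fixed, then the outer one moves \<open>a\<^sub>0\<close>.
      \<open>H\<close> is the stage in between, with \<open>b\<^sub>0\<close> already on the
      right.\<close>
    define H where "H = (\<lambda>(a, a'). MB (\<lambda>(b, b'). F (t a b, t a' (mB b' b\<^sub>0))))"
    have H: "H \<in> bilinear_forms A"
      using inner_functional_form[OF B.functional_mult_right[OF fB b\<^sub>0] F] by (simp add: H_def)
    have step: "MB (\<lambda>(b, b'). F (mC (t a\<^sub>0 b\<^sub>0) (t a b), t a' b')) = H (mA a\<^sub>0 a, a')"
      if a: "a \<in> A" "a' \<in> A" for a a'
    proof -
      have "MB (\<lambda>(b, b'). case (t a b, t a' b') of (x, y) \<Rightarrow> F (mC (t a\<^sub>0 b\<^sub>0) x, y)) =
          MB (\<lambda>(b, b'). F (t (mA a\<^sub>0 a) (mB b\<^sub>0 b), t a' b'))"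
        using a a\<^sub>0 b\<^sub>0 slice[OF C.bilinear_forms_mult(1)[OF F c] a]
        by (intro congB) (auto simp: t_mult)
      then show ?thesis
        using commB[OF slice[OF F, of "mA a\<^sub>0 a" a'] b\<^sub>0] a a\<^sub>0 by (simp add: H_def)
    qed
    have step': "H (a, mA a' a\<^sub>0) = MB (\<lambda>(b, b'). F (t a b, mC (t a' b') (t a\<^sub>0 b\<^sub>0)))"
      if a: "a \<in> A" "a' \<in> A" for a a'
      unfolding H_def prod.case
      using a a\<^sub>0 b\<^sub>0 B.bilinear_forms_mult(2)[OF slice[OF F, of a "mA a' a\<^sub>0"] b\<^sub>0]
      by (intro congB) (auto simp: t_mult)
    have "?M (\<lambda>(x, y). F (mC (t a\<^sub>0 b\<^sub>0) x, y)) = MA (\<lambda>(a, a'). H (mA a\<^sub>0 a, a'))"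
      by (rule congA[OF form[OF C.bilinear_forms_mult(1)[OF F c]]]) (auto simp: step)
    also have "\<dots> = MA (\<lambda>(a, a'). H (a, mA a' a\<^sub>0))" by (rule commA[OF H a\<^sub>0])
    also have "\<dots> = ?M (\<lambda>(x, y). F (x, mC y (t a\<^sub>0 b\<^sub>0)))"
      by (rule congA[OF A.bilinear_forms_mult(2)[OF H a\<^sub>0]]) (auto simp: step')
    finally show ?thesis .
  qed
  have comm: "?M (\<lambda>(x, y). F (mC c x, y)) = ?M (\<lambda>(x, y). F (x, mC y c))"
    if F: "F \<in> bilinear_forms C" and c: "c \<in> C" for F c
    using linear_form_eq_0[OF C.L1.diff_form[OF C.functional_mult_form(1,2)[OF fC F]] _ c]
      comm_t[OF F] by simp
  have unit_t: "?M (\<lambda>(x, y). \<phi> (mC x (mC y (t a\<^sub>0 b\<^sub>0)))) = \<phi> (t a\<^sub>0 b\<^sub>0)"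
    if \<phi>: "\<phi> \<in> linear_forms C" and a\<^sub>0: "a\<^sub>0 \<in> A" and b\<^sub>0: "b\<^sub>0 \<in> B" for \<phi> a\<^sub>0 b\<^sub>0
  proof -
    note c = t_mem[OF a\<^sub>0 b\<^sub>0]
    have F: "(\<lambda>(x, y). \<phi> (mC x (mC y (t a\<^sub>0 b\<^sub>0)))) \<in> bilinear_forms C"
      using C.bilinear_forms_mult(2)[OF C.mult_bilinear_form[OF \<phi>] c] by simp
    \<comment> \<open>The inner unit law consumes \<open>b\<close> and \<open>b'\<close> and leaves
      a linear form in the product of the A-variables, to which the outer unit law applies.\<close>
    have step: "MB (\<lambda>(b, b'). \<phi> (mC (t a b) (mC (t a' b') (t a\<^sub>0 b\<^sub>0)))) = \<phi> (t (mA (mA a a') a\<^sub>0) b\<^sub>0)"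
      if a: "a \<in> A" "a' \<in> A" for a a'
    proof -
      have "MB (\<lambda>(b, b'). case (t a b, t a' b') of (x, y) \<Rightarrow> \<phi> (mC x (mC y (t a\<^sub>0 b\<^sub>0)))) =
          MB (\<lambda>(b, b'). \<phi> (t (mA (mA a a') a\<^sub>0) (mB (mB b b') b\<^sub>0)))"
        using a a\<^sub>0 b\<^sub>0 slice[OF F a]
        by (intro congB) (auto simp: t_mult A.mult_simps B.mult_simps)
      then show ?thesis
        using unitB[OF linear_forms_compose[OF \<phi> bounded_map_t] b\<^sub>0, of "mA (mA a a') a\<^sub>0"] a a\<^sub>0 by simp
    qed
    have "?M (\<lambda>(x, y). \<phi> (mC x (mC y (t a\<^sub>0 b\<^sub>0)))) = MA (\<lambda>(a, a'). \<phi> (t (mA (mA a a') a\<^sub>0) b\<^sub>0))"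
      by (rule congA[OF form[OF F]]) (auto simp: step)
    also have "\<dots> = \<phi> (t a\<^sub>0 b\<^sub>0)"
      by (rule unitA[OF linear_forms_compose[OF \<phi> bounded_map_t'[OF b\<^sub>0]] a\<^sub>0])
    finally show ?thesis .
  qed
  have unit: "?M (\<lambda>(x, y). \<phi> (mC (mC x y) c)) = \<phi> c" if \<phi>: "\<phi> \<in> linear_forms C" and c: "c \<in> C" for \<phi> c
  proof -
    \<comment> \<open>Bracketed as x (y c), the form is a right shift of the product form, hence its
      value is linear in \<open>c\<close> and density applies. Associativity then restores the
      bracketing of the unit law.\<close>
    have "(\<lambda>c. ?M (\<lambda>(x, y). \<phi> (mC x (mC y c)))) \<in> linear_forms C"
      using C.functional_mult_form(2)[OF fC C.mult_bilinear_form[OF \<phi>]] by simp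
    from linear_form_eq_0[OF C.L1.diff_form[OF this \<phi>] _ c]
    have "?M (\<lambda>(x, y). \<phi> (mC x (mC y c))) = \<phi> c" using unit_t[OF \<phi>] by simp
    moreover have "?M (\<lambda>(x, y). \<phi> (mC (mC x y) c)) = ?M (\<lambda>(x, y). \<phi> (mC x (mC y c)))"
      using c C.mult_bilinear_form[OF C.linear_forms_mult(1)[OF \<phi> c]]
      by (intro C.L2.functional_cong[OF fC]) (auto simp: C.mult_simps)
    ultimately show ?thesis by simp
  qed
  show ?thesis
    unfolding C.virtual_diagonal_def using fC comm unit by blast
qed

end

section \<open>Tensor products of approximable operators\<close>

lemma elem_tensor_simps:
  "elem_tensor (x + x') y = (\<lambda>B. elem_tensor x y B + elem_tensor x' y B)"
  "elem_tensor x (y + y') = (\<lambda>B. elem_tensor x y B + elem_tensor x y' B)"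
  "elem_tensor (c *\<^sub>C x) y = (\<lambda>B. c * elem_tensor x y B)"
  "elem_tensor x (c *\<^sub>C y) = (\<lambda>B. c * elem_tensor x y B)"
  by (auto simp: fun_eq_iff elem_tensor_def cbilinear_form_def)

lemma tensor_product_zero: "(\<lambda>B. 0) \<in> tensor_product"
  by (auto simp: tensor_product_def intro!: exI[of _ "0::nat"])

lemma tensor_product_step:
  assumes "u \<in> tensor_product"
  shows "(\<lambda>B. u B + elem_tensor x y B) \<in> tensor_product"
proof -
  obtain n :: nat and xs ys where u: "u = (\<lambda>B. \<Sum>i<n. elem_tensor (xs i) (ys i) B)"
    using assms by (auto simp: tensor_product_def)
  have "(\<lambda>B. u B + elem_tensor x y B) =
      (\<lambda>B. \<Sum>i<Suc n. elem_tensor ((xs(n := x)) i) ((ys(n := y)) i) B)"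
    by (simp add: u)
  then show ?thesis unfolding tensor_product_def by blast
qed

text \<open>Runs through the partial sums of a representation; scalars require no case of their own,
  as they are absorbed into a factor.\<close>

lemma tensor_product_induct [consumes 1, case_names zero step]:
  assumes "u \<in> tensor_product" and "P (\<lambda>B. 0)"
    and "\<And>u x y. u \<in> tensor_product \<Longrightarrow> P u \<Longrightarrow> P (\<lambda>B. u B + elem_tensor x y B)"
  shows "P u"
proof -
  obtain n :: nat and xs ys where u: "u = (\<lambda>B. \<Sum>i<n. elem_tensor (xs i) (ys i) B)"
    using assms(1) by (auto simp: tensor_product_def)
  have "(\<lambda>B. \<Sum>i<k. elem_tensor (xs i) (ys i) B) \<in> tensor_product" for k :: nat
    unfolding tensor_product_def by blast
  then have "P (\<lambda>B. \<Sum>i<k. elem_tensor (xs i) (ys i) B)" for k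
    by (induction k) (simp_all add: assms(2,3))
  then show ?thesis by (simp add: u)
qed

lemma tensor_product_add:
  assumes "u \<in> tensor_product" "v \<in> tensor_product"
  shows "(\<lambda>B. u B + v B) \<in> tensor_product"
  using assms(2)
proof (induction rule: tensor_product_induct)
  case (step v x y)
  then show ?case using tensor_product_step[of "\<lambda>B. u B + v B" x y] by (simp add: add.assoc)
qed (simp add: assms(1))

lemma tensor_product_scale:
  assumes "u \<in> tensor_product"
  shows "(\<lambda>B. c * u B) \<in> tensor_product"
  using assms
proof (induction rule: tensor_product_induct)
  case (step u x y)
  then show ?case
    using tensor_product_step[of "\<lambda>B. c * u B" "c *\<^sub>C x" y]
    by (simp add: elem_tensor_simps distrib_left)
qed (simp add: tensor_product_zero)

lemma cbilinear_form_compose: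
  assumes "clinear_op S" "clinear_op T" "cbilinear_form B"
  shows "cbilinear_form (\<lambda>x y. B (blinfun_apply S x) (blinfun_apply T y))"
  using assms by (simp add: cbilinear_form_def clinear_op_def blinfun.add_right)

lemma tensor_op_linear:
  "tensor_op S T (\<lambda>B. u B + v B) = (\<lambda>B. tensor_op S T u B + tensor_op S T v B)"
  "tensor_op S T (\<lambda>B. c * u B) = (\<lambda>B. c * tensor_op S T u B)"
  "tensor_op S T (\<lambda>B. 0) = (\<lambda>B. 0)"
  by (auto simp: tensor_op_def)

lemma tensor_op_mem:
  assumes "clinear_op S" "clinear_op T" "u \<in> tensor_product"
  shows "tensor_op S T u \<in> tensor_product"
  using assms(3)
  by (induction rule: tensor_product_induct)
    (simp_all add: tensor_op_linear tensor_op_elem_tensor assms(1,2) tensor_product_zero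
      tensor_product_step)

lemma clinear_op_simps:
  "clinear_op S \<Longrightarrow> clinear_op S' \<Longrightarrow> clinear_op (S + S')"
  "clinear_op S \<Longrightarrow> clinear_op (c *\<^sub>C S)"
  by (simp_all add: clinear_op_def blinfun.add_left scaleC_add_right scaleC_blinfun.rep_eq
      scaleC_scaleC mult.commute)

lemma tensor_op_add_operator:
  assumes u: "u \<in> tensor_product"
  shows "clinear_op S \<Longrightarrow> clinear_op S' \<Longrightarrow> clinear_op T \<Longrightarrow>
      tensor_op (S + S') T u = (\<lambda>B. tensor_op S T u B + tensor_op S' T u B)"
    and "clinear_op S \<Longrightarrow> clinear_op T \<Longrightarrow> clinear_op T' \<Longrightarrow>
      tensor_op S (T + T') u = (\<lambda>B. tensor_op S T u B + tensor_op S T' u B)"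
  using u
  by (induction rule: tensor_product_induct)
    (simp_all add: tensor_op_linear tensor_op_elem_tensor clinear_op_simps blinfun.add_left
      elem_tensor_simps add_ac)

lemma tensor_op_scale_operator:
  assumes u: "u \<in> tensor_product" and "clinear_op S" "clinear_op T"
  shows "tensor_op (c *\<^sub>C S) T u = (\<lambda>B. c * tensor_op S T u B)"
    and "tensor_op S (c *\<^sub>C T) u = (\<lambda>B. c * tensor_op S T u B)"
  using u
  by (induction rule: tensor_product_induct)
    (simp_all add: tensor_op_linear tensor_op_elem_tensor clinear_op_simps assms(2,3)
      scaleC_blinfun.rep_eq elem_tensor_simps distrib_left)

text \<open>The inner operator returns 0 at functions that are not bilinear, so \<open>B\<close>
  composed with \<open>S\<close> and \<open>T\<close> has to be bilinear; this is where linearity of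
  the outer pair enters.\<close>

lemma tensor_op_compose:
  assumes "clinear_op S" "clinear_op T"
  shows "tensor_op S T (tensor_op S' T' u) = tensor_op (S o\<^sub>L S') (T o\<^sub>L T') u"
  using cbilinear_form_compose[OF assms] by (auto simp: tensor_op_def)

text \<open>Evaluation at a vector is continuous, so complex linearity of finite rank operators
  survives norm limits.\<close>

lemma approximable_clinear_op:
  assumes "T \<in> approximable" shows "clinear_op T"
proof -
  obtain t where t: "\<And>n. clinear_op (t n)" "t \<longlonglongrightarrow> T"
    using assms by (auto simp: approximable_def closure_sequential finite_rank_def)
  have ev: "(\<lambda>n. t n y) \<longlonglongrightarrow> T y" for y
    using t(2) by (intro blinfun.tendsto) auto
  have "(\<lambda>n. t n (c *\<^sub>C x)) \<longlonglongrightarrow> c *\<^sub>C T x" for c x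
    using bounded_linear.tendsto[OF bounded_linear_scaleC ev[of x], of c] t(1)
    by (simp add: clinear_op_def)
  then show ?thesis
    using LIMSEQ_unique[OF ev] by (auto simp: clinear_op_def)
qed

text \<open>A bounded linear map on a dense subspace is uniformly continuous and so extends to the
  closure; linearity and the bound, with the same \<open>C\<close>, pass to limits of
  sequences.\<close>

lemma extend_dense_blinfun:
  fixes g :: "'v::real_normed_vector \<Rightarrow> 'w::banach"
  assumes V: "subspace V" "closure V = UNIV"
    and add: "\<And>x y. x \<in> V \<Longrightarrow> y \<in> V \<Longrightarrow> g (x + y) = g x + g y"
    and scale: "\<And>r x. x \<in> V \<Longrightarrow> g (r *\<^sub>R x) = r *\<^sub>R g x"
    and bound: "\<And>x. x \<in> V \<Longrightarrow> norm (g x) \<le> C * norm x"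
  obtains R where "\<forall>x\<in>V. blinfun_apply R x = g x" "\<forall>x. norm (blinfun_apply R x) \<le> C * norm x"
proof -
  have diff: "g (x - y) = g x - g y" if "x \<in> V" "y \<in> V" for x y
    using add[OF that(1) subspace_scale[OF V(1) that(2), of "-1"]] scale[OF that(2), of "-1"] by simp
  have "uniformly_continuous_on V g"
    unfolding uniformly_continuous_on_def
  proof (intro allI impI)
    fix e :: real assume e: "e > 0"
    \<comment> \<open>\<open>\<bar>C\<bar> + 1\<close> is positive whatever the sign of
      \<open>C\<close>.\<close>
    have "dist (g x') (g x) < e" if xy: "x \<in> V" "x' \<in> V" and d: "dist x' x < e / (\<bar>C\<bar> + 1)" for x x'
    proof -
      have "dist (g x') (g x) \<le> C * norm (x' - x)"
        using bound[OF subspace_diff[OF V(1) xy(2,1)]] diff[OF xy(2,1)] by (simp add: dist_norm)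
      also have "\<dots> \<le> (\<bar>C\<bar> + 1) * norm (x' - x)" by (intro mult_right_mono) auto
      also have "\<dots> < e" using d by (simp add: dist_norm pos_less_divide_eq mult.commute)
      finally show ?thesis .
    qed
    then show "\<exists>d>0. \<forall>x\<in>V. \<forall>x'\<in>V. dist x' x < d \<longrightarrow> dist (g x') (g x) < e"
      using e by (intro exI[of _ "e / (\<bar>C\<bar> + 1)"]) auto
  qed
  then obtain h where h: "uniformly_continuous_on (closure V) h" "\<And>x. x \<in> V \<Longrightarrow> g x = h x"
    by (rule uniformly_continuous_on_extension_on_closure) blast
  have cont: "isCont h x" for x
    using uniformly_continuous_imp_continuous[OF h(1)] V(2)
    by (simp add: continuous_on_eq_continuous_at)
  have app: "\<exists>s. (\<forall>n. s n \<in> V) \<and> s \<longlonglongrightarrow> x" for x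
    using V(2) closure_sequential[of x V] by blast
  have lim: "(\<lambda>n. g (s n)) \<longlonglongrightarrow> h x" if "\<forall>n. s n \<in> V" "s \<longlonglongrightarrow> x" for s x
    using isCont_tendsto_compose[OF cont that(2)] that(1) h(2) by simp
  have h_add: "h (x + y) = h x + h y" for x y
  proof -
    obtain s where s: "\<forall>n. s n \<in> V" "s \<longlonglongrightarrow> x" using app by blast
    obtain t where t: "\<forall>n. t n \<in> V" "t \<longlonglongrightarrow> y" using app by blast
    have "(\<lambda>n. g (s n + t n)) \<longlonglongrightarrow> h (x + y)"
      using s t by (intro lim) (auto intro: subspace_add[OF V(1)] tendsto_add)
    moreover have "(\<lambda>n. g (s n + t n)) \<longlonglongrightarrow> h x + h y"
      using tendsto_add[OF lim[OF s] lim[OF t]] s(1) t(1) by (simp add: add)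
    ultimately show ?thesis by (rule LIMSEQ_unique)
  qed
  have h_scale: "h (r *\<^sub>R x) = r *\<^sub>R h x" for r x
  proof -
    obtain s where s: "\<forall>n. s n \<in> V" "s \<longlonglongrightarrow> x" using app by blast
    have "(\<lambda>n. g (r *\<^sub>R s n)) \<longlonglongrightarrow> h (r *\<^sub>R x)"
      using s by (intro lim) (auto intro: subspace_scale[OF V(1)] tendsto_intros)
    moreover have "(\<lambda>n. g (r *\<^sub>R s n)) \<longlonglongrightarrow> r *\<^sub>R h x"
      using tendsto_scaleR[OF tendsto_const lim[OF s], of r] s(1) by (simp add: scale)
    ultimately show ?thesis by (rule LIMSEQ_unique)
  qed
  have h_bound: "norm (h x) \<le> C * norm x" for x
  proof -
    obtain s where s: "\<forall>n. s n \<in> V" "s \<longlonglongrightarrow> x" using app by blast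
    show ?thesis
    proof (rule LIMSEQ_le)
      show "(\<lambda>n. norm (g (s n))) \<longlonglongrightarrow> norm (h x)" by (rule tendsto_norm[OF lim[OF s]])
      show "(\<lambda>n. C * norm (s n)) \<longlonglongrightarrow> C * norm x" by (intro tendsto_intros s(2))
      show "\<exists>N. \<forall>n\<ge>N. norm (g (s n)) \<le> C * norm (s n)" using bound s(1) by blast
    qed
  qed
  have "bounded_linear h"
    by (rule bounded_linear_intro[where K = C]) (simp_all add: h_add h_scale h_bound mult.commute)
  then have "blinfun_apply (Blinfun h) = h" by (rule bounded_linear_Blinfun_apply)
  then show thesis using that[of "Blinfun h"] h(2) h_bound by simp
qed

section \<open>Extension of tensor products of operators to the completion\<close>

locale tight =
  fixes \<alpha> :: "('x::complex_banach, 'y::complex_banach) tensor \<Rightarrow> real"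
    and \<iota> :: "('x, 'y) tensor \<Rightarrow> 'w::complex_banach" and K :: real
  assumes crossnorm: "crossnorm \<alpha>" and completion: "is_completion \<alpha> \<iota>"
    and K_pos: "K > 0"
    and bound: "\<And>S T u. S \<in> approximable \<Longrightarrow> T \<in> approximable \<Longrightarrow> u \<in> tensor_product \<Longrightarrow>
      \<alpha> (tensor_op S T u) \<le> K * norm S * norm T * \<alpha> u"
    and dense: "closure (complex_vector.span
      {R. \<exists>S\<in>approximable. \<exists>T\<in>approximable. extends_tensor_op \<iota> S T R}) = approximable"
begin

lemma iota_simps:
  "u \<in> tensor_product \<Longrightarrow> v \<in> tensor_product \<Longrightarrow> \<iota> (\<lambda>B. u B + v B) = \<iota> u + \<iota> v"
  "u \<in> tensor_product \<Longrightarrow> \<iota> (\<lambda>B. c * u B) = c *\<^sub>C \<iota> u"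
  "u \<in> tensor_product \<Longrightarrow> norm (\<iota> u) = \<alpha> u"
  using completion by (simp_all add: is_completion_def)

text \<open>\<open>\<iota>\<close> is isometric and \<open>\<alpha>\<close> is definite. Injectivity
  makes the tensor product of two operators well defined on the image of
  \<open>\<iota>\<close>.\<close>

lemma inj_iota: "inj_on \<iota> tensor_product"
proof (rule inj_onI)
  fix u v assume uv: "u \<in> tensor_product" "v \<in> tensor_product" "\<iota> u = \<iota> v"
  let ?d = "\<lambda>B. u B + (-1) * v B"
  have d: "?d \<in> tensor_product" using uv tensor_product_add tensor_product_scale by blast
  have "\<iota> ?d = 0"
    using iota_simps(1)[OF uv(1) tensor_product_scale[OF uv(2)], of "-1"]
      iota_simps(2)[OF uv(2), of "-1"] uv(3) by simp
  then have "\<alpha> ?d = 0" using iota_simps(3)[OF d] by simp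
  then have "?d = (\<lambda>B. 0)" using crossnorm d unfolding crossnorm_def by blast
  then show "u = v" by (auto simp: fun_eq_iff)
qed

lemma dense_iota: "closure (\<iota> ` tensor_product) = UNIV"
  using completion by (simp add: is_completion_def)

text \<open>Condition (i) of tightness is the bound that lets the operator extend from the dense
  image of \<open>\<iota>\<close>, with the same constant.\<close>

lemma ex_extension:
  assumes S: "S \<in> approximable" and T: "T \<in> approximable"
  shows "\<exists>R. extends_tensor_op \<iota> S T R \<and> norm R \<le> K * norm S * norm T"
proof -
  note lin = approximable_clinear_op[OF S] approximable_clinear_op[OF T]
  define g where "g w = \<iota> (tensor_op S T (inv_into tensor_product \<iota> w))" for w
  have g: "g (\<iota> u) = \<iota> (tensor_op S T u)" if "u \<in> tensor_product" for u
    using inv_into_f_f[OF inj_iota that] by (simp add: g_def)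
  note mem = tensor_op_mem[OF lin]
  have scaleR: "r *\<^sub>R \<iota> u = \<iota> (\<lambda>B. complex_of_real r * u B)" if "u \<in> tensor_product" for r u
    using that by (simp add: iota_simps scaleR_scaleC)
  have sub: "subspace (\<iota> ` tensor_product)"
  proof (rule subspaceI)
    have "\<iota> (\<lambda>B. 0) = 0" using iota_simps(2)[OF tensor_product_zero, of 0] by simp
    then show "0 \<in> \<iota> ` tensor_product" using tensor_product_zero by force
  next
    fix x y assume "x \<in> \<iota> ` tensor_product" "y \<in> \<iota> ` tensor_product"
    then show "x + y \<in> \<iota> ` tensor_product"
      by (auto simp: iota_simps(1)[symmetric] intro: tensor_product_add)
  next
    fix r x assume "x \<in> \<iota> ` tensor_product"
    then show "r *\<^sub>R x \<in> \<iota> ` tensor_product"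
      by (auto simp: scaleR intro: tensor_product_scale)
  qed
  obtain R where R: "\<forall>x\<in>\<iota> ` tensor_product. blinfun_apply R x = g x"
    "\<forall>x. norm (blinfun_apply R x) \<le> (K * norm S * norm T) * norm x"
  proof (rule extend_dense_blinfun[OF sub dense_iota])
    fix x y assume "x \<in> \<iota> ` tensor_product" "y \<in> \<iota> ` tensor_product"
    then obtain u v where uv: "u \<in> tensor_product" "v \<in> tensor_product" and [simp]: "x = \<iota> u" "y = \<iota> v"
      by blast
    show "g (x + y) = g x + g y"
      using g[OF tensor_product_add[OF uv]] uv by (simp add: g iota_simps tensor_op_linear mem)
  next
    fix r x assume "x \<in> \<iota> ` tensor_product"
    then obtain u where u: "u \<in> tensor_product" and [simp]: "x = \<iota> u" by blast
    show "g (r *\<^sub>R x) = r *\<^sub>R g x"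
      using g[OF tensor_product_scale[OF u]] u by (simp add: g scaleR tensor_op_linear mem)
  next
    fix x assume "x \<in> \<iota> ` tensor_product"
    then obtain u where u: "u \<in> tensor_product" and [simp]: "x = \<iota> u" by blast
    show "norm (g x) \<le> (K * norm S * norm T) * norm x"
      using bound[OF S T u] by (simp add: g u iota_simps mem)
  qed
  have "norm R \<le> K * norm S * norm T"
    using R(2) K_pos by (intro norm_blinfun_bound) auto
  moreover have "extends_tensor_op \<iota> S T R"
    using R(1) g by (simp add: extends_tensor_op_def)
  ultimately show ?thesis by blast
qed

text \<open>Bounded operators that agree on a dense set coincide. Laws for extensions thereby reduce
  to identities of tensors before completion.\<close>

lemma extension_unique:
  assumes "extends_tensor_op \<iota> S T R" "extends_tensor_op \<iota> S T R'"
  shows "R = R'"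
proof (rule blinfun_eqI)
  fix w
  obtain s where s: "\<And>n. s n \<in> \<iota> ` tensor_product" "s \<longlonglongrightarrow> w"
    using dense_iota closure_sequential[of w "\<iota> ` tensor_product"] by blast
  have "R (s n) = R' (s n)" for n
    using assms s(1)[of n] by (auto simp: extends_tensor_op_def)
  moreover have "(\<lambda>n. R (s n)) \<longlonglongrightarrow> R w" "(\<lambda>n. R' (s n)) \<longlonglongrightarrow> R' w"
    by (intro tendsto_intros s(2))+
  ultimately show "R w = R' w" using LIMSEQ_unique by auto
qed

definition extension :: "('x \<Rightarrow>\<^sub>L 'x) \<Rightarrow> ('y \<Rightarrow>\<^sub>L 'y) \<Rightarrow> ('w \<Rightarrow>\<^sub>L 'w)" where
  "extension S T = (SOME R. extends_tensor_op \<iota> S T R \<and> norm R \<le> K * norm S * norm T)"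

lemma extension:
  assumes "S \<in> approximable" "T \<in> approximable"
  shows "extends_tensor_op \<iota> S T (extension S T)" "norm (extension S T) \<le> K * norm S * norm T"
  using someI_ex[OF ex_extension[OF assms]] by (simp_all add: extension_def)

lemma extension_eqI:
  assumes "S \<in> approximable" "T \<in> approximable" "extends_tensor_op \<iota> S T R"
  shows "extension S T = R"
  using extension_unique extension(1) assms by blast

sublocale X: banach_alg "approximable :: ('x \<Rightarrow>\<^sub>L 'x) set" "(o\<^sub>L)"
  by standard (rule banach_algebra_approximable)

sublocale Y: banach_alg "approximable :: ('y \<Rightarrow>\<^sub>L 'y) set" "(o\<^sub>L)"
  by standard (rule banach_algebra_approximable)

sublocale W: banach_alg "approximable :: ('w \<Rightarrow>\<^sub>L 'w) set" "(o\<^sub>L)"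
  by standard (rule banach_algebra_approximable)

sublocale tensor_alg "approximable :: ('x \<Rightarrow>\<^sub>L 'x) set" "(o\<^sub>L)"
  "approximable :: ('y \<Rightarrow>\<^sub>L 'y) set" "(o\<^sub>L)" "approximable :: ('w \<Rightarrow>\<^sub>L 'w) set" "(o\<^sub>L)" extension K
proof
  note ext = extension(1)[unfolded extends_tensor_op_def, rule_format]
  note lin = approximable_clinear_op
  fix S S' :: "'x \<Rightarrow>\<^sub>L 'x" and T T' :: "'y \<Rightarrow>\<^sub>L 'y" and c
  assume S: "S \<in> approximable" and T: "T \<in> approximable"
  \<comment> \<open>Approximability of the extension is read off from condition (ii): the span lies
    in its closure.\<close>
  have "extension S T \<in> complex_vector.span
      {R. \<exists>S\<in>approximable. \<exists>T\<in>approximable. extends_tensor_op \<iota> S T R}"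
    using extension(1)[OF S T] S T by (intro complex_vector.span_base) blast
  from subsetD[OF closure_subset this] show "extension S T \<in> approximable"
    unfolding dense .
  show "norm (extension S T) \<le> K * norm S * norm T" by (rule extension(2)[OF S T])
  show "extension (c *\<^sub>C S) T = c *\<^sub>C extension S T"
    using S T by (intro extension_eqI)
      (simp_all add: extends_tensor_op_def ext scaleC_blinfun.rep_eq tensor_op_add_operator tensor_op_scale_operator lin
        iota_simps tensor_op_mem)
  show "extension S (c *\<^sub>C T) = c *\<^sub>C extension S T"
    using S T by (intro extension_eqI)
      (simp_all add: extends_tensor_op_def ext scaleC_blinfun.rep_eq tensor_op_add_operator tensor_op_scale_operator lin
        iota_simps tensor_op_mem)
  show "extension S (T + T') = extension S T + extension S T'" if "T' \<in> approximable"
    using S T that by (intro extension_eqI)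
      (simp_all add: extends_tensor_op_def ext blinfun.add_left tensor_op_add_operator tensor_op_scale_operator lin
        iota_simps tensor_op_mem)
  show "extension (S + S') T = extension S T + extension S' T" if "S' \<in> approximable"
    using S T that by (intro extension_eqI)
      (simp_all add: extends_tensor_op_def ext blinfun.add_left tensor_op_add_operator tensor_op_scale_operator lin
        iota_simps tensor_op_mem)
  show "extension S T o\<^sub>L extension S' T' = extension (S o\<^sub>L S') (T o\<^sub>L T')"
    if "S' \<in> approximable" "T' \<in> approximable"
    using S T that by (intro extension_eqI[symmetric])
      (simp_all add: extends_tensor_op_def ext tensor_op_compose lin tensor_op_mem)
next
  show "0 \<le> K" using K_pos by simp
  \<comment> \<open>By uniqueness each operator occurring in condition (ii) is a value of
    \<open>extension\<close>.\<close>
  have "{R. \<exists>S\<in>approximable. \<exists>T\<in>approximable. extends_tensor_op \<iota> S T R} \<subseteq>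
      {extension S T | S T. S \<in> approximable \<and> T \<in> approximable}"
    using extension_eqI by blast
  from closure_mono[OF complex_vector.span_mono[OF this]]
  show "approximable \<subseteq> closure (complex_vector.span
      {extension S T | S T. S \<in> approximable \<and> T \<in> approximable})"
    unfolding dense .
qed

end

theorem theorem2p2:
  fixes \<alpha> :: "('x::complex_banach, 'y::complex_banach) tensor \<Rightarrow> real"
    and \<iota> :: "('x, 'y) tensor \<Rightarrow> 'w::complex_banach"
  assumes "\<not> (\<exists>B :: 'x set. finite B \<and> complex_vector.span B = UNIV)"
    and "\<not> (\<exists>B :: 'y set. finite B \<and> complex_vector.span B = UNIV)"
    and "crossnorm \<alpha>"
    and "is_completion \<alpha> \<iota>"
    and "amenable TYPE(('x \<Rightarrow>\<^sub>L 'x) module_universe) (approximable :: ('x \<Rightarrow>\<^sub>L 'x) set) (o\<^sub>L)"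
    and "amenable TYPE(('y \<Rightarrow>\<^sub>L 'y) module_universe) (approximable :: ('y \<Rightarrow>\<^sub>L 'y) set) (o\<^sub>L)"
    and "tight_tensor_product \<alpha> \<iota>"
  shows "amenable TYPE('z) (approximable :: ('w \<Rightarrow>\<^sub>L 'w) set) (o\<^sub>L)"
proof -
  obtain K where "tight \<alpha> \<iota> K"
    using assms(3,4,7) unfolding tight_tensor_product_def tight_def by blast
  then interpret tight \<alpha> \<iota> K .
  obtain M where M: "X.virtual_diagonal M" by (rule X.amenable_virtual_diagonal[OF assms(5)])
  obtain N where N: "Y.virtual_diagonal N" by (rule Y.amenable_virtual_diagonal[OF assms(6)])
  \<comment> \<open>A virtual diagonal serves modules over every type, hence the arbitrary
    \<open>'z\<close>, although the factors were tested over \<open>module_universe\<close>.\<close>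
  show ?thesis by (rule W.virtual_diagonal_amenable[OF virtual_diagonal_tensor[OF M N]])
qed

end
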